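(* Let $V\subset\mathcal{O}(\mathbb{C})$ be an infinite-dimensional quasi-Banach space with continuous inclusion. Let $f:\mathbb{C}\to\mathbb{C}$ be entire, let $u\in\mathcal{O}(\mathbb{C})\setminus\{0\}$, and assume that $uC_f$ is bounded on $V$. Then there exist $a,b\in\mathbb{C}$ with $|a|\le1$ such that $f(z)=az+b$ for all $z\in\mathbb{C}$.
   Context: $\mathcal{O}(\mathbb{C})$ is the space of entire functions with the topology of uniform convergence on compact sets. A quasi-Banach space is a complete Hausdorff topological vector space whose topology is given by a quasi-norm: a map $\|\cdot\|_V:V\to\mathbb{R}_{\ge0}$ with $\|av\|_V=|a|\|v\|_V$, $\|v+w\|_V\le K(\|v\|_V+\|w\|_V)$ for some $K\ge1$ independent of $v,w$, and $\|v\|_V=0\Rightarrow v=0$. "$V\subset\mathcal{O}(\mathbb{C})$ with continuous inclusion" means $V$ is a complex linear subspace of $\mathcal{O}(\mathbb{C})$, with its own topology, such that the inclusion is continuous. The weighted composition operator $uC_f$ on $V$ is $h\mapsto u\cdot(h\circ f)$ with domain $\{h\in V:u\cdot(h\circ f)\in V\}$; it is bounded on $V$ if its domain is all of $V$ and it is a bounded operator $V\to V$. *)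

theory Defs
  imports "HOL-Analysis.Analysis" "HOL-Library.Function_Algebras"
begin

text \<open>Functions \<open>complex \<Rightarrow> complex\<close> carry the pointwise addition and zero of
  \<^theory>\<open>HOL-Library.Function_Algebras\<close>; the complex scalar multiplication is added here.\<close>

definition cscale :: "complex \<Rightarrow> (complex \<Rightarrow> complex) \<Rightarrow> complex \<Rightarrow> complex"
  where "cscale c h = (\<lambda>z. c * h z)"

global_interpretation cfun: vector_space cscale
  defines cfun_span = "module.span cscale"
    and cfun_subspace = "module.subspace cscale"
  by unfold_locales (auto simp: cscale_def fun_eq_iff algebra_simps)

definition infinite_dimensional :: "(complex \<Rightarrow> complex) set \<Rightarrow> bool"
  where "infinite_dimensional V \<longleftrightarrow> (\<nexists>B. finite B \<and> B \<subseteq> V \<and> V \<subseteq> cfun_span B)"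

definition entire_functions :: "(complex \<Rightarrow> complex) set"
  where "entire_functions = {h. h holomorphic_on UNIV}"

text \<open>The topology of uniform convergence on compact sets: a neighbourhood base at \<open>h\<close> is given by
  the sets of entire \<open>g\<close> with \<open>norm (g z - h z) < e\<close> on a compact set \<open>K\<close>.\<close>

definition entire_topology :: "(complex \<Rightarrow> complex) topology"
  where "entire_topology = topology (\<lambda>U. U \<subseteq> entire_functions \<and>
    (\<forall>h\<in>U. \<exists>K e. compact K \<and> e > 0 \<and>
       (\<forall>g\<in>entire_functions. (\<forall>z\<in>K. norm (g z - h z) < e) \<longrightarrow> g \<in> U)))"

lemma openin_entire_topology:
  "openin entire_topology U \<longleftrightarrow> U \<subseteq> entire_functions \<and>
    (\<forall>h\<in>U. \<exists>K e. compact K \<and> e > 0 \<and>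
       (\<forall>g\<in>entire_functions. (\<forall>z\<in>K. norm (g z - h z) < e) \<longrightarrow> g \<in> U))"
proof -
  let ?P = "\<lambda>U h. \<exists>K e. compact K \<and> e > (0::real) \<and>
       (\<forall>g\<in>entire_functions. (\<forall>z\<in>K. norm (g z - h z) < e) \<longrightarrow> g \<in> U)"
  have int: "?P (S \<inter> T) h" if S: "?P S h" and T: "?P T h" for S T h
  proof -
    from S obtain K e where K: "compact K" "e > 0"
      "\<forall>g\<in>entire_functions. (\<forall>z\<in>K. norm (g z - h z) < e) \<longrightarrow> g \<in> S"
      by (elim exE conjE)
    from T obtain L d where L: "compact L" "d > 0"
      "\<forall>g\<in>entire_functions. (\<forall>z\<in>L. norm (g z - h z) < d) \<longrightarrow> g \<in> T"
      by (elim exE conjE)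
    have "compact (K \<union> L)" using K(1) L(1) by (rule compact_Un)
    moreover have "min e d > 0" using K(2) L(2) by simp
    moreover have "\<forall>g\<in>entire_functions.
        (\<forall>z\<in>K \<union> L. norm (g z - h z) < min e d) \<longrightarrow> g \<in> S \<inter> T"
      using K(3) L(3) by simp
    ultimately show ?thesis by (intro exI conjI)
  qed
  have "istopology (\<lambda>U. U \<subseteq> entire_functions \<and> (\<forall>h\<in>U. ?P U h))"
    unfolding istopology_def
  proof (intro conjI allI impI)
    fix S T
    assume "S \<subseteq> entire_functions \<and> (\<forall>h\<in>S. ?P S h)" "T \<subseteq> entire_functions \<and> (\<forall>h\<in>T. ?P T h)"
    then show "S \<inter> T \<subseteq> entire_functions" "\<forall>h\<in>S \<inter> T. ?P (S \<inter> T) h"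
      by (blast, intro ballI int) simp_all
  next
    fix \<S>
    assume *: "\<forall>S\<in>\<S>. S \<subseteq> entire_functions \<and> (\<forall>h\<in>S. ?P S h)"
    then show "\<Union>\<S> \<subseteq> entire_functions" by blast
    show "\<forall>h\<in>\<Union>\<S>. ?P (\<Union>\<S>) h"
    proof
      fix h assume "h \<in> \<Union>\<S>"
      then obtain S where S: "S \<in> \<S>" "h \<in> S" by (rule UnionE)
      from * S have "?P S h" by simp
      then obtain K e where K: "compact K" "e > 0"
        "\<forall>g\<in>entire_functions. (\<forall>z\<in>K. norm (g z - h z) < e) \<longrightarrow> g \<in> S"
        by (elim exE conjE)
      from K(3) have "\<forall>g\<in>entire_functions. (\<forall>z\<in>K. norm (g z - h z) < e) \<longrightarrow> g \<in> \<Union>\<S>"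
        using S(1) by (simp add: Union_iff) blast
      with K(1,2) show "?P (\<Union>\<S>) h" by (intro exI conjI)
    qed
  qed
  then show ?thesis
    unfolding entire_topology_def by (simp only: topology_inverse')
qed

definition quasi_norm_on ::
    "(complex \<Rightarrow> complex) set \<Rightarrow> ((complex \<Rightarrow> complex) \<Rightarrow> real) \<Rightarrow> bool"
  where "quasi_norm_on V N \<longleftrightarrow>
    (\<forall>v\<in>V. 0 \<le> N v) \<and>
    (\<forall>a. \<forall>v\<in>V. N (cscale a v) = norm a * N v) \<and>
    (\<exists>K\<ge>1. \<forall>v\<in>V. \<forall>w\<in>V. N (v + w) \<le> K * (N v + N w)) \<and>
    (\<forall>v\<in>V. N v = 0 \<longrightarrow> v = 0)"

text \<open>Balls of a quasi-norm need not be open, but they are neighbourhoods of their centres; hence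
  the open sets are described directly instead of being generated by the balls.\<close>

definition quasi_norm_topology ::
    "(complex \<Rightarrow> complex) set \<Rightarrow> ((complex \<Rightarrow> complex) \<Rightarrow> real) \<Rightarrow> (complex \<Rightarrow> complex) topology"
  where "quasi_norm_topology V N = topology (\<lambda>U. U \<subseteq> V \<and>
    (\<forall>v\<in>U. \<exists>r>0. \<forall>w\<in>V. N (w - v) < r \<longrightarrow> w \<in> U))"

lemma openin_quasi_norm_topology:
  "openin (quasi_norm_topology V N) U \<longleftrightarrow>
    U \<subseteq> V \<and> (\<forall>v\<in>U. \<exists>r>0. \<forall>w\<in>V. N (w - v) < r \<longrightarrow> w \<in> U)"
proof -
  let ?P = "\<lambda>U v. \<exists>r>0. \<forall>w\<in>V. N (w - v) < r \<longrightarrow> w \<in> U"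
  have int: "?P (S \<inter> T) v" if S: "?P S v" and T: "?P T v" for S T v
  proof -
    obtain r where r: "r > 0" "\<forall>w\<in>V. N (w - v) < r \<longrightarrow> w \<in> S" using S by blast
    obtain s where s: "s > 0" "\<forall>w\<in>V. N (w - v) < s \<longrightarrow> w \<in> T" using T by blast
    show ?thesis
      using r s by (intro exI[of _ "min r s"]) auto
  qed
  have "istopology (\<lambda>U. U \<subseteq> V \<and> (\<forall>v\<in>U. ?P U v))"
    unfolding istopology_def
  proof (intro conjI allI impI)
    fix S T
    assume "S \<subseteq> V \<and> (\<forall>v\<in>S. ?P S v)" "T \<subseteq> V \<and> (\<forall>v\<in>T. ?P T v)"
    then show "S \<inter> T \<subseteq> V" "\<forall>v\<in>S \<inter> T. ?P (S \<inter> T) v"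
      by (blast, intro ballI int) simp_all
  next
    fix \<S>
    assume *: "\<forall>S\<in>\<S>. S \<subseteq> V \<and> (\<forall>v\<in>S. ?P S v)"
    then show "\<Union>\<S> \<subseteq> V" by blast
    show "\<forall>v\<in>\<Union>\<S>. ?P (\<Union>\<S>) v"
    proof
      fix v assume "v \<in> \<Union>\<S>"
      then obtain S where S: "S \<in> \<S>" "v \<in> S" by blast
      with * obtain r where "r > 0" "\<forall>w\<in>V. N (w - v) < r \<longrightarrow> w \<in> S" by blast
      then show "?P (\<Union>\<S>) v"
        using S(1) by (intro exI[of _ r]) auto
    qed
  qed
  then show ?thesis
    unfolding quasi_norm_topology_def by (simp only: topology_inverse')
qed

definition topological_vector_space ::
    "(complex \<Rightarrow> complex) set \<Rightarrow> (complex \<Rightarrow> complex) topology \<Rightarrow> bool"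
  where "topological_vector_space V T \<longleftrightarrow>
    cfun_subspace V \<and> topspace T = V \<and>
    continuous_map (prod_topology T T) T (\<lambda>(v, w). v + w) \<and>
    continuous_map (prod_topology euclidean T) T (\<lambda>(c, v). cscale c v)"

definition tvs_Cauchy_filter :: "(complex \<Rightarrow> complex) topology \<Rightarrow> (complex \<Rightarrow> complex) filter \<Rightarrow> bool"
  where "tvs_Cauchy_filter T F \<longleftrightarrow> F \<noteq> bot \<and> F \<le> principal (topspace T) \<and>
    (\<forall>U. openin T U \<and> 0 \<in> U \<longrightarrow>
       (\<exists>A. (\<forall>\<^sub>F v in F. v \<in> A) \<and> (\<forall>v\<in>A. \<forall>w\<in>A. v - w \<in> U)))"

definition tvs_complete :: "(complex \<Rightarrow> complex) topology \<Rightarrow> bool"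
  where "tvs_complete T \<longleftrightarrow> (\<forall>F. tvs_Cauchy_filter T F \<longrightarrow> (\<exists>v. limitin T (\<lambda>w. w) v F))"

definition quasi_Banach_space ::
    "(complex \<Rightarrow> complex) set \<Rightarrow> ((complex \<Rightarrow> complex) \<Rightarrow> real) \<Rightarrow> bool"
  where "quasi_Banach_space V N \<longleftrightarrow>
    quasi_norm_on V N \<and>
    topological_vector_space V (quasi_norm_topology V N) \<and>
    Hausdorff_space (quasi_norm_topology V N) \<and>
    tvs_complete (quasi_norm_topology V N)"

definition continuously_included ::
    "(complex \<Rightarrow> complex) set \<Rightarrow> ((complex \<Rightarrow> complex) \<Rightarrow> real) \<Rightarrow> bool"
  where "continuously_included V N \<longleftrightarrow>
    V \<subseteq> entire_functions \<and> continuous_map (quasi_norm_topology V N) entire_topology (\<lambda>v. v)"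

definition weighted_comp ::
    "(complex \<Rightarrow> complex) \<Rightarrow> (complex \<Rightarrow> complex) \<Rightarrow> (complex \<Rightarrow> complex) \<Rightarrow> complex \<Rightarrow> complex"
  where "weighted_comp u f h = (\<lambda>z. u z * h (f z))"

definition weighted_comp_domain ::
    "(complex \<Rightarrow> complex) set \<Rightarrow> (complex \<Rightarrow> complex) \<Rightarrow> (complex \<Rightarrow> complex) \<Rightarrow> (complex \<Rightarrow> complex) set"
  where "weighted_comp_domain V u f = {h \<in> V. weighted_comp u f h \<in> V}"

text \<open>Linearity is automatic for \<^const>\<open>weighted_comp\<close>, so only the norm bound is required.\<close>

definition weighted_comp_bounded ::
    "(complex \<Rightarrow> complex) set \<Rightarrow> ((complex \<Rightarrow> complex) \<Rightarrow> real)
      \<Rightarrow> (complex \<Rightarrow> complex) \<Rightarrow> (complex \<Rightarrow> complex) \<Rightarrow> bool"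
  where "weighted_comp_bounded V N u f \<longleftrightarrow>
    weighted_comp_domain V u f = V \<and> (\<exists>C. \<forall>h\<in>V. N (weighted_comp u f h) \<le> C * N h)"

end

theory Submission
  imports Defs "HOL-Complex_Analysis.Complex_Analysis"
begin

text \<open>Let \<open>T\<close> be the weighted composition operator. The claim follows from two facts: \<open>f\<close> has no repelling periodic
point, and every entire map not of the form \<open>\<lambda>z. a * z + b\<close> with \<open>norm a \<le> 1\<close> has one.

The first fact is a comparison of growth rates. Powers of \<open>T\<close> are bounded weighted composition operators along
iterates of \<open>f\<close>, so consider a fixed point \<open>p\<close> with multiplier \<open>\<mu>\<close>, \<open>norm \<mu> > 1\<close>. If \<open>h\<close> vanishes to order
\<open>k\<close> at \<open>p\<close>, each application of the operator multiplies the leading Taylor coefficient of \<open>h\<close> at \<open>p\<close> by a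
constant times a power of \<open>\<mu>\<close> with exponent at least \<open>k\<close>. Since \<open>V\<close> is infinite-dimensional, it contains
functions \<open>h \<noteq> 0\<close> for which \<open>k\<close> is as large as desired, and then the coefficients grow faster than the
quasi-norms. As the inclusion into the entire functions is continuous, quasi-norms control Taylor
coefficients, which is a contradiction (\<open>repelling_fixpoint_unbounded\<close>).

The second fact is immediate for affine maps. For the others it is a theorem of Fatou and Baker, proved here by
rescaling (\<open>repelling_periodic_point\<close>). Let the Julia set consist of the points near which the spherical
derivatives of the iterates are unbounded. If it is finite, the iterates tend to infinity locally uniformly
outside of it, because they are unbounded on large circles (\<open>iterates_unbounded_on_circles\<close>). The second iterate
has a fixed point by Picard's theorem; it must be an isolated point of the Julia set, and the minimum
principle shows that it is repelling (\<open>finite_Julia_imp_repelling_fixpoint\<close>).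

If the Julia set is infinite, take five of its points. At each of them a rescaled sequence of iterates converges to
an entire function \<open>g\<close> that is not constant and has bounded spherical derivative (\<open>Zalcman\<close>). Such a \<open>g\<close> has a
simple point over one of the five values (\<open>five_totally_ramified_values\<close>). So there is an inverse
branch of an iterate that maps a fixed disc about one of the five points into a tiny disc about the point that
was rescaled (\<open>Julia_island\<close>). Following these branches among five points one meets a cycle; the composition
along the cycle contracts a disc into itself, and its fixed point is a repelling periodic point of \<open>f\<close>.\<close>

section \<open>Growth of the iterates of a map that is not affine\<close>

definition affine_map :: "(complex \<Rightarrow> complex) \<Rightarrow> bool"
  where "affine_map f \<longleftrightarrow> (\<exists>a b. \<forall>z. f z = a * z + b)"

lemma max_modulus_sphere:
  fixes f :: "complex \<Rightarrow> complex"
  assumes holf: "f holomorphic_on UNIV" and "norm w \<le> r" and "0 < r"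
  obtains z where "norm z = r" "norm (f w) \<le> norm (f z)"
proof -
  have "continuous_on (sphere 0 r) (\<lambda>z. norm (f z))"
    by (intro continuous_intros holomorphic_on_imp_continuous_on holomorphic_on_subset[OF holf]) auto
  moreover have "sphere (0::complex) r \<noteq> {}" using \<open>0 < r\<close> by simp
  ultimately obtain z where z: "z \<in> sphere 0 r" "\<And>y. y \<in> sphere 0 r \<Longrightarrow> norm (f y) \<le> norm (f z)"
    using continuous_attains_sup[OF compact_sphere] by blast
  have "norm (f w) \<le> norm (f z)"
  proof (rule maximum_modulus_frontier[where S = "cball 0 r" and f = f and \<xi> = w])
    show "f holomorphic_on interior (cball 0 r)" using holf holomorphic_on_subset by blast
    show "continuous_on (closure (cball 0 r)) f"
      using holf holomorphic_on_imp_continuous_on continuous_on_subset by blast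
    show "\<And>y. y \<in> frontier (cball 0 r) \<Longrightarrow> norm (f y) \<le> norm (f z)"
      using z(2) by (simp add: frontier_cball)
  qed (use assms in auto)
  with z(1) that show thesis by auto
qed

text \<open>Liouville's theorem applied to the difference quotient \<open>(f z - f 0) / z\<close>, which is entire and, since
\<open>f\<close> is not affine, not constant. The maximum principle turns one large value of the quotient into a
large value on every bigger circle.\<close>

lemma entire_superlinear:
  fixes f :: "complex \<Rightarrow> complex"
  assumes holf: "f holomorphic_on UNIV" and nonaff: "\<not> affine_map f"
  obtains r0 where "0 < r0" "\<And>r. r0 \<le> r \<Longrightarrow> \<exists>z. norm z = r \<and> C * r < norm (f z)"
proof -
  define g where "g = (\<lambda>z. if z = 0 then deriv f 0 else (f z - f 0) / (z - 0))"
  have holg: "g holomorphic_on UNIV"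
    unfolding g_def by (rule pole_lemma_open[OF holf open_UNIV])
  have fg: "f z = g z * z + f 0" for z
    by (simp add: g_def)
  have "\<not> g constant_on UNIV"
    using nonaff fg unfolding affine_map_def constant_on_def by (metis UNIV_I)
  then have "\<not> bounded (range g)" using Liouville_theorem[OF holg] by blast
  then obtain w where w: "norm (g w) > \<bar>C\<bar> + 1"
    unfolding bounded_iff by (metis imageE not_le)
  show thesis
  proof (rule that[of "norm w + norm (f 0) + 1"])
    show "0 < norm w + norm (f 0) + 1" by (smt (verit) norm_ge_zero)
    fix r assume r: "norm w + norm (f 0) + 1 \<le> r"
    then have "norm w \<le> r" "0 < r" "norm (f 0) < r" using norm_ge_zero[of w] norm_ge_zero[of "f 0"] by linarith+
    then obtain z where z: "norm z = r" "norm (g w) \<le> norm (g z)"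
      using max_modulus_sphere[OF holg] by blast
    have "(\<bar>C\<bar> + 1) * r < norm (g z) * r"
      using w z(2) \<open>0 < r\<close> by (intro mult_strict_right_mono) auto
    also have "\<dots> = norm (f z - f 0)"
      by (simp add: fg[of z] norm_mult z(1))
    also have "\<dots> \<le> norm (f z) + norm (f 0)" by (rule norm_triangle_ineq4)
    finally have "(\<bar>C\<bar> + 1) * r < norm (f z) + norm (f 0)" .
    then have "C * r < norm (f z)"
      using \<open>norm (f 0) < r\<close> mult_right_mono[of C "\<bar>C\<bar>" r] \<open>0 < r\<close>
      unfolding distrib_right by linarith
    with z(1) show "\<exists>z. norm z = r \<and> C * r < norm (f z)" by blast
  qed
qed

text \<open>The bound of Schottky's theorem at two thirds of the radius of the disc.\<close>

definition Schottky_bound :: "real \<Rightarrow> real"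
  where "Schottky_bound B = exp (pi * exp (pi * (2 + 2 * B + 24)))"

lemma Schottky_disc:
  assumes holF: "F holomorphic_on cball c \<rho>" and "0 < \<rho>"
    and omit: "\<And>z. z \<in> cball c \<rho> \<Longrightarrow> F z \<noteq> 0 \<and> F z \<noteq> 1"
    and B: "norm (F c) \<le> B" and z: "norm (z - c) \<le> 2 / 3 * \<rho>"
  shows "norm (F z) \<le> Schottky_bound B"
proof -
  have sub: "c + of_real \<rho> * \<zeta> \<in> cball c \<rho>" if "\<zeta> \<in> cball 0 1" for \<zeta>
    using that \<open>0 < \<rho>\<close> by (simp add: dist_norm norm_mult mult_left_le)
  have "norm ((\<lambda>\<zeta>. F (c + of_real \<rho> * \<zeta>)) ((z - c) / of_real \<rho>))
      \<le> exp (pi * exp (pi * (2 + 2 * B + 12 * (2/3) / (1 - 2/3))))"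
  proof (rule Schottky[where f = "\<lambda>\<zeta>. F (c + of_real \<rho> * \<zeta>)" and z = "(z - c) / of_real \<rho>"])
    have "F \<circ> (\<lambda>\<zeta>. c + of_real \<rho> * \<zeta>) holomorphic_on cball 0 1"
      by (rule holomorphic_on_compose_gen[OF _ holF]) (use sub in \<open>auto intro!: holomorphic_intros\<close>)
    then show "(\<lambda>\<zeta>. F (c + of_real \<rho> * \<zeta>)) holomorphic_on cball 0 1" by (simp add: o_def)
    show "norm ((z - c) / of_real \<rho>) \<le> 2 / 3"
      using z \<open>0 < \<rho>\<close> by (simp add: norm_divide field_simps)
  qed (use B omit sub in auto)
  moreover have "c + of_real \<rho> * ((z - c) / of_real \<rho>) = z" using \<open>0 < \<rho>\<close> by simp
  ultimately show ?thesis by (simp add: Schottky_bound_def)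
qed

text \<open>Polya's argument. If the image of the disc of radius \<open>r\<close> missed a point \<open>w1\<close> of modulus \<open>2 * r\<close> and a
point \<open>w2\<close> of modulus \<open>4 * r\<close>, then \<open>(f z - w1) / (w2 - w1)\<close> would omit 0 and 1, and Schottky's theorem
would bound \<open>f\<close> on the disc of radius \<open>r / 2\<close> by a fixed multiple of \<open>r\<close>. A map that is not affine
grows faster than that.\<close>

lemma image_contains_circle:
  fixes f :: "complex \<Rightarrow> complex"
  assumes holf: "f holomorphic_on UNIV" and nonaff: "\<not> affine_map f"
  obtains r0 :: real where "0 < r0"
    "\<And>r. r0 \<le> r \<Longrightarrow> \<exists>s \<ge> 2 * r. sphere 0 s \<subseteq> f ` ball 0 r"
proof -
  define C where "C = Schottky_bound 2"
  have "0 < C" unfolding C_def Schottky_bound_def by simp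
  \<comment> \<open>On the circle of radius \<open>r / 2\<close> this gives a value larger than \<open>C * (6 * r) + 2 * r\<close>, the bound that Schottky's theorem yields below.\<close>
  obtain r1 where r1: "0 < r1" "\<And>r. r1 \<le> r \<Longrightarrow> \<exists>z. norm z = r \<and> (12 * C + 4) * r < norm (f z)"
    using entire_superlinear[OF assms] by blast
  show thesis
  proof (rule that[of "2 * r1 + norm (f 0)"])
    show "0 < 2 * r1 + norm (f 0)" using r1(1) by (simp add: add_pos_nonneg)
    fix r assume r: "2 * r1 + norm (f 0) \<le> r"
    have "0 < r" "norm (f 0) \<le> r" "r1 \<le> r / 2" using r r1(1) norm_ge_zero[of "f 0"] by linarith+
    show "\<exists>s \<ge> 2 * r. sphere 0 s \<subseteq> f ` ball 0 r"
    proof (rule ccontr)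
      assume contr: "\<not> ?thesis"
      from contr have "\<not> sphere 0 (2 * r) \<subseteq> f ` ball 0 r" "\<not> sphere 0 (4 * r) \<subseteq> f ` ball 0 r"
        using \<open>0 < r\<close> by auto
      then obtain w1 w2 where w: "norm w1 = 2 * r" "w1 \<notin> f ` ball 0 r" "norm w2 = 4 * r" "w2 \<notin> f ` ball 0 r"
        by (auto simp: subset_iff)
      have d: "2 * r \<le> norm (w2 - w1)" "norm (w2 - w1) \<le> 6 * r"
        using norm_triangle_ineq2[of w2 w1] norm_triangle_ineq4[of w2 w1] w by auto
      then have "w2 \<noteq> w1" using \<open>0 < r\<close> by auto
      obtain z where z: "norm z = r / 2" "(12 * C + 4) * (r / 2) < norm (f z)"
        using r1(2)[OF \<open>r1 \<le> r / 2\<close>] by blast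
      have "norm ((f z - w1) / (w2 - w1)) \<le> Schottky_bound 2"
      proof (rule Schottky_disc[where F = "\<lambda>z. (f z - w1) / (w2 - w1)" and c = 0 and \<rho> = "3 / 4 * r"])
        show "(\<lambda>z. (f z - w1) / (w2 - w1)) holomorphic_on cball 0 (3 / 4 * r)"
          using \<open>w2 \<noteq> w1\<close> by (intro holomorphic_intros holomorphic_on_subset[OF holf]) auto
        have "norm (f 0 - w1) \<le> 3 * r"
          using norm_triangle_ineq4[of "f 0" w1] w(1) \<open>norm (f 0) \<le> r\<close> by linarith
        then show "norm ((f 0 - w1) / (w2 - w1)) \<le> 2"
          using d(1) \<open>0 < r\<close> \<open>w2 \<noteq> w1\<close> by (simp add: norm_divide divide_le_eq)
        fix x :: complex assume "x \<in> cball 0 (3 / 4 * r)"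
        then have "x \<in> ball 0 r" using \<open>0 < r\<close> by auto
        then show "(f x - w1) / (w2 - w1) \<noteq> 0 \<and> (f x - w1) / (w2 - w1) \<noteq> 1"
          using w \<open>w2 \<noteq> w1\<close> by auto
      qed (use \<open>0 < r\<close> z in auto)
      then have "norm (f z - w1) \<le> C * norm (w2 - w1)"
        using \<open>w2 \<noteq> w1\<close> by (simp add: C_def norm_divide divide_le_eq)
      also have "\<dots> \<le> C * (6 * r)" using d(2) \<open>0 < C\<close> by (intro mult_left_mono) auto
      finally have "norm (f z) \<le> C * (6 * r) + 2 * r"
        using norm_triangle_sub[of "f z" w1] w(1) by linarith
      with z(2) show False by (simp add: algebra_simps)
    qed
  qed
qed

lemma holomorphic_funpow [holomorphic_intros]:
  assumes "f holomorphic_on UNIV" shows "(f ^^ n) holomorphic_on UNIV"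
proof (induction n)
  case (Suc n)
  have "f \<circ> (f ^^ n) holomorphic_on UNIV"
    by (rule holomorphic_on_compose_gen[OF Suc assms]) auto
  then show ?case by (simp add: o_def)
qed (simp add: id_def)

text \<open>A circle covered by the image of a disc passes its large values on to that disc, and each application of
\<open>f\<close> at least doubles the radius that is covered. This is what excludes finite limit functions of the
iterates on a set that contains large circles.\<close>

lemma iterates_unbounded_on_circles:
  fixes f :: "complex \<Rightarrow> complex"
  assumes holf: "f holomorphic_on UNIV" and nonaff: "\<not> affine_map f"
  obtains r0 where "0 < r0"
    "\<And>r n. r0 \<le> r \<Longrightarrow> \<exists>z. norm z = r \<and> 2 ^ n * r \<le> norm ((f ^^ n) z)"
proof -
  obtain r0 where r0: "0 < r0" "\<And>r. r0 \<le> r \<Longrightarrow> \<exists>s \<ge> 2 * r. sphere 0 s \<subseteq> f ` ball 0 r"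
    using image_contains_circle[OF assms] by blast
  show thesis
  proof (rule that[OF r0(1)])
    show "\<exists>z. norm z = r \<and> 2 ^ n * r \<le> norm ((f ^^ n) z)" if "r0 \<le> r" for r n
      using that
    proof (induction n arbitrary: r)
      case 0
      then show ?case using r0(1) by (intro exI[of _ "of_real r"]) auto
    next
      case (Suc n)
      have "0 < r" using Suc.prems r0(1) by linarith
      obtain s where s: "s \<ge> 2 * r" "sphere 0 s \<subseteq> f ` ball 0 r" using r0(2) Suc.prems by blast
      then have "r0 \<le> s" using Suc.prems \<open>0 < r\<close> by linarith
      then obtain w where w: "norm w = s" "2 ^ n * s \<le> norm ((f ^^ n) w)" using Suc.IH by blast
      then obtain y where y: "norm y < r" "f y = w" using s(2) by (auto simp: subset_iff image_iff)
      obtain z where z: "norm z = r" "norm ((f ^^ Suc n) y) \<le> norm ((f ^^ Suc n) z)"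
        using max_modulus_sphere[OF holomorphic_funpow[OF holf]] y(1) \<open>0 < r\<close> by (metis less_imp_le)
      have "2 ^ Suc n * r \<le> 2 ^ n * s" using s(1) by simp
      also have "\<dots> \<le> norm ((f ^^ Suc n) y)" using w(2) y(2) by (simp add: funpow_swap1)
      finally show ?case using z by (intro exI[of _ z]) auto
    qed
  qed
qed

section \<open>Functions with bounded spherical derivative\<close>

text \<open>The spherical derivative of \<open>F\<close> is \<open>norm (deriv F z) / (1 + (norm (F z))\<^sup>2)\<close>. Bounds on it survive the
passage of \<open>F\<close> through infinity, so they describe normality of families whose limit may be the
constant infinity.\<close>

definition spherically_bounded :: "real \<Rightarrow> complex set \<Rightarrow> (complex \<Rightarrow> complex) \<Rightarrow> bool"
  where "spherically_bounded K S F \<longleftrightarrow> (\<forall>z\<in>S. norm (deriv F z) \<le> K * (1 + (norm (F z))\<^sup>2))"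

text \<open>Until the first point of the segment at which the modulus reaches \<open>R + 1\<close>, the derivative of \<open>F\<close> is at most
\<open>K * (1 + (R + 1)\<^sup>2)\<close>; a short segment leaves no room for the modulus to grow by 1.\<close>

lemma spherically_bounded_growth:
  assumes holF: "F holomorphic_on S" and "open S" and seg: "closed_segment w0 w1 \<subseteq> S"
    and sph: "spherically_bounded K S F" and "0 \<le> K"
    and R: "norm (F w0) \<le> R" "0 \<le> R" and small: "K * (1 + (R + 1)\<^sup>2) * norm (w1 - w0) < 1"
  shows "norm (F w1) \<le> R + 1"
proof (rule ccontr)
  assume big: "\<not> norm (F w1) \<le> R + 1"
  define p where "p = (\<lambda>t. linepath w0 w1 t)"
  define T where "T = {t\<in>{0..1}. R + 1 \<le> norm (F (p t))}"
  have pS: "p t \<in> S" if "t \<in> {0..1}" for t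
    using that seg unfolding p_def by (metis linepath_in_path subsetD)
  have contp: "continuous_on {0..1} p" unfolding p_def by (rule continuous_on_linepath)
  have "continuous_on {0..1} (F \<circ> p)"
    by (rule continuous_on_compose[OF contp], rule continuous_on_subset[OF holomorphic_on_imp_continuous_on[OF holF]])
       (use pS in auto)
  then have cont: "continuous_on {0..1} (\<lambda>t. norm (F (p t)))"
    by (intro continuous_on_norm) (simp add: o_def)
  have "closed T" unfolding T_def
    by (rule continuous_on_closed_Collect_le[OF continuous_on_const cont closed_atLeastAtMost])
  moreover have "bounded T" by (rule bounded_subset[OF bounded_closed_interval[of 0 1]]) (auto simp: T_def)
  ultimately have "compact T" by (simp add: compact_eq_bounded_closed)
  moreover have "1 \<in> T" using big by (simp add: T_def p_def linepath_1')
  ultimately obtain t0 where t0: "t0 \<in> T" "\<And>t. t \<in> T \<Longrightarrow> t0 \<le> t"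
    using compact_attains_inf[of T] by blast
  have t01: "t0 \<in> {0..1}" using t0(1) by (simp add: T_def)
  have below: "norm (F (p t)) \<le> R + 1" if "t \<in> {0..t0}" for t
  proof (cases "t0 = 0")
    case True then show ?thesis using that R by (simp add: p_def linepath_0')
  next
    case False
    have "\<forall>t\<in>{0..<t0}. norm (F (p t)) \<le> R + 1"
      using t0(2) t01 by (force simp: T_def)
    moreover have "closure {0..<t0} = {0..t0}" using False t01 by simp
    moreover have "continuous_on {0..t0} (\<lambda>t. norm (F (p t)))"
      by (rule continuous_on_subset[OF cont]) (use t01 in auto)
    ultimately show ?thesis
      using continuous_le_on_closure[of "{0..<t0}" "\<lambda>t. norm (F (p t))" t "R+1"] that by auto
  qed
  have seg0: "\<exists>t\<in>{0..t0}. x = p t" if x: "x \<in> closed_segment w0 (p t0)" for x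
  proof -
    obtain s where s: "0 \<le> s" "s \<le> 1" "x = (1 - s) *\<^sub>R w0 + s *\<^sub>R p t0"
      using x unfolding closed_segment_def by blast
    have "x = p (s * t0)" unfolding s(3) p_def linepath_def by (simp add: algebra_simps)
    moreover have "s * t0 \<in> {0..t0}" using s(1,2) t01 mult_left_le_one_le[of t0 s] by auto
    ultimately show ?thesis by blast
  qed
  have "norm (F (p t0) - F w0) \<le> (K * (1 + (R + 1)\<^sup>2)) * norm (p t0 - w0)"
  proof (rule field_differentiable_bound[where S = "closed_segment w0 (p t0)" and f' = "deriv F"])
    fix x assume x: "x \<in> closed_segment w0 (p t0)"
    then obtain t where t: "t \<in> {0..t0}" "x = p t" using seg0 by blast
    then have xS: "x \<in> S" using pS t01 by auto
    show "(F has_field_derivative deriv F x) (at x within closed_segment w0 (p t0))"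
      using holF \<open>open S\<close> xS by (metis has_field_derivative_at_within holomorphic_derivI)
    have "norm (F x) \<le> R + 1" using below t by simp
    then have "(norm (F x))\<^sup>2 \<le> (R + 1)\<^sup>2" by (intro power_mono) auto
    then have "K * (1 + (norm (F x))\<^sup>2) \<le> K * (1 + (R + 1)\<^sup>2)"
      using \<open>0 \<le> K\<close> by (intro mult_left_mono) auto
    moreover have "norm (deriv F x) \<le> K * (1 + (norm (F x))\<^sup>2)"
      using sph xS by (simp add: spherically_bounded_def)
    ultimately show "norm (deriv F x) \<le> K * (1 + (R + 1)\<^sup>2)" by linarith
  qed (auto simp: convex_closed_segment)
  also have "norm (p t0 - w0) \<le> norm (w1 - w0)"
  proof -
    have "p t0 - w0 = t0 *\<^sub>R (w1 - w0)" by (simp add: p_def linepath_def algebra_simps)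
    then show ?thesis using t01 by (simp add: mult_left_le_one_le)
  qed
  finally have "norm (F (p t0) - F w0) < 1"
    using small \<open>0 \<le> K\<close> by (smt (verit) mult_left_mono mult_nonneg_nonneg zero_le_power2)
  moreover have "R + 1 \<le> norm (F (p t0))" using t0(1) by (simp add: T_def)
  ultimately show False using R norm_triangle_ineq2[of "F (p t0)" "F w0"] by linarith
qed

text \<open>The finite half of Marty's theorem, uniform in \<open>F\<close>. If \<open>F\<close> takes a value in the closed unit disc near \<open>z\<close>,
the spherical bound keeps its modulus at most 2 nearby. Otherwise \<open>F\<close> omits 0 and 1, and Schottky's theorem carries
a bound at one point to a neighbourhood whose size depends neither on the bound nor on \<open>F\<close>. Read
backwards, a large value at one point forces large values throughout that neighbourhood.\<close>

lemma spherically_bounded_Harnack: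
  assumes "0 \<le> K" and "0 < \<delta>"
  obtains \<epsilon> where "0 < \<epsilon>" "\<epsilon> \<le> \<delta>"
    "\<And>B. \<exists>B'. \<forall>F w w'. F holomorphic_on ball z \<delta> \<longrightarrow> spherically_bounded K (ball z \<delta>) F \<longrightarrow>
        w \<in> ball z \<epsilon> \<longrightarrow> w' \<in> ball z \<epsilon> \<longrightarrow> norm (F w) \<le> B \<longrightarrow> norm (F w') \<le> B'"
proof -
  \<comment> \<open>With this radius the growth lemma applies with \<open>R = 1\<close> to any segment of length at most \<open>2 * \<eta>\<close>.\<close>
  define \<eta> where "\<eta> = min \<delta> (1 / (2 * (5 * K + 1)))"
  have "0 < \<eta>" "\<eta> \<le> \<delta>" using assms by (auto simp: \<eta>_def)
  have K\<eta>: "K * (1 + (1 + 1)\<^sup>2) * (2 * \<eta>) < 1"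
  proof -
    have "K * (1 + (1 + 1)\<^sup>2) * (2 * \<eta>) \<le> 5 * K * (2 * (1 / (2 * (5 * K + 1))))"
      unfolding \<eta>_def using assms mult_left_mono[of "min \<delta> (1 / (2 * (5 * K + 1)))" "1 / (2 * (5 * K + 1))" "10 * K"]
      by simp
    also have "\<dots> < 1" using assms by (simp add: field_simps)
    finally show ?thesis .
  qed
  have main: "norm (F w') \<le> max 2 (Schottky_bound B)"
    if holF: "F holomorphic_on ball z \<delta>" and sph: "spherically_bounded K (ball z \<delta>) F"
      and w: "w \<in> ball z (\<eta>/8)" "w' \<in> ball z (\<eta>/8)" and B: "norm (F w) \<le> B" for F w w' B
  proof (cases "\<exists>w0\<in>ball z \<eta>. norm (F w0) \<le> 1")
    case True
    then obtain w0 where w0: "w0 \<in> ball z \<eta>" "norm (F w0) \<le> 1" by blast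
    have w'\<eta>: "w' \<in> ball z \<eta>" using w(2) \<open>0 < \<eta>\<close> by auto
    have seg: "closed_segment w0 w' \<subseteq> ball z \<delta>"
      using w0(1) w'\<eta> \<open>\<eta> \<le> \<delta>\<close> by (intro closed_segment_subset) auto
    have "norm (w' - w0) \<le> 2 * \<eta>"
      using w0(1) w'\<eta> dist_triangle2[of w' w0 z] by (simp add: dist_norm norm_minus_commute)
    then have "K * (1 + (1 + 1)\<^sup>2) * norm (w' - w0) < 1"
      using K\<eta> assms by (smt (verit) mult_left_mono mult_nonneg_nonneg zero_le_power2)
    then have "norm (F w') \<le> 1 + 1"
      by (intro spherically_bounded_growth[OF holF open_ball seg sph assms(1) w0(2)]) auto
    then show ?thesis by simp
  next
    case False
    have sub: "cball w (\<eta>/2) \<subseteq> ball z \<eta>"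
      using w(1) \<open>0 < \<eta>\<close> by (simp add: cball_subset_ball_iff dist_commute)
    have "norm (F w') \<le> Schottky_bound B"
    proof (rule Schottky_disc[where \<rho> = "\<eta>/2" and c = w and F = F and z = w'])
      show "F holomorphic_on cball w (\<eta>/2)"
        using holomorphic_on_subset[OF holF] sub \<open>\<eta> \<le> \<delta>\<close> by (meson order_trans subset_ball)
      show "F x \<noteq> 0 \<and> F x \<noteq> 1" if "x \<in> cball w (\<eta>/2)" for x
        using False sub that by force
      show "norm (w' - w) \<le> 2 / 3 * (\<eta> / 2)"
        using w dist_triangle2[of w' w z] \<open>0 < \<eta>\<close> by (simp add: dist_norm norm_minus_commute)
    qed (use B \<open>0 < \<eta>\<close> in auto)
    then show ?thesis by simp
  qed
  show thesis
  proof (rule that[of "\<eta>/8"])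
    show "\<exists>B'. \<forall>F w w'. F holomorphic_on ball z \<delta> \<longrightarrow> spherically_bounded K (ball z \<delta>) F \<longrightarrow>
        w \<in> ball z (\<eta>/8) \<longrightarrow> w' \<in> ball z (\<eta>/8) \<longrightarrow> norm (F w) \<le> B \<longrightarrow> norm (F w') \<le> B'" for B
      using main[of _ _ _ B] by blast
  qed (use \<open>0 < \<eta>\<close> \<open>\<eta> \<le> \<delta>\<close> in auto)
qed

lemma spherically_bounded_mono:
  assumes "spherically_bounded K S F" "T \<subseteq> S" "K \<le> K'"
  shows "spherically_bounded K' T F"
  unfolding spherically_bounded_def
proof
  fix z assume "z \<in> T"
  then have "norm (deriv F z) \<le> K * (1 + (norm (F z))\<^sup>2)"
    using assms(1,2) by (auto simp: spherically_bounded_def)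
  also have "\<dots> \<le> K' * (1 + (norm (F z))\<^sup>2)"
    using assms(3) by (intro mult_right_mono) auto
  finally show "norm (deriv F z) \<le> K' * (1 + (norm (F z))\<^sup>2)" .
qed

definition locally_spherically_bounded :: "complex set \<Rightarrow> (nat \<Rightarrow> complex \<Rightarrow> complex) \<Rightarrow> bool"
  where "locally_spherically_bounded S G \<longleftrightarrow>
    (\<forall>z\<in>S. \<exists>\<delta>>0. \<exists>K. ball z \<delta> \<subseteq> S \<and> (\<forall>\<^sub>F k in sequentially. spherically_bounded K (ball z \<delta>) (G k)))"

lemma locally_spherically_bounded_Harnack:
  assumes holG: "\<And>k. G k holomorphic_on S"
    and sph: "locally_spherically_bounded S G" and "z \<in> S"
  obtains \<epsilon> where "0 < \<epsilon>" "ball z \<epsilon> \<subseteq> S"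
    "\<And>B. \<exists>B'. \<forall>\<^sub>F k in sequentially. \<forall>w\<in>ball z \<epsilon>. \<forall>w'\<in>ball z \<epsilon>. norm (G k w) \<le> B \<longrightarrow> norm (G k w') \<le> B'"
proof -
  obtain \<delta> K where \<delta>: "0 < \<delta>" "ball z \<delta> \<subseteq> S" "\<forall>\<^sub>F k in sequentially. spherically_bounded K (ball z \<delta>) (G k)"
    using sph \<open>z \<in> S\<close> unfolding locally_spherically_bounded_def by blast
  have ev: "\<forall>\<^sub>F k in sequentially. spherically_bounded \<bar>K\<bar> (ball z \<delta>) (G k)"
    using \<delta>(3) by (rule eventually_mono) (auto intro: spherically_bounded_mono)
  obtain \<epsilon> where \<epsilon>: "0 < \<epsilon>" "\<epsilon> \<le> \<delta>"
    "\<And>B. \<exists>B'. \<forall>F w w'. F holomorphic_on ball z \<delta> \<longrightarrow> spherically_bounded \<bar>K\<bar> (ball z \<delta>) F \<longrightarrow>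
        w \<in> ball z \<epsilon> \<longrightarrow> w' \<in> ball z \<epsilon> \<longrightarrow> norm (F w) \<le> B \<longrightarrow> norm (F w') \<le> B'"
    using spherically_bounded_Harnack[of "\<bar>K\<bar>" \<delta> z] \<delta>(1) by (metis abs_ge_zero)
  have hol: "G k holomorphic_on ball z \<delta>" for k
    using holG \<delta>(2) by (rule holomorphic_on_subset)
  show thesis
  proof (rule that[OF \<epsilon>(1)])
    show "ball z \<epsilon> \<subseteq> S" using \<epsilon>(2) \<delta>(2) by (meson order_trans subset_ball)
    fix B
    obtain B' where "\<forall>F w w'. F holomorphic_on ball z \<delta> \<longrightarrow> spherically_bounded \<bar>K\<bar> (ball z \<delta>) F \<longrightarrow>
        w \<in> ball z \<epsilon> \<longrightarrow> w' \<in> ball z \<epsilon> \<longrightarrow> norm (F w) \<le> B \<longrightarrow> norm (F w') \<le> B'"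
      using \<epsilon>(3) by blast
    then have "\<forall>\<^sub>F k in sequentially. \<forall>w\<in>ball z \<epsilon>. \<forall>w'\<in>ball z \<epsilon>. norm (G k w) \<le> B \<longrightarrow> norm (G k w') \<le> B'"
      using hol by (intro eventually_mono[OF ev]) blast
    then show "\<exists>B'. \<forall>\<^sub>F k in sequentially. \<forall>w\<in>ball z \<epsilon>. \<forall>w'\<in>ball z \<epsilon>. norm (G k w) \<le> B \<longrightarrow> norm (G k w') \<le> B'"
      by blast
  qed
qed

text \<open>The points at which the sequence is bounded form an open and closed subset of \<open>S\<close>, because near each point
boundedness spreads over a ball of fixed size.\<close>

lemma bounded_at_point_imp_bounded_on_compact:
  assumes "open S" "connected S" and holG: "\<And>k. G k holomorphic_on S"
    and sph: "locally_spherically_bounded S G"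
    and z0: "z0 \<in> S" "\<forall>\<^sub>F k in sequentially. norm (G k z0) \<le> B0"
    and C: "compact C" "C \<subseteq> S"
  obtains B where "\<forall>\<^sub>F k in sequentially. \<forall>w\<in>C. norm (G k w) \<le> B"
proof -
  define P where "P = (\<lambda>z. \<exists>B. \<forall>\<^sub>F k in sequentially. norm (G k z) \<le> B)"
  have P: "P z" if "z \<in> S" for z
  proof (rule connected_induction_simple[OF assms(2) z0(1) that])
    show "P z0" using z0(2) P_def by blast
    fix a assume "a \<in> S"
    then obtain \<epsilon> where \<epsilon>: "0 < \<epsilon>" "ball a \<epsilon> \<subseteq> S"
      "\<And>B. \<exists>B'. \<forall>\<^sub>F k in sequentially. \<forall>w\<in>ball a \<epsilon>. \<forall>w'\<in>ball a \<epsilon>. norm (G k w) \<le> B \<longrightarrow> norm (G k w') \<le> B'"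
      using locally_spherically_bounded_Harnack[OF holG sph] by blast
    have "P y" if xy: "x \<in> ball a \<epsilon>" "y \<in> ball a \<epsilon>" and "P x" for x y
    proof -
      obtain B where B: "\<forall>\<^sub>F k in sequentially. norm (G k x) \<le> B" using \<open>P x\<close> P_def by blast
      obtain B' where "\<forall>\<^sub>F k in sequentially. \<forall>w\<in>ball a \<epsilon>. \<forall>w'\<in>ball a \<epsilon>. norm (G k w) \<le> B \<longrightarrow> norm (G k w') \<le> B'"
        using \<epsilon>(3) by blast
      with B have "\<forall>\<^sub>F k in sequentially. norm (G k y) \<le> B'"
        by eventually_elim (use xy in blast)
      then show ?thesis unfolding P_def by blast
    qed
    moreover have "openin (top_of_set S) (ball a \<epsilon>)" by (rule open_subset[OF \<epsilon>(2) open_ball])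
    moreover have "a \<in> ball a \<epsilon>" using \<epsilon>(1) by simp
    ultimately show "\<exists>T. openin (top_of_set S) T \<and> a \<in> T \<and> (\<forall>x\<in>T. \<forall>y\<in>T. P x \<longrightarrow> P y)"
      by (intro exI[of _ "ball a \<epsilon>"] conjI ballI impI)
  qed
  have "\<forall>z\<in>C. \<exists>eB. 0 < fst eB \<and> (\<forall>\<^sub>F k in sequentially. \<forall>w\<in>ball z (fst eB). norm (G k w) \<le> snd eB)"
  proof
    fix z assume "z \<in> C"
    then have "z \<in> S" using C by blast
    then obtain \<epsilon> where \<epsilon>: "0 < \<epsilon>" "ball z \<epsilon> \<subseteq> S"
      "\<And>B. \<exists>B'. \<forall>\<^sub>F k in sequentially. \<forall>w\<in>ball z \<epsilon>. \<forall>w'\<in>ball z \<epsilon>. norm (G k w) \<le> B \<longrightarrow> norm (G k w') \<le> B'"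
      using locally_spherically_bounded_Harnack[OF holG sph] by blast
    obtain B where B: "\<forall>\<^sub>F k in sequentially. norm (G k z) \<le> B"
      using P[OF \<open>z \<in> S\<close>] P_def by blast
    obtain B' where "\<forall>\<^sub>F k in sequentially. \<forall>w\<in>ball z \<epsilon>. \<forall>w'\<in>ball z \<epsilon>. norm (G k w) \<le> B \<longrightarrow> norm (G k w') \<le> B'"
      using \<epsilon>(3) by blast
    with B have "\<forall>\<^sub>F k in sequentially. \<forall>w\<in>ball z \<epsilon>. norm (G k w) \<le> B'"
      by eventually_elim (use \<epsilon>(1) in auto)
    with \<epsilon>(1) show "\<exists>eB. 0 < fst eB \<and> (\<forall>\<^sub>F k in sequentially. \<forall>w\<in>ball z (fst eB). norm (G k w) \<le> snd eB)"
      by (intro exI[of _ "(\<epsilon>, B')"]) simp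
  qed
  from bchoice[OF this] obtain eB where eB: "\<forall>z\<in>C. 0 < fst (eB z) \<and>
      (\<forall>\<^sub>F k in sequentially. \<forall>w\<in>ball z (fst (eB z)). norm (G k w) \<le> snd (eB z))" ..
  define \<epsilon> B where "\<epsilon> = (\<lambda>z. fst (eB z))" and "B = (\<lambda>z. snd (eB z))"
  have \<epsilon>B: "0 < \<epsilon> z" "\<forall>\<^sub>F k in sequentially. \<forall>w\<in>ball z (\<epsilon> z). norm (G k w) \<le> B z" if "z \<in> C" for z
    using bspec[OF eB that] by (simp_all add: \<epsilon>_def B_def)
  obtain D where D: "D \<subseteq> C" "finite D" "C \<subseteq> (\<Union>z\<in>D. ball z (\<epsilon> z))"
    by (rule compactE_image[OF C(1), of C "\<lambda>z. ball z (\<epsilon> z)"]) (use \<epsilon>B in force)+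
  have "\<forall>\<^sub>F k in sequentially. \<forall>z\<in>D. \<forall>w\<in>ball z (\<epsilon> z). norm (G k w) \<le> B z"
    using D(1,2) \<epsilon>B by (intro eventually_ball_finite) auto
  then have "\<forall>\<^sub>F k in sequentially. \<forall>w\<in>C. norm (G k w) \<le> (\<Sum>z\<in>D. \<bar>B z\<bar>)"
  proof eventually_elim
    case (elim k)
    show ?case
    proof
      fix w assume "w \<in> C"
      then obtain z where z: "z \<in> D" "w \<in> ball z (\<epsilon> z)" using D(3) by blast
      then have "norm (G k w) \<le> \<bar>B z\<bar>" using elim by fastforce
      also have "\<dots> \<le> (\<Sum>z\<in>D. \<bar>B z\<bar>)" using z(1) D(2) by (intro member_le_sum) auto
      finally show "norm (G k w) \<le> (\<Sum>z\<in>D. \<bar>B z\<bar>)" .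
    qed
  qed
  then show thesis by (rule that)
qed

section \<open>Repelling points in a finite Julia set\<close>

text \<open>By Marty's theorem this is the set of points without a neighbourhood on which the iterates form a normal
family, with the constant infinity admitted as a limit.\<close>

definition Julia :: "(complex \<Rightarrow> complex) \<Rightarrow> complex set"
  where "Julia f = {z. \<forall>\<delta>>0. \<forall>K. \<exists>n. \<not> spherically_bounded K (ball z \<delta>) (f ^^ n)}"

lemma closed_Julia: "closed (Julia f)"
proof -
  have "open (- Julia f)"
    unfolding open_contains_ball
  proof
    fix z assume "z \<in> - Julia f"
    then obtain \<delta> K where \<delta>: "0 < \<delta>" "\<And>n. spherically_bounded K (ball z \<delta>) (f ^^ n)"
      unfolding Julia_def by blast
    have "w \<in> - Julia f" if "w \<in> ball z \<delta>" for w
    proof -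
      obtain e where "0 < e" "ball w e \<subseteq> ball z \<delta>"
        using \<open>w \<in> ball z \<delta>\<close> open_ball open_contains_ball by metis
      then show ?thesis using \<delta>(2) spherically_bounded_mono unfolding Julia_def by blast
    qed
    with \<delta>(1) show "\<exists>e>0. ball z e \<subseteq> - Julia f" by blast
  qed
  then show ?thesis by (simp add: closed_def)
qed

lemma iterates_locally_spherically_bounded:
  "locally_spherically_bounded (- Julia f) (\<lambda>k. f ^^ r k)"
  unfolding locally_spherically_bounded_def
proof
  fix z assume "z \<in> - Julia f"
  then obtain \<delta> K where \<delta>: "0 < \<delta>" "\<And>n. spherically_bounded K (ball z \<delta>) (f ^^ n)"
    unfolding Julia_def by blast
  obtain e where e: "0 < e" "ball z e \<subseteq> - Julia f"
    using \<open>z \<in> - Julia f\<close> closed_Julia by (metis open_Compl open_contains_ball)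
  show "\<exists>\<delta>>0. \<exists>K. ball z \<delta> \<subseteq> - Julia f \<and> (\<forall>\<^sub>F k in sequentially. spherically_bounded K (ball z \<delta>) (f ^^ r k))"
  proof (intro exI conjI always_eventually allI)
    show "0 < min \<delta> e" "ball z (min \<delta> e) \<subseteq> - Julia f" using \<delta> e by auto
    show "spherically_bounded K (ball z (min \<delta> e)) (f ^^ r k)" for k
      by (rule spherically_bounded_mono[OF \<delta>(2)]) auto
  qed
qed

text \<open>If a subsequence of the iterates were bounded at a single point, it would be bounded on a large circle,
since the complement of a finite set is connected; but the iterates are unbounded on large circles.\<close>

lemma iterates_escape_off_finite_Julia:
  fixes f :: "complex \<Rightarrow> complex"
  assumes holf: "f holomorphic_on UNIV" and nonaff: "\<not> affine_map f"
    and fin: "finite (Julia f)" and z: "z \<notin> Julia f"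
  shows "\<forall>\<^sub>F n in sequentially. B < norm ((f ^^ n) z)"
proof (rule ccontr)
  assume "\<not> ?thesis"
  then have "\<exists>\<^sub>F n in sequentially. norm ((f ^^ n) z) \<le> B"
    by (simp add: frequently_def not_le)
  then have "infinite {n. norm ((f ^^ n) z) \<le> B}"
    by (simp add: frequently_cofinite flip: cofinite_eq_sequentially)
  then obtain r :: "nat \<Rightarrow> nat" where r: "strict_mono r" "\<And>k. norm ((f ^^ r k) z) \<le> B"
    using infinite_enumerate by blast
  obtain r0 where r0: "0 < r0"
    "\<And>r n. r0 \<le> r \<Longrightarrow> \<exists>z. norm z = r \<and> 2 ^ n * r \<le> norm ((f ^^ n) z)"
    using iterates_unbounded_on_circles[OF holf nonaff] by blast
  obtain R where R: "\<And>w. w \<in> Julia f \<Longrightarrow> norm w \<le> R"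
    using finite_imp_bounded[OF fin] by (auto simp: bounded_iff)
  define \<rho> where "\<rho> = max (R + 1) r0"
  have conn: "connected (- Julia f)"
    using connected_open_delete_finite[of "UNIV :: complex set" "Julia f"] fin connected_UNIV by (simp add: Compl_eq_Diff_UNIV)
  have sub: "sphere 0 \<rho> \<subseteq> - Julia f" using R by (force simp: \<rho>_def)
  obtain B' where "\<forall>\<^sub>F k in sequentially. \<forall>w\<in>sphere 0 \<rho>. norm ((f ^^ r k) w) \<le> B'"
  proof (rule bounded_at_point_imp_bounded_on_compact)
    show "open (- Julia f)" using closed_Julia by (rule open_Compl)
    show "connected (- Julia f)" by (rule conn)
    show "locally_spherically_bounded (- Julia f) (\<lambda>k. f ^^ r k)"
      by (rule iterates_locally_spherically_bounded)
    show "(f ^^ r k) holomorphic_on (- Julia f)" for k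
      by (rule holomorphic_on_subset[OF holomorphic_funpow[OF holf]]) simp
    show "z \<in> - Julia f" using z by simp
    show "\<forall>\<^sub>F k in sequentially. norm ((f ^^ r k) z) \<le> B" using r(2) by simp
    show "compact (sphere 0 \<rho> :: complex set)" by (rule compact_sphere)
  qed (use sub that in auto)
  moreover have "\<forall>\<^sub>F k in sequentially. B' < 2 ^ r k * \<rho>"
  proof -
    obtain n0 where n0: "B' / \<rho> < 2 ^ n0" using real_arch_pow[of 2 "B' / \<rho>"] by auto
    have "0 < \<rho>" using r0(1) by (simp add: \<rho>_def)
    show ?thesis
    proof (rule eventually_sequentiallyI[of n0])
      fix k assume "n0 \<le> k"
      then have "n0 \<le> r k" using seq_suble[OF r(1), of k] by linarith
      then have "(2::real) ^ n0 \<le> 2 ^ r k" by (intro power_increasing) auto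
      with n0 have "B' / \<rho> < 2 ^ r k" by linarith
      then show "B' < 2 ^ r k * \<rho>" using \<open>0 < \<rho>\<close> by (simp add: divide_less_eq)
    qed
  qed
  ultimately have "\<forall>\<^sub>F k in sequentially. False"
  proof eventually_elim
    case (elim k)
    obtain w where w: "norm w = \<rho>" "2 ^ r k * \<rho> \<le> norm ((f ^^ r k) w)"
      using r0(2)[of \<rho> "r k"] by (auto simp: \<rho>_def)
    have "norm ((f ^^ r k) w) \<le> B'" by (rule bspec[OF elim(1)]) (simp add: w(1))
    have "B' < B'" by (rule less_le_trans[OF elim(2) order_trans[OF w(2) \<open>norm ((f ^^ r k) w) \<le> B'\<close>]])
    then show False by simp
  qed
  then show False by simp
qed

lemma iterates_escape_uniformly_off_finite_Julia:
  fixes f :: "complex \<Rightarrow> complex"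
  assumes holf: "f holomorphic_on UNIV" and nonaff: "\<not> affine_map f"
    and fin: "finite (Julia f)" and C: "compact C" "C \<inter> Julia f = {}"
  shows "\<forall>\<^sub>F n in sequentially. \<forall>z\<in>C. B < norm ((f ^^ n) z)"
proof -
  have sph: "locally_spherically_bounded (- Julia f) (\<lambda>k. f ^^ k)"
    using iterates_locally_spherically_bounded[of f "\<lambda>k. k"] by simp
  have hol: "(f ^^ k) holomorphic_on (- Julia f)" for k
    using holomorphic_on_subset[OF holomorphic_funpow[OF holf]] by blast
  have "\<forall>z\<in>C. \<exists>\<epsilon>>0. \<forall>\<^sub>F n in sequentially. \<forall>w\<in>ball z \<epsilon>. B < norm ((f ^^ n) w)"
  proof
    fix z assume "z \<in> C"
    then have z: "z \<in> - Julia f" using C by blast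
    then obtain \<epsilon> where \<epsilon>: "0 < \<epsilon>" "ball z \<epsilon> \<subseteq> - Julia f"
      "\<And>B. \<exists>B'. \<forall>\<^sub>F k in sequentially. \<forall>w\<in>ball z \<epsilon>. \<forall>w'\<in>ball z \<epsilon>. norm ((f ^^ k) w) \<le> B \<longrightarrow> norm ((f ^^ k) w') \<le> B'"
      using locally_spherically_bounded_Harnack[of "\<lambda>k. f ^^ k", OF hol sph] by blast
    obtain B' where B': "\<forall>\<^sub>F k in sequentially. \<forall>w\<in>ball z \<epsilon>. \<forall>w'\<in>ball z \<epsilon>. norm ((f ^^ k) w) \<le> B \<longrightarrow> norm ((f ^^ k) w') \<le> B'"
      using \<epsilon>(3) by blast
    have "\<forall>\<^sub>F n in sequentially. B' < norm ((f ^^ n) z)"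
      using iterates_escape_off_finite_Julia[OF holf nonaff fin] z by blast
    with B' have "\<forall>\<^sub>F n in sequentially. \<forall>w\<in>ball z \<epsilon>. B < norm ((f ^^ n) w)"
    proof eventually_elim
      case (elim k)
      show ?case
      proof (rule ballI, rule ccontr)
        fix w assume "w \<in> ball z \<epsilon>" "\<not> B < norm ((f ^^ k) w)"
        then have "norm ((f ^^ k) z) \<le> B'"
          using elim(1) centre_in_ball \<epsilon>(1) by (metis not_le)
        with elim(2) show False by simp
      qed
    qed
    with \<epsilon>(1) show "\<exists>\<epsilon>>0. \<forall>\<^sub>F n in sequentially. \<forall>w\<in>ball z \<epsilon>. B < norm ((f ^^ n) w)" by blast
  qed
  from bchoice[OF this] obtain \<epsilon> where "\<forall>z\<in>C. 0 < \<epsilon> z \<and> (\<forall>\<^sub>F n in sequentially. \<forall>w\<in>ball z (\<epsilon> z). B < norm ((f ^^ n) w))" ..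
  then have \<epsilon>: "0 < \<epsilon> z" "\<forall>\<^sub>F n in sequentially. \<forall>w\<in>ball z (\<epsilon> z). B < norm ((f ^^ n) w)" if "z \<in> C" for z
    using that by auto
  obtain D where D: "D \<subseteq> C" "finite D" "C \<subseteq> (\<Union>z\<in>D. ball z (\<epsilon> z))"
    by (rule compactE_image[OF C(1), of C "\<lambda>z. ball z (\<epsilon> z)"]) (use \<epsilon> in force)+
  have "\<forall>\<^sub>F k in sequentially. \<forall>z\<in>D. \<forall>w\<in>ball z (\<epsilon> z). B < norm ((f ^^ k) w)"
    using D(1,2) \<epsilon> by (intro eventually_ball_finite) auto
  then show ?thesis
    by eventually_elim (use D(3) in blast)
qed

lemma deriv_funpow_fixpoint:
  assumes holf: "f holomorphic_on UNIV" and fp: "f p = p"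
  shows "(f ^^ n) p = p" "deriv (f ^^ n) p = deriv f p ^ n"
proof -
  show fn: "(f ^^ n) p = p" for n by (induction n) (use fp in auto)
  have dfn: "((f ^^ n) has_field_derivative deriv f p ^ n) (at p)" for n
  proof (induction n)
    case (Suc n)
    have "(f has_field_derivative deriv f p) (at ((f ^^ n) p))"
      using holomorphic_derivI[OF holf open_UNIV, of p] fn[of n] by simp
    from DERIV_chain[OF this Suc] show ?case by (simp add: o_def)
  qed (simp add: id_def)
  show "deriv (f ^^ n) p = deriv f p ^ n" by (rule DERIV_imp_deriv[OF dfn])
qed

text \<open>By Picard's theorem the second iterate \<open>F\<close> has a fixed point \<open>p\<close>. Points with bounded orbit lie in the Julia
set, so \<open>p\<close> is an isolated point of it and no other point close to \<open>p\<close> has a bounded orbit. This first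
excludes that the multiplier \<open>\<mu>\<close> vanishes, as then points near \<open>p\<close> would stay near \<open>p\<close>. It also shows that
\<open>p\<close> is the only solution of \<open>(F ^^ n) z = p\<close> near \<open>p\<close>. Hence \<open>((F ^^ n) z - p) / (z - p)\<close> has no zero near
\<open>p\<close>, its value at \<open>p\<close> is \<open>\<mu> ^ n\<close>, and on a small circle it is large for some \<open>n\<close>: the minimum principle
gives \<open>norm \<mu> > 1\<close>.\<close>

lemma finite_Julia_imp_repelling_fixpoint:
  fixes f :: "complex \<Rightarrow> complex"
  assumes holf: "f holomorphic_on UNIV" and nonaff: "\<not> affine_map f"
    and fin: "finite (Julia f)"
  obtains p where "(f ^^ 2) p = p" "1 < norm (deriv (f ^^ 2) p)"
proof -
  have "f \<noteq> (\<lambda>x. a + x)" for a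
    using nonaff unfolding affine_map_def by (metis add.commute mult_1)
  then obtain p where p: "f (f p) = p" using holomorphic_involution_point[OF holf] by metis
  define F where "F = f ^^ 2"
  have holF: "F holomorphic_on UNIV" unfolding F_def by (rule holomorphic_funpow[OF holf])
  have Fp: "F p = p" using p by (simp add: F_def numeral_2_eq_2)
  have Fn: "F ^^ n = f ^^ (2 * n)" for n by (simp add: F_def funpow_mult)
  define \<mu> where "\<mu> = deriv F p"
  have escape: "z \<in> Julia f" if "\<And>n. norm ((F ^^ n) z) \<le> B" for z B
  proof (rule ccontr)
    assume "z \<notin> Julia f"
    then have "\<forall>\<^sub>F n in sequentially. B < norm ((f ^^ n) z)"
      by (rule iterates_escape_off_finite_Julia[OF holf nonaff fin])
    then obtain n0 where "\<And>n. n0 \<le> n \<Longrightarrow> B < norm ((f ^^ n) z)"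
      unfolding eventually_sequentially by blast
    from this[of "2 * n0"] that[of n0] show False by (simp add: Fn)
  qed
  obtain \<epsilon> where \<epsilon>: "0 < \<epsilon>" "cball p \<epsilon> \<inter> Julia f \<subseteq> {p}"
  proof -
    have "open (- (Julia f - {p}))" using fin by (intro open_Compl finite_imp_closed) simp
    then obtain \<epsilon> where "0 < \<epsilon>" "cball p \<epsilon> \<subseteq> - (Julia f - {p})"
      by (meson ComplI DiffD2 insertI1 open_contains_cball)
    with that show thesis by blast
  qed
  have "\<mu> \<noteq> 0"
  proof
    assume "\<mu> = 0"
    then have "(F has_field_derivative 0) (at p)"
      using holomorphic_derivI[OF holF open_UNIV, of p] by (simp add: \<mu>_def)
    then have "(F has_derivative (*) 0) (at p)" by (simp add: has_field_derivative_def)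
    then obtain \<delta> where \<delta>: "0 < \<delta>" "\<And>y. norm (y - p) < \<delta> \<Longrightarrow> norm (F y - F p - 0 * (y - p)) \<le> 1 * norm (y - p)"
      unfolding has_derivative_at_alt by (metis zero_less_one)
    define z where "z = p + of_real (min \<delta> \<epsilon> / 2)"
    have z: "norm (z - p) < \<delta>" "z \<in> cball p \<epsilon>" "z \<noteq> p"
      using \<delta>(1) \<epsilon>(1) by (auto simp: z_def dist_norm simp flip: of_real_divide)
    have "norm ((F ^^ n) z - p) \<le> norm (z - p)" for n
    proof (induction n)
      case (Suc n)
      then have "norm ((F ^^ n) z - p) < \<delta>" using z(1) by linarith
      from \<delta>(2)[OF this] Suc show ?case by (simp add: Fp)
    qed simp
    then have "norm ((F ^^ n) z) \<le> norm (z - p) + norm p" for n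
      using norm_triangle_sub[of "(F ^^ n) z" p] by (smt (verit))
    then have "z \<in> Julia f" by (rule escape)
    with z \<epsilon>(2) show False by blast
  qed
  have compact: "sphere p \<epsilon> \<inter> Julia f = {}" using \<epsilon> by force
  obtain n0 where n0: "\<And>n z. n0 \<le> n \<Longrightarrow> z \<in> sphere p \<epsilon> \<Longrightarrow> 2 * \<epsilon> + norm p + 1 < norm ((f ^^ n) z)"
    using iterates_escape_uniformly_off_finite_Julia[OF holf nonaff fin compact_sphere compact, of "2 * \<epsilon> + norm p + 1"]
    unfolding eventually_sequentially by blast
  define n where "n = n0 + 1"
  have large: "2 * \<epsilon> < norm ((F ^^ n) z - p)" if "z \<in> sphere p \<epsilon>" for z
    using n0[of "2 * n" z] that norm_triangle_ineq2[of "(F ^^ n) z" p] by (auto simp: Fn n_def)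
  define H where "H = (\<lambda>z. if z = p then deriv (F ^^ n) p else ((F ^^ n) z - (F ^^ n) p) / (z - p))"
  have holH: "H holomorphic_on UNIV"
    unfolding H_def by (rule pole_lemma_open[OF holomorphic_funpow[OF holF] open_UNIV])
  have Hp: "H p = \<mu> ^ n" by (simp add: H_def \<mu>_def deriv_funpow_fixpoint[OF holF Fp])
  have Hnz: "H z \<noteq> 0" if "z \<in> cball p \<epsilon>" for z
  proof (cases "z = p")
    case True then show ?thesis using Hp \<open>\<mu> \<noteq> 0\<close> by simp
  next
    case False
    show ?thesis
    proof
      assume "H z = 0"
      then have zp: "(F ^^ n) z = p" using False deriv_funpow_fixpoint(1)[OF holF Fp] by (simp add: H_def)
      have "norm ((F ^^ m) z) \<le> norm p + (\<Sum>k\<le>n. norm ((F ^^ k) z))" for m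
      proof (cases "m \<le> n")
        case True
        then have "norm ((F ^^ m) z) \<le> (\<Sum>k\<le>n. norm ((F ^^ k) z))"
          using member_le_sum[of m "{..n}" "\<lambda>k. norm ((F ^^ k) z)"] by simp
        then show ?thesis using norm_ge_zero[of p] by linarith
      next
        case False
        then have "(F ^^ m) z = (F ^^ (m - n)) ((F ^^ n) z)"
          by (metis add_diff_inverse_nat add.commute comp_apply funpow_add less_imp_le not_le order_less_irrefl)
        then have "(F ^^ m) z = p" using zp deriv_funpow_fixpoint(1)[OF holF Fp] by simp
        then show ?thesis by (simp add: sum_nonneg)
      qed
      then have "z \<in> Julia f" by (rule escape)
      with that False \<epsilon>(2) show False by blast
    qed
  qed
  have Hinv: "norm (1 / H p) \<le> 1 / 2"
  proof (rule maximum_modulus_frontier[where S = "cball p \<epsilon>" and f = "\<lambda>z. 1 / H z" and \<xi> = p])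
    show "(\<lambda>z. 1 / H z) holomorphic_on interior (cball p \<epsilon>)"
      using Hnz by (intro holomorphic_intros holomorphic_on_subset[OF holH]) auto
    show "continuous_on (closure (cball p \<epsilon>)) (\<lambda>z. 1 / H z)"
      using Hnz by (intro continuous_intros continuous_on_subset[OF holomorphic_on_imp_continuous_on[OF holH]]) auto
    show "norm (1 / H z) \<le> 1 / 2" if "z \<in> frontier (cball p \<epsilon>)" for z
    proof -
      have z: "z \<in> sphere p \<epsilon>" "z \<noteq> p" using that \<epsilon>(1) by (auto simp: frontier_cball)
      then have "norm (H z) = norm ((F ^^ n) z - p) / \<epsilon>"
        by (simp add: H_def deriv_funpow_fixpoint(1)[OF holF Fp] norm_divide dist_norm norm_minus_commute)
      moreover have "2 \<le> norm ((F ^^ n) z - p) / \<epsilon>"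
        using large[OF z(1)] \<epsilon>(1) by (simp add: le_divide_eq)
      ultimately have "2 \<le> norm (H z)" by simp
      then show ?thesis by (simp add: norm_divide divide_le_eq)
    qed
  qed (use \<epsilon>(1) in auto)
  have "2 \<le> norm \<mu> ^ n"
  proof -
    have "0 < norm (\<mu> ^ n)" using \<open>\<mu> \<noteq> 0\<close> by simp
    with Hinv show ?thesis
      unfolding Hp norm_divide norm_power by (simp add: field_simps)
  qed
  then have "1 < norm \<mu>"
    using power_le_one[of "norm \<mu>" n] norm_ge_zero[of \<mu>] by linarith
  with Fp show thesis using that by (simp add: F_def \<mu>_def)
qed

section \<open>Rescaling at points of the Julia set\<close>

text \<open>Zalcman's choice of centres and scales. The centre \<open>z\<close> maximises the spherical derivative \<open>s\<close> weighted with
the distance to the boundary of a small disc, and the scale is \<open>1 / s z\<close>. Within distance \<open>k\<close> of the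
origin in the new coordinate the weight decreases at most by a factor 2, so that the rescaled map has
spherical derivative at most 2 there and exactly 1 at the origin.\<close>

lemma Zalcman_rescaling:
  fixes f :: "complex \<Rightarrow> complex"
  assumes holf: "f holomorphic_on UNIV" and a: "a \<in> Julia f" and k: "2 \<le> (k::nat)"
  obtains n z \<rho> where "0 < \<rho>" "\<rho> \<le> 1 / k" "norm (z - a) \<le> 2 / k"
    "\<And>\<zeta>. norm \<zeta> \<le> k \<Longrightarrow>
      \<rho> * norm (deriv (f ^^ n) (z + of_real \<rho> * \<zeta>)) \<le> 2 * (1 + (norm ((f ^^ n) (z + of_real \<rho> * \<zeta>)))\<^sup>2)"
    "\<rho> * norm (deriv (f ^^ n) z) = 1 + (norm ((f ^^ n) z))\<^sup>2"
proof -
  define \<kappa> where "\<kappa> = real k"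
  have \<kappa>: "2 \<le> \<kappa>" using k by (simp add: \<kappa>_def)
  then have \<kappa>0: "0 < 1 / \<kappa>" by simp
  have "\<exists>n. \<not> spherically_bounded (\<kappa> ^ 3) (ball a (1 / \<kappa>)) (f ^^ n)"
    using a \<kappa>0 unfolding Julia_def by blast
  then obtain n w where w: "w \<in> ball a (1 / \<kappa>)"
    "\<kappa> ^ 3 * (1 + (norm ((f ^^ n) w))\<^sup>2) < norm (deriv (f ^^ n) w)"
    unfolding spherically_bounded_def by (auto simp: not_le)
  define F where "F = f ^^ n"
  have holF: "F holomorphic_on UNIV" unfolding F_def by (rule holomorphic_funpow[OF holf])
  define s where "s = (\<lambda>z. norm (deriv F z) / (1 + (norm (F z))\<^sup>2))"
  have pos: "0 < 1 + (norm (F z))\<^sup>2" for z by (simp add: add_pos_nonneg)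
  have s_nonneg: "0 \<le> s z" for z unfolding s_def by (intro divide_nonneg_pos norm_ge_zero pos)
  have sw: "\<kappa> ^ 3 < s w"
    using w(2) pos[of w] by (simp add: s_def F_def less_divide_eq)
  have conts: "continuous_on T s" for T
    unfolding s_def
    by (intro continuous_intros holomorphic_on_imp_continuous_on holomorphic_on_subset[OF holF]
        holomorphic_on_subset[OF holomorphic_deriv[OF holF open_UNIV]]) (use pos in \<open>auto simp: less_imp_neq[symmetric]\<close>)
  \<comment> \<open>The value \<open>\<psi> w\<close> exceeds \<open>\<kappa>\<^sup>2\<close>, hence so does the maximum; this makes the rescaled disc large.\<close>
  define \<psi> where "\<psi> = (\<lambda>z. (1 / \<kappa> - norm (z - w)) * s z)"
  have "continuous_on (cball w (1 / \<kappa>)) \<psi>"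
    unfolding \<psi>_def by (intro continuous_intros conts)
  moreover have win: "w \<in> cball w (1 / \<kappa>)" using \<kappa>0 by simp
  ultimately obtain z where z: "z \<in> cball w (1 / \<kappa>)" and zmax: "\<And>y. y \<in> cball w (1 / \<kappa>) \<Longrightarrow> \<psi> y \<le> \<psi> z"
    using continuous_attains_sup[OF compact_cball, of w "1 / \<kappa>" \<psi>] by blast
  define d where "d = 1 / \<kappa> - norm (z - w)"
  have "\<psi> w = s w / \<kappa>" by (simp add: \<psi>_def)
  moreover have "\<kappa>\<^sup>2 < s w / \<kappa>"
    using sw \<kappa> by (simp add: less_divide_eq power2_eq_square power3_eq_cube)
  ultimately have big: "\<kappa>\<^sup>2 < d * s z" using zmax[OF win] by (simp add: \<psi>_def d_def)
  have "0 \<le> d" using z by (simp add: d_def dist_norm norm_minus_commute)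
  moreover have "0 < d * s z" using big zero_le_power2[of \<kappa>] by linarith
  ultimately have "0 < d" "0 < s z" using s_nonneg[of z] by (auto simp: zero_less_mult_iff)
  have d\<kappa>: "d \<le> 1 / \<kappa>" by (simp add: d_def)
  define \<rho> where "\<rho> = 1 / s z"
  have "0 < \<rho>" using \<open>0 < s z\<close> by (simp add: \<rho>_def)
  have \<rho>d: "\<rho> * \<kappa>\<^sup>2 \<le> d"
    using big \<open>0 < s z\<close> by (simp add: \<rho>_def divide_le_eq)
  then have \<rho>\<kappa>: "\<rho> * \<kappa> \<le> d / \<kappa>" using \<kappa> by (simp add: le_divide_eq power2_eq_square mult.assoc)
  moreover have "d / \<kappa> \<le> d / 2" using \<kappa> \<open>0 < d\<close> by (intro divide_left_mono) auto
  ultimately have \<rho>\<kappa>2: "\<rho> * \<kappa> \<le> d / 2" by linarith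
  show thesis
  proof (rule that[of \<rho> z n])
    show "0 < \<rho>" by fact
    have "\<rho> * 1 \<le> \<rho> * \<kappa>" using \<kappa> \<open>0 < \<rho>\<close> by (intro mult_left_mono) auto
    then show "\<rho> \<le> 1 / real k" using \<rho>\<kappa>2 d\<kappa> \<open>0 < d\<close> by (simp add: \<kappa>_def)
    have "norm (z - a) \<le> norm (z - w) + norm (w - a)" using norm_triangle_ineq[of "z - w" "w - a"] by simp
    also have "\<dots> \<le> 1 / \<kappa> + 1 / \<kappa>"
      using z w(1) by (intro add_mono) (auto simp: dist_norm norm_minus_commute)
    finally show "norm (z - a) \<le> 2 / real k" by (simp add: \<kappa>_def)
    show "\<rho> * norm (deriv (f ^^ n) z) = 1 + (norm ((f ^^ n) z))\<^sup>2"
    proof -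
      have "deriv F z \<noteq> 0" using \<open>0 < s z\<close> by (auto simp: s_def)
      then show ?thesis using pos[of z] by (simp add: \<rho>_def s_def F_def[symmetric])
    qed
    fix \<zeta> :: complex assume \<zeta>: "norm \<zeta> \<le> real k"
    define y where "y = z + of_real \<rho> * \<zeta>"
    have "norm (y - z) = \<rho> * norm \<zeta>" using \<open>0 < \<rho>\<close> by (simp add: y_def norm_mult)
    also have "\<dots> \<le> \<rho> * \<kappa>" using \<zeta> \<open>0 < \<rho>\<close> by (simp add: \<kappa>_def)
    finally have yz: "norm (y - z) \<le> d / 2" using \<rho>\<kappa>2 by linarith
    then have yw: "d / 2 \<le> 1 / \<kappa> - norm (y - w)"
      using norm_triangle_ineq[of "y - z" "z - w"] by (simp add: d_def)
    then have "y \<in> cball w (1 / \<kappa>)" using \<open>0 < d\<close> by (simp add: dist_norm norm_minus_commute)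
    then have "(1 / \<kappa> - norm (y - w)) * s y \<le> d * s z" using zmax by (simp add: \<psi>_def d_def)
    moreover have "d / 2 * s y \<le> (1 / \<kappa> - norm (y - w)) * s y"
      using yw s_nonneg by (rule mult_right_mono)
    ultimately have "d / 2 * s y \<le> d * s z" by linarith
    then have "s y \<le> 2 * s z" using \<open>0 < d\<close> by simp
    then have "\<rho> * s y \<le> 2" using \<open>0 < s z\<close> by (simp add: \<rho>_def divide_le_eq)
    then show "\<rho> * norm (deriv (f ^^ n) (z + of_real \<rho> * \<zeta>)) \<le> 2 * (1 + (norm ((f ^^ n) (z + of_real \<rho> * \<zeta>)))\<^sup>2)"
      using pos[of y] by (simp add: s_def F_def[symmetric] y_def[symmetric] divide_le_eq)
  qed
qed

text \<open>The rescaled maps cannot escape to infinity: if \<open>F\<close> were large at 0, it would be large on a fixed ball, and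
\<open>inverse F\<close> would be small there together with its derivative. But \<open>F\<close> and \<open>inverse F\<close> have the same
spherical derivative, which is at least 1 at 0.\<close>

lemma spherically_bounded_at_point_imp_bounded:
  fixes K :: real
  assumes "0 \<le> K"
  obtains B where "\<And>F. \<lbrakk>F holomorphic_on ball 0 1; spherically_bounded K (ball 0 1) F;
      1 + (norm (F 0))\<^sup>2 \<le> norm (deriv F 0)\<rbrakk> \<Longrightarrow> norm (F 0) \<le> B"
proof -
  obtain \<epsilon> where \<epsilon>: "0 < \<epsilon>" "\<epsilon> \<le> 1"
    "\<And>B. \<exists>B'. \<forall>F w w'. F holomorphic_on ball 0 1 \<longrightarrow> spherically_bounded K (ball 0 1) F \<longrightarrow>
        w \<in> ball 0 \<epsilon> \<longrightarrow> w' \<in> ball 0 \<epsilon> \<longrightarrow> norm (F w) \<le> B \<longrightarrow> norm (F w') \<le> B'"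
    using spherically_bounded_Harnack[OF assms zero_less_one, of "0::complex"] by metis
  \<comment> \<open>If \<open>norm F > 4 / \<epsilon>\<close> on the ball, Cauchy's inequality on the half ball bounds the derivative of \<open>inverse F\<close> at 0 by \<open>1 / 2\<close>.\<close>
  obtain B where B: "\<forall>F w w'. F holomorphic_on ball 0 1 \<longrightarrow> spherically_bounded K (ball 0 1) F \<longrightarrow>
        w \<in> ball 0 \<epsilon> \<longrightarrow> w' \<in> ball 0 \<epsilon> \<longrightarrow> norm (F w) \<le> 4 / \<epsilon> \<longrightarrow> norm (F w') \<le> B"
    using \<epsilon>(3) by blast
  show thesis
  proof (rule that[of B], rule ccontr)
    fix F assume holF: "F holomorphic_on ball 0 1" and sph: "spherically_bounded K (ball 0 1) F"
      and d: "1 + (norm (F 0))\<^sup>2 \<le> norm (deriv F 0)" and "\<not> norm (F 0) \<le> B"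
    have big: "4 / \<epsilon> < norm (F w)" if "w \<in> ball 0 \<epsilon>" for w
    proof (rule ccontr)
      assume "\<not> 4 / \<epsilon> < norm (F w)"
      then have "norm (F 0) \<le> B" using B holF sph that \<epsilon>(1) by (simp add: not_less)
      with \<open>\<not> norm (F 0) \<le> B\<close> show False by simp
    qed
    have nz: "F w \<noteq> 0" if "w \<in> ball 0 \<epsilon>" for w
    proof -
      have "0 < 4 / \<epsilon>" using \<epsilon>(1) by simp
      with big[OF that] show ?thesis by auto
    qed
    have sub: "cball 0 (\<epsilon>/2) \<subseteq> ball (0::complex) \<epsilon>" using \<epsilon>(1) by auto
    have hol: "(\<lambda>w. inverse (F w)) holomorphic_on ball 0 \<epsilon>"
      using nz by (intro holomorphic_intros holomorphic_on_subset[OF holF]) (use \<epsilon>(2) in auto)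
    have "norm ((deriv ^^ 1) (\<lambda>w. inverse (F w)) 0) \<le> fact 1 * (\<epsilon> / 4) / (\<epsilon> / 2) ^ 1"
    proof (rule Cauchy_inequality[where \<xi> = 0 and r = "\<epsilon>/2" and f = "\<lambda>w. inverse (F w)" and n = 1])
      show "(\<lambda>w. inverse (F w)) holomorphic_on ball 0 (\<epsilon>/2)"
        using holomorphic_on_subset[OF hol] sub by (meson ball_subset_cball order_trans)
      show "continuous_on (cball 0 (\<epsilon>/2)) (\<lambda>w. inverse (F w))"
        using continuous_on_subset[OF holomorphic_on_imp_continuous_on[OF hol] sub] .
      fix x :: complex assume "norm (0 - x) = \<epsilon> / 2"
      then have "4 / \<epsilon> < norm (F x)" using \<epsilon>(1) by (intro big) auto
      then have "inverse (norm (F x)) \<le> inverse (4 / \<epsilon>)" using \<epsilon>(1) by (intro le_imp_inverse_le) auto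
      then show "norm (inverse (F x)) \<le> \<epsilon> / 4" by (simp add: norm_inverse)
    qed (use \<epsilon>(1) in auto)
    then have le: "norm (deriv (\<lambda>w. inverse (F w)) 0) \<le> 1 / 2" using \<epsilon>(1) by simp
    have "(F has_field_derivative deriv F 0) (at 0)"
      by (rule holomorphic_derivI[OF holF open_ball]) simp
    then have "((\<lambda>w. inverse (F w)) has_field_derivative - (inverse (F 0) * deriv F 0 * inverse (F 0))) (at 0)"
      using nz[of 0] \<epsilon>(1) by (intro DERIV_inverse') auto
    then have "deriv (\<lambda>w. inverse (F w)) 0 = - (inverse (F 0) * deriv F 0 * inverse (F 0))"
      by (rule DERIV_imp_deriv)
    with le have "norm (deriv F 0) / (norm (F 0))\<^sup>2 \<le> 1 / 2"
      by (simp add: norm_mult norm_inverse norm_divide field_simps power2_eq_square)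
    then have "norm (deriv F 0) \<le> (norm (F 0))\<^sup>2 / 2"
      using nz[of 0] \<epsilon>(1) by (simp add: divide_le_eq)
    with d show False using zero_le_power2[of "norm (F 0)"] by linarith
  qed
qed

text \<open>Boundedness at 0 spreads to all compact sets, so Montel's theorem yields a limit. The normalisation at 0
passes to the limit and keeps it from being constant.\<close>

lemma spherically_bounded_limit:
  fixes G :: "nat \<Rightarrow> complex \<Rightarrow> complex"
  assumes holG: "\<And>k. G k holomorphic_on UNIV"
    and sph: "\<And>k. spherically_bounded 2 (ball 0 (real k + 1)) (G k)"
    and one: "\<And>k. norm (deriv (G k) 0) = 1 + (norm (G k 0))\<^sup>2"
  obtains g r where "g holomorphic_on UNIV" "strict_mono (r :: nat \<Rightarrow> nat)"
    "\<And>C. compact C \<Longrightarrow> uniform_limit C (\<lambda>k. G (r k)) g sequentially"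
    "spherically_bounded 2 UNIV g" "\<not> g constant_on UNIV"
proof -
  have hol: "G k holomorphic_on S" for k S using holG by (rule holomorphic_on_subset) simp
  obtain B0 where B0: "\<And>F. \<lbrakk>F holomorphic_on ball 0 1; spherically_bounded 2 (ball 0 1) F;
      1 + (norm (F 0))\<^sup>2 \<le> norm (deriv F 0)\<rbrakk> \<Longrightarrow> norm (F 0) \<le> B0"
    using spherically_bounded_at_point_imp_bounded[of 2] by auto
  have G0: "norm (G k 0) \<le> B0" for k
    by (rule B0[OF hol spherically_bounded_mono[OF sph[of k]]]) (use one in \<open>auto simp: subset_ball\<close>)
  have loc: "locally_spherically_bounded UNIV G"
    unfolding locally_spherically_bounded_def
  proof
    fix z :: complex
    obtain m where m: "norm z < real m" using reals_Archimedean2 by blast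
    have "\<forall>\<^sub>F k in sequentially. spherically_bounded 2 (ball z 1) (G k)"
    proof (rule eventually_sequentiallyI[of m])
      fix k assume "m \<le> k"
      have "ball z 1 \<subseteq> ball 0 (real k + 1)"
      proof
        fix x assume "x \<in> ball z 1"
        then have "norm x < norm z + 1" using norm_triangle_sub[of x z] by (simp add: dist_norm norm_minus_commute)
        also have "\<dots> \<le> real k + 1" using m \<open>m \<le> k\<close> by simp
        finally show "x \<in> ball 0 (real k + 1)" by simp
      qed
      then show "spherically_bounded 2 (ball z 1) (G k)" by (rule spherically_bounded_mono[OF sph]) simp
    qed
    then show "\<exists>\<delta>>0. \<exists>K. ball z \<delta> \<subseteq> UNIV \<and> (\<forall>\<^sub>F k in sequentially. spherically_bounded K (ball z \<delta>) (G k))"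
      by (intro exI[of _ 1] conjI exI[of _ 2]) auto
  qed
  have bdd: "\<exists>B. \<forall>h\<in>range G. \<forall>z\<in>C. norm (h z) \<le> B" if C: "compact C" for C
  proof -
    obtain B where "\<forall>\<^sub>F k in sequentially. \<forall>w\<in>C. norm (G k w) \<le> B"
    proof (rule bounded_at_point_imp_bounded_on_compact[OF open_UNIV connected_UNIV hol loc UNIV_I _ C subset_UNIV])
      show "\<forall>\<^sub>F k in sequentially. norm (G k 0) \<le> B0" using G0 by simp
    qed
    then obtain k0 where k0: "\<And>k. k0 \<le> k \<Longrightarrow> \<forall>w\<in>C. norm (G k w) \<le> B"
      unfolding eventually_sequentially by blast
    have "\<forall>k. \<exists>b. \<forall>w\<in>C. norm (G k w) \<le> b"
    proof
      fix k
      have "compact (G k ` C)"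
        by (rule compact_continuous_image[OF holomorphic_on_imp_continuous_on[OF hol] C])
      then have "bounded (G k ` C)" by (rule compact_imp_bounded)
      then show "\<exists>b. \<forall>w\<in>C. norm (G k w) \<le> b" by (auto simp: bounded_iff)
    qed
    from choice[OF this] obtain b where b: "\<forall>k. \<forall>w\<in>C. norm (G k w) \<le> b k" ..
    have "norm (G k w) \<le> \<bar>B\<bar> + (\<Sum>i<k0. \<bar>b i\<bar>)" if "w \<in> C" for k w
    proof (cases "k0 \<le> k")
      case True
      then have "norm (G k w) \<le> B" using k0 that by blast
      moreover have "0 \<le> (\<Sum>i<k0. \<bar>b i\<bar>)" by (simp add: sum_nonneg)
      ultimately show ?thesis by linarith
    next
      case False
      then have "\<bar>b k\<bar> \<le> (\<Sum>i<k0. \<bar>b i\<bar>)" by (intro member_le_sum) auto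
      moreover have "norm (G k w) \<le> b k" using b that by blast
      ultimately show ?thesis by linarith
    qed
    then show ?thesis by blast
  qed
  have holr: "h holomorphic_on UNIV" if "h \<in> range G" for h using that holG by blast
  obtain g r where g: "g holomorphic_on UNIV" "strict_mono (r :: nat \<Rightarrow> nat)"
    "\<And>x. x \<in> UNIV \<Longrightarrow> ((\<lambda>n. G (r n) x) \<longlongrightarrow> g x) sequentially"
    "\<And>C. \<lbrakk>compact C; C \<subseteq> UNIV\<rbrakk> \<Longrightarrow> uniform_limit C (G \<circ> r) g sequentially"
    by (rule Montel[OF open_UNIV holr bdd subset_refl]) (assumption | blast)+
  have ul: "uniform_limit C (\<lambda>k. G (r k)) g sequentially" if "compact C" for C
    using g(4)[OF that] by (simp add: o_def)
  have dlim: "(\<lambda>k. deriv (G (r k)) z) \<longlonglongrightarrow> deriv g z" for z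
  proof -
    have "uniform_limit (ball z 1) (\<lambda>k. G (r k)) g sequentially"
      by (rule uniform_limit_on_subset[OF ul[OF compact_cball[of z 1]] ball_subset_cball])
    then have "(\<lambda>k. (deriv ^^ 1) (G (r k)) z) \<longlonglongrightarrow> (deriv ^^ 1) g z"
      by (rule higher_deriv_complex_uniform_limit) (use hol in auto)
    then show ?thesis by simp
  qed
  have lim: "(\<lambda>k. G (r k) z) \<longlonglongrightarrow> g z" for z using g(3) by simp
  have "spherically_bounded 2 UNIV g"
    unfolding spherically_bounded_def
  proof
    fix z :: complex
    obtain m where m: "norm z < real m" using reals_Archimedean2 by blast
    show "norm (deriv g z) \<le> 2 * (1 + (norm (g z))\<^sup>2)"
    proof (rule tendsto_le[OF trivial_limit_sequentially])
      show "(\<lambda>k. norm (deriv (G (r k)) z)) \<longlonglongrightarrow> norm (deriv g z)" by (intro tendsto_intros dlim)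
      show "(\<lambda>k. 2 * (1 + (norm (G (r k) z))\<^sup>2)) \<longlonglongrightarrow> 2 * (1 + (norm (g z))\<^sup>2)" by (intro tendsto_intros lim)
      show "\<forall>\<^sub>F k in sequentially. norm (deriv (G (r k)) z) \<le> 2 * (1 + (norm (G (r k) z))\<^sup>2)"
      proof (rule eventually_sequentiallyI[of m])
        fix k assume "m \<le> k"
        then have "m \<le> r k" using seq_suble[OF g(2), of k] by linarith
        then have "z \<in> ball 0 (real (r k) + 1)" using m by simp
        then show "norm (deriv (G (r k)) z) \<le> 2 * (1 + (norm (G (r k) z))\<^sup>2)"
          using sph[of "r k"] unfolding spherically_bounded_def by blast
      qed
    qed
  qed
  moreover have "\<not> g constant_on UNIV"
  proof
    assume "g constant_on UNIV"
    then obtain c where "g = (\<lambda>x. c)" by (auto simp: constant_on_def)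
    then have "deriv g 0 = 0" by simp
    have "(\<lambda>k. norm (deriv (G (r k)) 0)) \<longlonglongrightarrow> norm (deriv g 0)" by (intro tendsto_intros dlim)
    moreover have "(\<lambda>k. 1 + (norm (G (r k) 0))\<^sup>2) \<longlonglongrightarrow> 1 + (norm (g 0))\<^sup>2" by (intro tendsto_intros lim)
    ultimately have "norm (deriv g 0) = 1 + (norm (g 0))\<^sup>2"
      using LIMSEQ_unique by (simp add: one)
    with \<open>deriv g 0 = 0\<close> have "1 + (norm (g 0))\<^sup>2 = 0" by simp
    then show False using zero_le_power2[of "norm (g 0)"] by linarith
  qed
  ultimately show thesis using that g(1,2) ul by blast
qed

text \<open>The limit turns local questions about the iterates near \<open>a\<close> into questions about a single entire function:
a value that \<open>g\<close> takes simply is taken simply by iterates of \<open>f\<close> on arbitrarily small discs near \<open>a\<close>.\<close>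

theorem Zalcman:
  fixes f :: "complex \<Rightarrow> complex"
  assumes holf: "f holomorphic_on UNIV" and a: "a \<in> Julia f"
  obtains n :: "nat \<Rightarrow> nat" and z :: "nat \<Rightarrow> complex" and \<rho> :: "nat \<Rightarrow> real" and g where
    "\<And>k. 0 < \<rho> k" "\<rho> \<longlonglongrightarrow> 0" "z \<longlonglongrightarrow> a"
    "g holomorphic_on UNIV" "spherically_bounded 2 UNIV g" "\<not> g constant_on UNIV"
    "\<And>C. compact C \<Longrightarrow> uniform_limit C (\<lambda>k \<zeta>. (f ^^ n k) (z k + of_real (\<rho> k) * \<zeta>)) g sequentially"
proof -
  define Q where "Q = (\<lambda>k::nat. \<lambda>(n, z, \<rho>). 0 < \<rho> \<and> \<rho> \<le> 1 / real (k + 2) \<and> norm (z - a) \<le> 2 / real (k + 2) \<and>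
    (\<forall>\<zeta>. norm \<zeta> \<le> real (k + 2) \<longrightarrow>
      \<rho> * norm (deriv (f ^^ n) (z + of_real \<rho> * \<zeta>)) \<le> 2 * (1 + (norm ((f ^^ n) (z + of_real \<rho> * \<zeta>)))\<^sup>2)) \<and>
    \<rho> * norm (deriv (f ^^ n) z) = 1 + (norm ((f ^^ n) z))\<^sup>2)"
  have "\<forall>k. \<exists>t. Q k t"
  proof
    fix k
    show "\<exists>t. Q k t"
      by (rule Zalcman_rescaling[OF holf a, of "k + 2"]) (auto simp: Q_def)
  qed
  from choice[OF this] obtain t where t: "\<forall>k. Q k (t k)" ..
  define n where "n = (\<lambda>k. fst (t k))"
  define z where "z = (\<lambda>k. fst (snd (t k)))"
  define \<rho> where "\<rho> = (\<lambda>k. snd (snd (t k)))"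
  have "Q k (n k, z k, \<rho> k)" for k using t by (simp add: n_def z_def \<rho>_def)
  then have q: "0 < \<rho> k" "\<rho> k \<le> 1 / real (k + 2)" "norm (z k - a) \<le> 2 / real (k + 2)"
      "norm \<zeta> \<le> real (k + 2) \<Longrightarrow> \<rho> k * norm (deriv (f ^^ n k) (z k + of_real (\<rho> k) * \<zeta>))
          \<le> 2 * (1 + (norm ((f ^^ n k) (z k + of_real (\<rho> k) * \<zeta>)))\<^sup>2)"
      "\<rho> k * norm (deriv (f ^^ n k) (z k)) = 1 + (norm ((f ^^ n k) (z k)))\<^sup>2" for k \<zeta>
    unfolding Q_def by blast+
  define G where "G = (\<lambda>k \<zeta>. (f ^^ n k) (z k + of_real (\<rho> k) * \<zeta>))"
  have derG: "(G k has_field_derivative deriv (f ^^ n k) (z k + of_real (\<rho> k) * \<zeta>) * of_real (\<rho> k)) (at \<zeta>)" for k \<zeta>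
    unfolding G_def
    by (rule DERIV_chain2[where f = "f ^^ n k", OF holomorphic_derivI[OF holomorphic_funpow[OF holf] open_UNIV UNIV_I]])
       (auto intro!: derivative_eq_intros)
  have dG: "norm (deriv (G k) \<zeta>) = \<rho> k * norm (deriv (f ^^ n k) (z k + of_real (\<rho> k) * \<zeta>))" for k \<zeta>
    using q(1)[of k] by (simp add: DERIV_imp_deriv[OF derG] norm_mult)
  have holG: "G k holomorphic_on UNIV" for k
    using derG by (auto simp: holomorphic_on_open)
  have sphG: "spherically_bounded 2 (ball 0 (real k + 1)) (G k)" for k
    unfolding spherically_bounded_def dG
  proof
    fix \<zeta> :: complex assume "\<zeta> \<in> ball 0 (real k + 1)"
    then have "norm \<zeta> \<le> real (k + 2)" by simp
    then show "\<rho> k * norm (deriv (f ^^ n k) (z k + of_real (\<rho> k) * \<zeta>)) \<le> 2 * (1 + (norm (G k \<zeta>))\<^sup>2)"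
      unfolding G_def by (rule q(4))
  qed
  have oneG: "norm (deriv (G k) 0) = 1 + (norm (G k 0))\<^sup>2" for k
    unfolding dG using q(5)[of k] by (simp add: G_def)
  obtain g r where g: "g holomorphic_on UNIV" "strict_mono (r :: nat \<Rightarrow> nat)"
    "\<And>C. compact C \<Longrightarrow> uniform_limit C (\<lambda>k. G (r k)) g sequentially"
    "spherically_bounded 2 UNIV g" "\<not> g constant_on UNIV"
    by (rule spherically_bounded_limit[OF holG sphG oneG]) (assumption | blast)+
  have lim0: "(\<lambda>k. c / real (k + 2)) \<longlonglongrightarrow> 0" for c
    using LIMSEQ_ignore_initial_segment[OF lim_const_over_n[of c], of 2] by simp
  have "\<rho> \<longlonglongrightarrow> 0"
    by (rule tendsto_sandwich[OF always_eventually always_eventually tendsto_const lim0[of 1]])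
       (blast intro: less_imp_le q(1,2))+
  moreover have "z \<longlonglongrightarrow> a"
    by (rule Lim_transform_bound[OF _ lim0[of 2], THEN LIM_zero_cancel]) (use q(3) in auto)
  ultimately show thesis
  proof (intro that[of "\<rho> \<circ> r" "z \<circ> r" g "n \<circ> r"])
    show "uniform_limit C (\<lambda>k \<zeta>. (f ^^ (n \<circ> r) k) ((z \<circ> r) k + of_real ((\<rho> \<circ> r) k) * \<zeta>)) g sequentially"
      if "compact C" for C using g(3)[OF that] by (simp add: G_def o_def)
  qed (use q(1) g LIMSEQ_subseq_LIMSEQ in auto)
qed

section \<open>Totally ramified values\<close>

lemma constant_on_ball_imp_constant:
  fixes g :: "complex \<Rightarrow> complex"
  assumes holg: "g holomorphic_on S" "open S" "connected S" and "ball z r \<subseteq> S" "0 < r"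
    and const: "g constant_on ball z r"
  shows "g constant_on S"
proof -
  obtain c where c: "\<And>x. x \<in> ball z r \<Longrightarrow> g x = c" using const by (auto simp: constant_on_def)
  have "g x = c" if "x \<in> S" for x
    by (rule analytic_continuation_open[where s = "ball z r" and s' = S and f = g and g = "\<lambda>_. c"])
       (use assms c that in auto)
  then show ?thesis by (auto simp: constant_on_def)
qed

text \<open>A Landau type estimate for a function without simple zeros. Where \<open>Q\<close> has no zero, \<open>\<psi>\<close> is the square of
\<open>s = deriv \<psi> / \<sigma>\<close> with \<open>\<sigma>\<^sup>2 = Q\<close>, and \<open>2 * deriv s = \<sigma>\<close>. So \<open>norm Q\<close> is four times the squared modulus of
the derivative of a function bounded by \<open>sqrt m\<close>, and Cauchy's inequality applies. To find a disc on which
\<open>Q\<close> has no zero and whose radius is under control, \<open>norm Q\<close> is maximised against the squared distance to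
the boundary, as in the proof of Bloch's theorem.\<close>

lemma holomorphic_square_Landau:
  assumes hol\<psi>: "\<psi> holomorphic_on ball z0 r" and holQ: "Q holomorphic_on ball z0 r" and "0 < r"
    and eq: "\<And>z. z \<in> ball z0 r \<Longrightarrow> (deriv \<psi> z)\<^sup>2 = Q z * \<psi> z"
    and bnd: "\<And>z. z \<in> ball z0 r \<Longrightarrow> norm (\<psi> z) \<le> m"
    and nonconst: "\<not> \<psi> constant_on ball z0 r"
  shows "r\<^sup>2 * norm (Q z0) \<le> 262144 * m"
proof -
  define r' where "r' = r / 2"
  have r': "0 < r'" "cball z0 r' \<subseteq> ball z0 r" using \<open>0 < r\<close> by (auto simp: r'_def)
  have "0 \<le> m" using order.trans[OF norm_ge_zero bnd[of z0]] \<open>0 < r\<close> by simp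
  \<comment> \<open>The weight vanishes on the boundary of the smaller disc, so the maximum controls \<open>Q\<close> on a disc around the point where it is attained.\<close>
  define D where "D = (\<lambda>z. (r' - norm (z - z0))\<^sup>2 * norm (Q z))"
  have "continuous_on (cball z0 r') D" unfolding D_def
    by (intro continuous_intros continuous_on_subset[OF holomorphic_on_imp_continuous_on[OF holQ] r'(2)])
  moreover have z0in: "z0 \<in> cball z0 r'" using r' by simp
  ultimately obtain x where x: "x \<in> cball z0 r'" and xmax: "\<And>y. y \<in> cball z0 r' \<Longrightarrow> D y \<le> D x"
    using continuous_attains_sup[OF compact_cball, of z0 r' D] by blast
  define d where "d = r' - norm (x - z0)"
  define q where "q = norm (Q x)"
  have "0 \<le> d" using x by (simp add: d_def dist_norm norm_minus_commute)
  have Dx: "D x = d\<^sup>2 * q" by (simp add: D_def d_def q_def)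
  have Dz0: "D z0 = r'\<^sup>2 * norm (Q z0)" by (simp add: D_def)
  \<comment> \<open>Here \<open>65536 = 4 * 128\<^sup>2\<close>: a factor 4 from \<open>norm Q = 4 * (norm (deriv s))\<^sup>2\<close> and 128 from Cauchy's inequality on a disc of radius \<open>d / 128\<close>.\<close>
  have "d\<^sup>2 * q \<le> 65536 * m"
  proof (cases "d = 0 \<or> q = 0")
    case True
    then show ?thesis using \<open>0 \<le> m\<close> by auto
  next
    case False
    then have "0 < d" "0 < q" using \<open>0 \<le> d\<close> by (auto simp: q_def)
    have in_half: "r' - norm (y - z0) \<ge> d / 2" if "norm (y - x) \<le> d / 2" for y
      using norm_triangle_ineq[of "y - x" "x - z0"] that by (simp add: d_def)
    then have half: "y \<in> cball z0 r'" if "y \<in> cball x (d/2)" for y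
      using that \<open>0 < d\<close> by (force simp: dist_norm norm_minus_commute)
    have Q4: "norm (Q y) \<le> 4 * q" if "y \<in> cball x (d/2)" for y
    proof -
      have "(d / 2)\<^sup>2 \<le> (r' - norm (y - z0))\<^sup>2"
        using in_half[of y] that \<open>0 < d\<close> by (intro power_mono) (auto simp: dist_norm norm_minus_commute)
      then have "(d / 2)\<^sup>2 * norm (Q y) \<le> D y" unfolding D_def by (rule mult_right_mono) simp
      also have "\<dots> \<le> d\<^sup>2 * q" using xmax[OF half[OF that]] Dx by simp
      finally show ?thesis using \<open>0 < d\<close> by (simp add: power_divide)
    qed
    have sub: "cball x (d/2) \<subseteq> ball z0 r" using half r'(2) by blast
    have dQ: "norm (deriv Q y) \<le> 16 * q / d" if "y \<in> ball x (d/64)" for y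
    proof -
      have sub': "cball y (d/4) \<subseteq> cball x (d/2)"
      proof
        fix w assume "w \<in> cball y (d/4)"
        then have "dist x w \<le> d / 64 + d / 4"
          using that dist_triangle[of x w y] by auto
        then show "w \<in> cball x (d/2)" using \<open>0 < d\<close> by simp
      qed
      have hol: "Q holomorphic_on cball y (d/4)"
        using holQ by (rule holomorphic_on_subset) (use sub sub' in blast)
      have "norm ((deriv ^^ 1) Q y) \<le> fact 1 * (4 * q) / (d/4) ^ 1"
      proof (rule Cauchy_inequality[where \<xi> = y and r = "d/4" and f = Q and n = 1])
        show "Q holomorphic_on ball y (d/4)" using hol by (rule holomorphic_on_subset) auto
        show "continuous_on (cball y (d/4)) Q" using hol by (rule holomorphic_on_imp_continuous_on)
        fix w assume "norm (y - w) = d / 4"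
        then have "w \<in> cball y (d/4)" by (simp add: dist_norm)
        then show "norm (Q w) \<le> 4 * q" using Q4 sub' by blast
      qed (use \<open>0 < d\<close> in auto)
      then show ?thesis by simp
    qed
    define S where "S = ball x (d/64)"
    have S: "S \<subseteq> ball z0 r" "x \<in> S" "open S" "connected S" "convex S" "contractible S"
      using sub \<open>0 < d\<close> by (auto simp: S_def convex_imp_contractible)
    have Qnz: "Q y \<noteq> 0" if "y \<in> S" for y
    proof
      assume "Q y = 0"
      have "norm (Q y - Q x) \<le> 16 * q / d * norm (y - x)"
      proof (rule field_differentiable_bound[where S = S and f' = "deriv Q"])
        show "(Q has_field_derivative deriv Q w) (at w within S)" if "w \<in> S" for w
          using holomorphic_derivI[OF holQ open_ball] S(1) that by blast
      qed (use dQ S that in \<open>auto simp: S_def\<close>)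
      also have "\<dots> \<le> 16 * q / d * (d / 64)"
        using that \<open>0 < d\<close> \<open>0 < q\<close> by (intro mult_left_mono) (auto simp: S_def dist_norm norm_minus_commute)
      also have "\<dots> < q" using \<open>0 < d\<close> \<open>0 < q\<close> by simp
      finally show False using \<open>Q y = 0\<close> by (simp add: q_def)
    qed
    have holQS: "Q holomorphic_on S" using holQ S(1) by (rule holomorphic_on_subset)
    have hol\<psi>S: "\<psi> holomorphic_on S" using hol\<psi> S(1) by (rule holomorphic_on_subset)
    obtain \<sigma> where \<sigma>: "\<sigma> holomorphic_on S" "\<And>z. z \<in> S \<Longrightarrow> Q z = \<sigma> z ^ 2"
      using contractible_imp_holomorphic_sqrt[OF holQS S(6) Qnz] by blast
    have \<sigma>nz: "\<sigma> z \<noteq> 0" if "z \<in> S" for z using \<sigma>(2)[OF that] Qnz[OF that] by auto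
    define s where "s = (\<lambda>z. deriv \<psi> z / \<sigma> z)"
    have hols: "s holomorphic_on S" unfolding s_def
      using \<sigma>nz by (intro holomorphic_intros \<sigma>(1) holomorphic_deriv hol\<psi>S S(3))
    have s2: "\<psi> z = (s z)\<^sup>2" if "z \<in> S" for z
      using eq[of z] \<sigma>(2)[OF that] \<sigma>nz[OF that] S(1) that by (auto simp: s_def power_divide field_simps)
    have ds: "s z * (2 * deriv s z - \<sigma> z) = 0" if "z \<in> S" for z
    proof -
      have "((\<lambda>z. (s z)\<^sup>2) has_field_derivative 2 * s z * deriv s z) (at z)"
        by (rule derivative_eq_intros holomorphic_derivI[OF hols S(3) that])+ simp
      then have "(\<psi> has_field_derivative 2 * s z * deriv s z) (at z)"
        by (rule has_field_derivative_transform_within_open[OF _ S(3) that]) (use s2 in auto)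
      then have "deriv \<psi> z = 2 * s z * deriv s z" by (rule DERIV_imp_deriv)
      moreover have "deriv \<psi> z = s z * \<sigma> z" using \<sigma>nz[OF that] by (simp add: s_def)
      ultimately have "s z * (2 * deriv s z) = s z * \<sigma> z" by (auto simp: mult_ac)
      then show ?thesis by (simp add: right_diff_distrib)
    qed
    have "\<exists>y\<in>S. s y \<noteq> 0"
    proof (rule ccontr)
      assume "\<not> ?thesis"
      then have "\<psi> constant_on ball x (d/64)" using s2 by (auto simp: constant_on_def S_def)
      then have "\<psi> constant_on ball z0 r"
        by (intro constant_on_ball_imp_constant[OF hol\<psi> open_ball connected_ball]) (use S(1) \<open>0 < d\<close> in \<open>auto simp: S_def\<close>)
      with nonconst show False by blast
    qed
    then obtain y where y: "y \<in> S" "s y \<noteq> 0" by blast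
    have s\<sigma>: "2 * deriv s x = \<sigma> x"
    proof (rule analytic_continuation_open[where s = "{z \<in> S. s z \<noteq> 0}" and s' = S and f = "\<lambda>z. 2 * deriv s z" and g = \<sigma>])
      show "open {z \<in> S. s z \<noteq> 0}"
        using continuous_open_preimage[OF holomorphic_on_imp_continuous_on[OF hols] S(3), of "- {0}"]
        by (simp add: open_Compl vimage_def Int_def)
      show "(\<lambda>z. 2 * deriv s z) holomorphic_on S" by (intro holomorphic_intros holomorphic_deriv hols S(3))
    qed (use y S \<sigma>(1) ds in auto)
    have "norm ((deriv ^^ 1) s x) \<le> fact 1 * sqrt m / (d/128) ^ 1"
    proof (rule Cauchy_inequality[where \<xi> = x and r = "d/128" and f = s and n = 1])
      have sub': "cball x (d/128) \<subseteq> S" using \<open>0 < d\<close> by (auto simp: S_def)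
      then have "s holomorphic_on cball x (d/128)" using hols by (metis holomorphic_on_subset)
      then show "s holomorphic_on ball x (d/128)" "continuous_on (cball x (d/128)) s"
        by (auto intro: holomorphic_on_subset holomorphic_on_imp_continuous_on)
      fix w assume "norm (x - w) = d / 128"
      then have "w \<in> S" using sub' by (auto simp: dist_norm)
      then have "(norm (s w))\<^sup>2 \<le> m" using s2[of w] bnd[of w] S(1) by (auto simp: norm_power)
      then show "norm (s w) \<le> sqrt m" by (rule real_le_rsqrt)
    qed (use \<open>0 < d\<close> in auto)
    then have "norm (deriv s x) \<le> sqrt m * 128 / d" by simp
    moreover have "norm (\<sigma> x) = 2 * norm (deriv s x)" by (simp add: s\<sigma>[symmetric] norm_mult)
    ultimately have "norm (\<sigma> x) \<le> 2 * (sqrt m * 128 / d)" by simp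
    then have "(norm (\<sigma> x))\<^sup>2 \<le> (2 * (sqrt m * 128 / d))\<^sup>2" by (rule power_mono) simp
    also have "\<dots> = 65536 * m / d\<^sup>2" using \<open>0 \<le> m\<close> by (simp add: power_mult_distrib power_divide)
    finally have "q \<le> 65536 * m / d\<^sup>2" using \<sigma>(2)[OF S(2)] by (simp add: q_def norm_power)
    then show ?thesis using \<open>0 < d\<close> by (simp add: le_divide_eq mult.commute)
  qed
  then have "r'\<^sup>2 * norm (Q z0) \<le> 65536 * m" using xmax[OF z0in] Dx Dz0 by simp
  then show ?thesis by (simp add: r'_def power_divide)
qed

text \<open>Local quotients of \<open>N\<close> by \<open>u\<close> agree where \<open>u\<close> does not vanish, and the zeros of \<open>u\<close> have no interior. Hence
the local quotients glue.\<close>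

lemma holomorphic_quotient_from_local:
  assumes holu: "u holomorphic_on UNIV" and unz: "u z1 \<noteq> 0"
    and loc: "\<And>z0. \<exists>R \<epsilon>. 0 < \<epsilon> \<and> R holomorphic_on ball z0 \<epsilon> \<and> (\<forall>z\<in>ball z0 \<epsilon>. N z = R z * u z)"
  obtains Q where "Q holomorphic_on UNIV" "\<And>z. N z = Q z * (u z :: complex)"
proof -
  have "\<forall>z0. \<exists>p. 0 < snd p \<and> fst p holomorphic_on ball z0 (snd p) \<and> (\<forall>z\<in>ball z0 (snd p). N z = fst p z * u z)"
  proof
    fix z0
    obtain R \<epsilon> where "0 < \<epsilon>" "R holomorphic_on ball z0 \<epsilon>" "\<forall>z\<in>ball z0 \<epsilon>. N z = R z * u z" using loc by blast
    then show "\<exists>p. 0 < snd p \<and> fst p holomorphic_on ball z0 (snd p) \<and> (\<forall>z\<in>ball z0 (snd p). N z = fst p z * u z)"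
      by (intro exI[of _ "(R, \<epsilon>)"]) simp
  qed
  from choice[OF this] obtain p where p: "\<forall>z0. 0 < snd (p z0) \<and> fst (p z0) holomorphic_on ball z0 (snd (p z0))
      \<and> (\<forall>z\<in>ball z0 (snd (p z0)). N z = fst (p z0) z * u z)" ..
  define R \<epsilon> where "R = (\<lambda>z. fst (p z))" and "\<epsilon> = (\<lambda>z. snd (p z))"
  have \<epsilon>: "0 < \<epsilon> z0" and R: "R z0 holomorphic_on ball z0 (\<epsilon> z0)"
    and N: "\<And>z. z \<in> ball z0 (\<epsilon> z0) \<Longrightarrow> N z = R z0 z * u z" for z0
    using spec[OF p, of z0] by (simp_all add: R_def \<epsilon>_def)
  define Q where "Q = (\<lambda>z. R z z)"
  have QR: "Q z = R z0 z" if z: "z \<in> ball z0 (\<epsilon> z0)" for z z0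
  proof (rule ccontr)
    assume ne: "Q z \<noteq> R z0 z"
    define T where "T = ball z0 (\<epsilon> z0) \<inter> ball z (\<epsilon> z)"
    have T: "open T" "z \<in> T" using z \<epsilon>[of z] by (auto simp: T_def)
    have "continuous_on T (\<lambda>w. R z w - R z0 w)"
      by (intro continuous_intros; rule continuous_on_subset[OF holomorphic_on_imp_continuous_on[OF R]]) (auto simp: T_def)
    then have "open (T \<inter> (\<lambda>w. R z w - R z0 w) -` (- {0}))" (is "open ?D")
      using T(1) by (intro continuous_open_preimage) (auto simp: open_Compl)
    moreover have "z \<in> ?D" using ne T(2) by (simp add: Q_def)
    ultimately have D: "open ?D" "?D \<noteq> {}" by blast+
    have u0: "u w = 0" if "w \<in> ?D" for w
    proof -
      have "R z w * u w = R z0 w * u w" using that N[of w z, symmetric] N[of w z0, symmetric] by (simp add: T_def del: mult_cancel_right)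
      then have "(R z w - R z0 w) * u w = 0" by (simp add: algebra_simps)
      then have "R z w - R z0 w = 0 \<or> u w = 0" by (simp only: mult_eq_0_iff)
      with that show ?thesis by auto
    qed
    have "u z1 = 0"
      by (rule analytic_continuation_open[OF D(1) open_UNIV D(2) connected_UNIV subset_UNIV holu holomorphic_on_const u0 UNIV_I])
    with unz show False by simp
  qed
  show thesis
  proof (rule that[of Q])
    have "Q field_differentiable (at z0)" for z0
    proof -
      have "(R z0 has_field_derivative deriv (R z0) z0) (at z0)"
        by (rule holomorphic_derivI[OF R open_ball]) (use \<epsilon>[of z0] in simp)
      then have "(Q has_field_derivative deriv (R z0) z0) (at z0)"
        by (rule has_field_derivative_transform_within_open[where S = "ball z0 (\<epsilon> z0)"]) (use \<epsilon>[of z0] QR in auto)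
      then show ?thesis by (auto simp: field_differentiable_def)
    qed
    then show "Q holomorphic_on UNIV" by (simp add: holomorphic_on_def)
    show "N z = Q z * u z" for z using N[of z z] \<epsilon>[of z] by (simp add: Q_def)
  qed
qed

text \<open>If \<open>g - g z0\<close> vanishes to order \<open>n \<ge> 2\<close> at \<open>z0\<close>, its derivative vanishes to order \<open>n - 1\<close>, and
\<open>2 * (n - 1) \<ge> n\<close>.\<close>

lemma deriv_square_divisible_locally:
  fixes g :: "complex \<Rightarrow> complex"
  assumes holg: "g holomorphic_on UNIV" and nonconst: "\<not> g constant_on UNIV"
    and mult: "deriv g z0 = 0"
  obtains R \<epsilon> where "0 < \<epsilon>" "R holomorphic_on ball z0 \<epsilon>"
    "\<And>z. z \<in> ball z0 \<epsilon> \<Longrightarrow> (deriv g z)\<^sup>2 = R z * (g z - g z0)"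
proof -
  define h where "h = (\<lambda>z. g z - g z0)"
  have "\<exists>w\<in>UNIV. h w \<noteq> 0" using nonconst by (auto simp: h_def constant_on_def)
  moreover have holh: "h holomorphic_on UNIV" unfolding h_def by (intro holomorphic_intros holg)
  moreover have hz0: "h z0 = 0" by (simp add: h_def)
  ultimately have "(if h z0 = 0 then 0 < zorder h z0 else zorder h z0 = 0) \<and>
      (\<exists>r. 0 < r \<and> cball z0 r \<subseteq> UNIV \<and> zor_poly h z0 holomorphic_on cball z0 r \<and>
        (\<forall>w\<in>cball z0 r. h w = zor_poly h z0 w * (w - z0) ^ nat (zorder h z0) \<and> zor_poly h z0 w \<noteq> 0))"
    by (intro zorder_exist_zero) auto
  then obtain r where "0 < zorder h z0" "0 < r" "zor_poly h z0 holomorphic_on cball z0 r"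
      "\<forall>w\<in>cball z0 r. h w = zor_poly h z0 w * (w - z0) ^ nat (zorder h z0) \<and> zor_poly h z0 w \<noteq> 0"
    using hz0 by auto
  then obtain e and n :: nat where r: "0 < r" "0 < n" "e holomorphic_on cball z0 r"
    "\<And>w. w \<in> cball z0 r \<Longrightarrow> h w = e w * (w - z0) ^ n \<and> e w \<noteq> 0"
    by (intro that[of "nat (zorder h z0)" "zor_poly h z0"]) auto
  have hole: "e holomorphic_on ball z0 r" using r(3) by (rule holomorphic_on_subset) auto
  have dg: "deriv g w = deriv e w * (w - z0) ^ n + e w * (of_nat n * (w - z0) ^ (n - 1))" if "w \<in> ball z0 r" for w
  proof -
    have "((\<lambda>w. e w * (w - z0) ^ n) has_field_derivative deriv e w * (w - z0) ^ n + e w * (of_nat n * (w - z0) ^ (n - 1))) (at w)"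
      using holomorphic_derivI[OF hole open_ball that] by (auto intro!: derivative_eq_intros)
    from DERIV_add[OF this DERIV_const[of "g z0"]]
    have "((\<lambda>w. e w * (w - z0) ^ n + g z0) has_field_derivative deriv e w * (w - z0) ^ n + e w * (of_nat n * (w - z0) ^ (n - 1))) (at w)"
      by simp
    then have "(g has_field_derivative deriv e w * (w - z0) ^ n + e w * (of_nat n * (w - z0) ^ (n - 1))) (at w)"
    proof (rule has_field_derivative_transform_within_open[OF _ open_ball that])
      fix x assume "x \<in> ball z0 r"
      then show "e x * (x - z0) ^ n + g z0 = g x" using r(4)[of x] by (simp add: h_def flip: eq_diff_eq)
    qed
    then show ?thesis by (rule DERIV_imp_deriv)
  qed
  have "n \<noteq> 1"
  proof
    assume "n = 1"
    then have "deriv g z0 = e z0" using dg[of z0] r(1) by simp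
    with mult r(1) r(4)[of z0] show False by simp
  qed
  then obtain k where n: "n = Suc (Suc k)" using r(2) by (metis One_nat_def gr0_conv_Suc not0_implies_Suc)
  define R where "R = (\<lambda>w. (w - z0) ^ k * (deriv e w * (w - z0) + e w * of_nat n)\<^sup>2 / e w)"
  show thesis
  proof (rule that[of r R])
    show "R holomorphic_on ball z0 r" unfolding R_def
      using r(4) by (intro holomorphic_intros hole holomorphic_deriv open_ball) auto
    fix w assume w: "w \<in> ball z0 r"
    have "deriv g w = (w - z0) ^ Suc k * (deriv e w * (w - z0) + e w * of_nat n)"
      unfolding dg[OF w] by (simp add: n algebra_simps)
    moreover have "g w - g z0 = e w * (w - z0) ^ Suc (Suc k)" "e w \<noteq> 0" using r(4)[of w] w by (auto simp: h_def n)
    ultimately show "(deriv g w)\<^sup>2 = R w * (g w - g z0)"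
      by (simp add: R_def power_mult_distrib power2_eq_square mult_ac)
  qed (use r in auto)
qed

text \<open>With \<open>P\<close> the monic polynomial whose zeros are the five values, \<open>Q = (deriv g)\<^sup>2 / P (g)\<close> is entire. Where
\<open>norm (g z)\<close> is large, the numerator is at most of order \<open>norm (g z) ^ 4\<close> by the spherical bound and the
denominator is of order \<open>norm (g z) ^ 5\<close>; this is why five values are used. So \<open>Q\<close> tends to 0 as \<open>g\<close>
tends to infinity. Near the five values the Landau estimate bounds \<open>Q\<close>, and elsewhere it is bounded
directly. By Liouville's theorem \<open>Q\<close> is constant; as \<open>g\<close> is unbounded, the constant is 0, and
\<open>deriv g\<close> vanishes.\<close>

theorem five_totally_ramified_values:
  fixes g :: "complex \<Rightarrow> complex"
  assumes holg: "g holomorphic_on UNIV" and "0 \<le> K" and sph: "spherically_bounded K UNIV g"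
    and A: "card A = 5" and ram: "\<And>a z. a \<in> A \<Longrightarrow> g z = a \<Longrightarrow> deriv g z = 0"
  shows "g constant_on UNIV"
proof (rule ccontr)
  assume nonconst: "\<not> g constant_on UNIV"
  have finA: "finite A" using A by (metis card.infinite zero_neq_numeral)
  define P where "P = (\<lambda>w. \<Prod>a\<in>A. w - a)"
  have holdg: "deriv g holomorphic_on UNIV" by (rule holomorphic_deriv[OF holg open_UNIV])
  have holPg: "(\<lambda>z. P (g z)) holomorphic_on UNIV" unfolding P_def by (intro holomorphic_intros holg)
  have P0: "P w = 0 \<longleftrightarrow> w \<in> A" for w using finA by (auto simp: P_def)
  have "\<not> bounded (range g)" using Liouville_theorem[OF holg] nonconst by blast
  then have gbig: "\<exists>z. b < norm (g z)" for b unfolding bounded_iff by (metis imageE not_le)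
  obtain M0 where M0: "\<And>a. a \<in> A \<Longrightarrow> norm a \<le> M0" using finite_imp_bounded[OF finA] by (auto simp: bounded_iff)
  \<comment> \<open>Beyond modulus \<open>2 * M\<close> every factor of \<open>P (g z)\<close> is at least half as large as \<open>g z\<close>.\<close>
  define M where "M = max 1 M0"
  have M: "1 \<le> M" "\<And>a. a \<in> A \<Longrightarrow> norm a \<le> M" using M0 by (auto simp: M_def le_max_iff_disj)
  obtain Q where Q: "Q holomorphic_on UNIV" "\<And>z. (deriv g z)\<^sup>2 = Q z * P (g z)"
  proof -
    obtain z1 where "M < norm (g z1)" using gbig by blast
    then have "P (g z1) \<noteq> 0" using M(2)[of "g z1"] by (auto simp: P0)
    moreover have "\<exists>R \<epsilon>. 0 < \<epsilon> \<and> R holomorphic_on ball z0 \<epsilon> \<and> (\<forall>z\<in>ball z0 \<epsilon>. (deriv g z)\<^sup>2 = R z * P (g z))" for z0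
    proof -
      define Z where "Z = (\<lambda>w. \<Prod>b\<in>A - {g z0}. w - b)"
      have "continuous_on UNIV (\<lambda>z. Z (g z))"
        unfolding Z_def by (intro continuous_intros holomorphic_on_imp_continuous_on holg)
      then have "open ((\<lambda>z. Z (g z)) -` (- {0}))" by (intro open_vimage) (auto simp: open_Compl)
      moreover have "z0 \<in> (\<lambda>z. Z (g z)) -` (- {0})" using finA by (auto simp: Z_def)
      ultimately obtain \<epsilon>1 where \<epsilon>1: "0 < \<epsilon>1" "ball z0 \<epsilon>1 \<subseteq> (\<lambda>z. Z (g z)) -` (- {0})"
        by (meson open_contains_ball)
      have holZ: "(\<lambda>z. Z (g z)) holomorphic_on UNIV" unfolding Z_def by (intro holomorphic_intros holg)
      show ?thesis
      proof (cases "g z0 \<in> A")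
        case True
        then have PZ: "P w = (w - g z0) * Z w" for w using finA by (simp add: P_def Z_def prod.remove)
        obtain R \<epsilon> where R: "0 < \<epsilon>" "R holomorphic_on ball z0 \<epsilon>"
          "\<And>z. z \<in> ball z0 \<epsilon> \<Longrightarrow> (deriv g z)\<^sup>2 = R z * (g z - g z0)"
          using deriv_square_divisible_locally[OF holg nonconst ram[OF True refl]] by blast
        have "(\<lambda>z. R z / Z (g z)) holomorphic_on ball z0 (min \<epsilon> \<epsilon>1)"
          using \<epsilon>1(2) by (intro holomorphic_on_divide holomorphic_on_subset[OF R(2)] holomorphic_on_subset[OF holZ]) auto
        moreover have "(deriv g z)\<^sup>2 = R z / Z (g z) * P (g z)" if "z \<in> ball z0 (min \<epsilon> \<epsilon>1)" for z
        proof -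
          have "Z (g z) \<noteq> 0" using \<epsilon>1(2) that by auto
          then show ?thesis using R(3)[of z] that by (simp add: PZ)
        qed
        ultimately show ?thesis using R(1) \<epsilon>1(1)
          by (intro exI[of _ "\<lambda>z. R z / Z (g z)"] exI[of _ "min \<epsilon> \<epsilon>1"] conjI ballI) auto
      next
        case False
        then have "Z = P" by (simp add: P_def Z_def)
        have "(\<lambda>z. (deriv g z)\<^sup>2 / P (g z)) holomorphic_on ball z0 \<epsilon>1"
          using \<epsilon>1(2) unfolding \<open>Z = P\<close>
          by (intro holomorphic_on_divide holomorphic_on_power holomorphic_on_subset[OF holdg] holomorphic_on_subset[OF holPg]) auto
        moreover have "(deriv g z)\<^sup>2 = (deriv g z)\<^sup>2 / P (g z) * P (g z)" if "z \<in> ball z0 \<epsilon>1" for z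
          using \<epsilon>1(2) that \<open>Z = P\<close> by auto
        ultimately show ?thesis using \<epsilon>1(1)
          by (intro exI[of _ "\<lambda>z. (deriv g z)\<^sup>2 / P (g z)"] exI[of _ \<epsilon>1] conjI ballI)
      qed
    qed
    ultimately show thesis using holomorphic_quotient_from_local[OF holPg, of z1 "\<lambda>z. (deriv g z)\<^sup>2"] that by blast
  qed
  have dg2: "norm (Q z) * norm (P (g z)) \<le> K\<^sup>2 * (1 + (norm (g z))\<^sup>2)\<^sup>2" for z
  proof -
    have "norm (Q z) * norm (P (g z)) = (norm (deriv g z))\<^sup>2"
      using arg_cong[OF Q(2)[of z], of norm] by (simp add: norm_mult norm_power)
    also have "\<dots> \<le> (K * (1 + (norm (g z))\<^sup>2))\<^sup>2"
      using sph by (intro power_mono) (auto simp: spherically_bounded_def)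
    finally show ?thesis by (simp add: power_mult_distrib)
  qed
  have far: "norm (Q z) \<le> 128 * K\<^sup>2 / norm (g z)" if z: "2 * M \<le> norm (g z)" for z
  proof -
    define t where "t = norm (g z)"
    have t: "2 * M \<le> t" "1 \<le> t" "0 < t" using z M(1) by (auto simp: t_def)
    have "(t / 2) ^ 5 = (\<Prod>a\<in>A. t / 2)" using A by simp
    also have "\<dots> \<le> (\<Prod>a\<in>A. norm (g z - a))"
    proof (rule prod_mono)
      fix a assume "a \<in> A"
      then have "t / 2 \<le> t - norm a" using M(2)[of a] t by simp
      also have "\<dots> \<le> norm (g z - a)" unfolding t_def by (rule norm_triangle_ineq2)
      finally show "0 \<le> t / 2 \<and> t / 2 \<le> norm (g z - a)" using t by simp
    qed
    also have "\<dots> = norm (P (g z))" by (simp add: P_def prod_norm)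
    finally have "norm (Q z) * (t / 2) ^ 5 \<le> norm (Q z) * norm (P (g z))" by (rule mult_left_mono) simp
    also have "\<dots> \<le> K\<^sup>2 * (1 + t\<^sup>2)\<^sup>2" using dg2 by (simp add: t_def)
    also have "\<dots> \<le> K\<^sup>2 * (2 * t\<^sup>2)\<^sup>2"
      using t power_mono[of 1 t 2] by (intro mult_left_mono power_mono) auto
    finally have "norm (Q z) * t * (t ^ 4) \<le> 128 * K\<^sup>2 * (t ^ 4)" by (simp add: power_divide power_mult_distrib eval_nat_numeral mult_ac)
    then have "norm (Q z) * t \<le> 128 * K\<^sup>2" using t by simp
    then show ?thesis using t by (simp add: le_divide_eq t_def)
  qed
  obtain \<eta> where \<eta>: "0 < \<eta>" "\<And>a b. a \<in> A \<Longrightarrow> b \<in> A \<Longrightarrow> a \<noteq> b \<Longrightarrow> 2 * \<eta> \<le> norm (a - b)"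
  proof -
    define T where "T = insert 1 ((\<lambda>(a, b). norm (a - b)) ` {(a, b). a \<in> A \<and> b \<in> A \<and> a \<noteq> b})"
    have "{(a, b). a \<in> A \<and> b \<in> A \<and> a \<noteq> b} \<subseteq> A \<times> A" by auto
    from finite_subset[OF this finite_cartesian_product[OF finA finA]] have "finite T" by (simp add: T_def)
    moreover have "0 < x" if "x \<in> T" for x using that by (auto simp: T_def)
    ultimately have "0 < Min T" "\<And>x. x \<in> T \<Longrightarrow> Min T \<le> x" by (auto simp: T_def Min_gr_iff)
    then show thesis by (intro that[of "Min T / 2"]) (auto simp: T_def image_iff)
  qed
  \<comment> \<open>On discs of this radius about points with \<open>norm (g z) \<le> 2 * M\<close>, the modulus of \<open>g\<close> stays below \<open>2 * M + 1\<close>.\<close>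
  define r where "r = 1 / (K * (1 + (2 * M + 1)\<^sup>2) + 1)"
  have Kpos: "0 \<le> K * (1 + (2 * M + 1)\<^sup>2)" using \<open>0 \<le> K\<close> by (intro mult_nonneg_nonneg) (auto simp: add_nonneg_nonneg)
  then have "0 < r" by (simp add: r_def)
  have near: "norm (Q z) \<le> 262144 * (3 * M + 1) / r\<^sup>2 / \<eta> ^ 4"
    if z: "norm (g z) \<le> 2 * M" and a: "a \<in> A" "norm (g z - a) < \<eta>" for z a
  proof -
    define Qa where "Qa = (\<lambda>w. Q w * (\<Prod>b\<in>A - {a}. g w - b))"
    have "r\<^sup>2 * norm (Qa z) \<le> 262144 * (3 * M + 1)"
    proof (rule holomorphic_square_Landau[where \<psi> = "\<lambda>w. g w - a" and Q = Qa and r = r and ?z0.0 = z])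
      show "(\<lambda>w. g w - a) holomorphic_on ball z r" "Qa holomorphic_on ball z r" unfolding Qa_def
        by (intro holomorphic_intros holomorphic_on_subset[OF holg] holomorphic_on_subset[OF Q(1)] subset_UNIV)+
      show "(deriv (\<lambda>w. g w - a) w)\<^sup>2 = Qa w * (g w - a)" for w
      proof -
        have "((\<lambda>w. g w - a) has_field_derivative deriv g w) (at w)"
          using holomorphic_derivI[OF holg open_UNIV UNIV_I] by (auto intro!: derivative_eq_intros)
        then have "deriv (\<lambda>w. g w - a) w = deriv g w" by (rule DERIV_imp_deriv)
        then show ?thesis using Q(2)[of w] a(1) finA by (simp add: Qa_def P_def prod.remove mult_ac)
      qed
      show "norm (g w - a) \<le> 3 * M + 1" if w: "w \<in> ball z r" for w
      proof -
        have "norm (g w) \<le> 2 * M + 1"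
        proof (rule spherically_bounded_growth[OF holg open_UNIV subset_UNIV sph \<open>0 \<le> K\<close> z])
          have "K * (1 + (2 * M + 1)\<^sup>2) * norm (w - z) \<le> K * (1 + (2 * M + 1)\<^sup>2) * r"
            using w Kpos by (intro mult_left_mono) (auto simp: dist_norm norm_minus_commute)
          also have "\<dots> < 1" using Kpos by (simp add: r_def divide_less_eq)
          finally show "K * (1 + (2 * M + 1)\<^sup>2) * norm (w - z) < 1" .
        qed (use M in auto)
        then show ?thesis using norm_triangle_ineq4[of "g w" a] M(2)[OF a(1)] by linarith
      qed
      show "\<not> (\<lambda>w. g w - a) constant_on ball z r"
      proof
        assume "(\<lambda>w. g w - a) constant_on ball z r"
        then obtain c where c: "\<forall>w\<in>ball z r. g w - a = c" unfolding constant_on_def by blast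
        have "g constant_on ball z r"
          unfolding constant_on_def by (rule exI[of _ "c + a"]) (use c in \<open>auto simp: diff_eq_eq\<close>)
        with constant_on_ball_imp_constant[OF holg open_UNIV connected_UNIV subset_UNIV \<open>0 < r\<close>] nonconst
        show False by blast
      qed
    qed fact
    then have "norm (Qa z) \<le> 262144 * (3 * M + 1) / r\<^sup>2" using \<open>0 < r\<close> by (simp add: le_divide_eq mult.commute)
    moreover have "norm (Q z) * \<eta> ^ 4 \<le> norm (Qa z)"
    proof -
      have "\<eta> ^ 4 = (\<Prod>b\<in>A - {a}. \<eta>)" using A a(1) finA by simp
      also have "\<dots> \<le> (\<Prod>b\<in>A - {a}. norm (g z - b))"
      proof (rule prod_mono)
        fix b assume "b \<in> A - {a}"
        then have "2 * \<eta> \<le> norm (a - b)" using \<eta>(2) a(1) by blast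
        also have "\<dots> \<le> norm (g z - a) + norm (g z - b)"
          using norm_triangle_ineq4[of "g z - b" "g z - a"] by simp
        finally show "0 \<le> \<eta> \<and> \<eta> \<le> norm (g z - b)" using a(2) \<eta>(1) by linarith
      qed
      finally show ?thesis by (simp add: Qa_def norm_mult prod_norm mult_left_mono)
    qed
    ultimately have "norm (Q z) * \<eta> ^ 4 \<le> 262144 * (3 * M + 1) / r\<^sup>2" by linarith
    then show ?thesis using \<eta>(1) by (simp only: pos_le_divide_eq zero_less_power)
  qed
  have mid: "norm (Q z) \<le> K\<^sup>2 * (1 + (2 * M)\<^sup>2)\<^sup>2 / \<eta> ^ 5"
    if z: "norm (g z) \<le> 2 * M" and a: "\<And>a. a \<in> A \<Longrightarrow> \<eta> \<le> norm (g z - a)" for z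
  proof -
    have "\<eta> ^ 5 = (\<Prod>b\<in>A. \<eta>)" using A by simp
    also have "\<dots> \<le> (\<Prod>b\<in>A. norm (g z - b))" by (rule prod_mono) (use a \<eta>(1) in auto)
    also have "\<dots> = norm (P (g z))" by (simp add: P_def prod_norm)
    finally have "norm (Q z) * \<eta> ^ 5 \<le> norm (Q z) * norm (P (g z))" by (rule mult_left_mono) simp
    also have "\<dots> \<le> K\<^sup>2 * (1 + (norm (g z))\<^sup>2)\<^sup>2" by (rule dg2)
    also have "\<dots> \<le> K\<^sup>2 * (1 + (2 * M)\<^sup>2)\<^sup>2"
      using z by (intro mult_left_mono power_mono add_left_mono) auto
    finally show ?thesis using \<eta>(1) by (simp add: le_divide_eq)
  qed
  have "bounded (range Q)"
  proof -
    define B where "B = 128 * K\<^sup>2 + \<bar>262144 * (3 * M + 1) / r\<^sup>2 / \<eta> ^ 4\<bar> + \<bar>K\<^sup>2 * (1 + (2 * M)\<^sup>2)\<^sup>2 / \<eta> ^ 5\<bar>"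
    have "norm (Q z) \<le> B" for z
    proof (cases "2 * M \<le> norm (g z)")
      case True
      have "128 * K\<^sup>2 / norm (g z) \<le> 128 * K\<^sup>2 / 1"
        using True M(1) by (intro divide_left_mono) auto
      then have "norm (Q z) \<le> 128 * K\<^sup>2" using far[OF True] by simp
      then show ?thesis unfolding B_def by linarith
    next
      case False
      then have z: "norm (g z) \<le> 2 * M" by simp
      have "norm (Q z) \<le> \<bar>262144 * (3 * M + 1) / r\<^sup>2 / \<eta> ^ 4\<bar> \<or> norm (Q z) \<le> \<bar>K\<^sup>2 * (1 + (2 * M)\<^sup>2)\<^sup>2 / \<eta> ^ 5\<bar>"
        using near[OF z] mid[OF z] by (meson abs_ge_self not_le order.trans)
      moreover have "0 \<le> 128 * K\<^sup>2" by simp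
      ultimately show ?thesis unfolding B_def by linarith
    qed
    then show ?thesis by (auto simp: bounded_iff)
  qed
  then obtain c where c: "\<And>z. Q z = c" using Liouville_theorem[OF Q(1)] by (auto simp: constant_on_def)
  have "c = 0"
  proof (rule ccontr)
    assume "c \<noteq> 0"
    obtain z where z: "max (2 * M) (128 * K\<^sup>2 / norm c) < norm (g z)" using gbig by blast
    have "0 < norm (g z)" using z M(1) by auto
    then have "norm c * norm (g z) \<le> 128 * K\<^sup>2" using far[of z] z by (simp add: c le_divide_eq)
    moreover have "128 * K\<^sup>2 < norm c * norm (g z)"
      using z \<open>c \<noteq> 0\<close> by (simp add: divide_less_eq mult.commute)
    ultimately show False by linarith
  qed
  then have "deriv g z = 0" for z using Q(2)[of z] c by simp
  then have "(g has_field_derivative 0) (at z)" for z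
    using holomorphic_derivI[OF holg open_UNIV UNIV_I, of z] by simp
  then have "g constant_on UNIV"
    using has_field_derivative_zero_constant[of UNIV g] by (auto simp: constant_on_def)
  with nonconst show False by blast
qed

section \<open>Repelling periodic points\<close>

text \<open>A locally injective holomorphic map stays injective, with an image containing a fixed disc, under small
uniform perturbations. By Cauchy's inequality the perturbed derivative stays within \<open>norm c / 2\<close> of the
constant \<open>c = deriv g \<zeta>\<close>, so that the perturbed map expands distances by at least
\<open>norm c / 2\<close>.\<close>

lemma inverse_branch_stable:
  fixes g :: "complex \<Rightarrow> complex"
  assumes holg: "g holomorphic_on UNIV" and "deriv g \<zeta> \<noteq> 0"
  obtains e \<delta> R where "0 < e" "0 < \<delta>" "0 < R"
    "\<And>G. \<lbrakk>G holomorphic_on UNIV; \<And>z. z \<in> ball \<zeta> R \<Longrightarrow> norm (G z - g z) < e\<rbrakk> \<Longrightarrow>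
      \<exists>S. S holomorphic_on ball (g \<zeta>) \<delta> \<and> S ` ball (g \<zeta>) \<delta> \<subseteq> ball \<zeta> R \<and> (\<forall>w\<in>ball (g \<zeta>) \<delta>. G (S w) = w)"
proof -
  define c where "c = deriv g \<zeta>"
  have "0 < norm c" using assms(2) by (simp add: c_def)
  have "deriv g holomorphic_on UNIV" by (rule holomorphic_deriv[OF holg open_UNIV])
  then have "isCont (deriv g) \<zeta>"
    using holomorphic_on_imp_continuous_on continuous_on_eq_continuous_at open_UNIV by blast
  then obtain R where R: "0 < R" "\<And>z. dist z \<zeta> < R \<Longrightarrow> dist (deriv g z) c < norm c / 4"
    unfolding continuous_at_eps_delta c_def using \<open>0 < norm c\<close> c_def
    by (metis zero_less_divide_iff zero_less_numeral)
  \<comment> \<open>On the half disc, perturbations below \<open>e\<close> change the derivative by at most \<open>norm c / 4\<close>, and the centre moves by less than half of the radius \<open>2 * e\<close> of a disc contained in the image.\<close>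
  define e where "e = norm c * R / 16"
  have "0 < e" using R(1) \<open>0 < norm c\<close> by (simp add: e_def)
  show thesis
  proof (rule that[OF \<open>0 < e\<close> \<open>0 < e\<close> R(1)])
    fix G assume holG: "G holomorphic_on UNIV" and close: "\<And>z. z \<in> ball \<zeta> R \<Longrightarrow> norm (G z - g z) < e"
    have dG: "norm (deriv G z - c) \<le> norm c / 2" if z: "z \<in> ball \<zeta> (R / 2)" for z
    proof -
      have "norm ((deriv ^^ 1) (\<lambda>w. G w - g w) z) \<le> fact 1 * e / (R / 4) ^ 1"
      proof (rule Cauchy_inequality[where \<xi> = z and r = "R / 4" and f = "\<lambda>w. G w - g w" and n = 1])
        show "(\<lambda>w. G w - g w) holomorphic_on ball z (R / 4)"
          by (intro holomorphic_intros holomorphic_on_subset[OF holG] holomorphic_on_subset[OF holg] subset_UNIV)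
        show "continuous_on (cball z (R / 4)) (\<lambda>w. G w - g w)"
          by (intro holomorphic_on_imp_continuous_on holomorphic_intros holomorphic_on_subset[OF holG] holomorphic_on_subset[OF holg] subset_UNIV)
        fix x assume "norm (z - x) = R / 4"
        then have "x \<in> ball \<zeta> R"
          using z R(1) dist_triangle[of \<zeta> x z] by (simp add: dist_norm)
        then show "norm (G x - g x) \<le> e" using close by (simp add: less_imp_le)
      qed (use R(1) in auto)
      moreover have "deriv (\<lambda>w. G w - g w) z = deriv G z - deriv g z"
        using holomorphic_derivI[OF holG open_UNIV UNIV_I] holomorphic_derivI[OF holg open_UNIV UNIV_I]
        by (intro DERIV_imp_deriv DERIV_diff)
      ultimately have "norm (deriv G z - deriv g z) \<le> norm c / 4" using R(1) by (simp add: e_def)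
      moreover have "norm (deriv g z - c) < norm c / 4"
        using R(2)[of z] z R(1) by (simp add: dist_norm norm_minus_commute)
      ultimately show ?thesis using norm_triangle_ineq[of "deriv G z - deriv g z" "deriv g z - c"] by simp
    qed
    have expand: "norm c / 2 * norm (x - y) \<le> norm (G x - G y)" if "x \<in> ball \<zeta> (R / 2)" "y \<in> ball \<zeta> (R / 2)" for x y
    proof -
      have "norm ((G x - c * x) - (G y - c * y)) \<le> norm c / 2 * norm (x - y)"
      proof (rule field_differentiable_bound[where S = "ball \<zeta> (R / 2)" and f' = "\<lambda>z. deriv G z - c" and f = "\<lambda>z. G z - c * z"])
        fix z assume "z \<in> ball \<zeta> (R / 2)"
        show "((\<lambda>z. G z - c * z) has_field_derivative deriv G z - c) (at z within ball \<zeta> (R / 2))"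
          using DERIV_subset[OF holomorphic_derivI[OF holG open_UNIV UNIV_I] subset_UNIV]
          by (auto intro!: derivative_eq_intros)
      qed (use dG that in auto)
      moreover have "norm (c * (x - y)) \<le> norm (G x - G y) + norm ((G x - c * x) - (G y - c * y))"
        using norm_triangle_ineq4[of "G x - G y" "(G x - c * x) - (G y - c * y)"] by (simp add: algebra_simps)
      ultimately show ?thesis by (simp add: norm_mult)
    qed
    define B where "B = ball \<zeta> (R / 4)"
    have "inj_on G B"
    proof (rule inj_onI)
      fix x y assume "x \<in> B" "y \<in> B" "G x = G y"
      then have "norm c / 2 * norm (x - y) \<le> 0" using expand[of x y] R(1) by (simp add: B_def)
      then show "x = y" using \<open>0 < norm c\<close> by (simp add: mult_le_0_iff)
    qed
    have holB: "G holomorphic_on B" using holG by (rule holomorphic_on_subset) simp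
    obtain S where S: "S holomorphic_on (G ` B)" "\<And>z. z \<in> B \<Longrightarrow> S (G z) = z"
      by (rule holomorphic_has_inverse[OF holB _ \<open>inj_on G B\<close>]) (simp_all add: B_def)
    have "ball (G \<zeta>) (2 * e) \<subseteq> G ` B"
    proof (rule ball_subset_open_map_image)
      show "continuous_on (closure B) G"
        by (rule holomorphic_on_imp_continuous_on[OF holomorphic_on_subset[OF holG subset_UNIV]])
      have "open (G ` B)"
        by (rule open_mapping_thm3[OF holB _ \<open>inj_on G B\<close>]) (simp add: B_def)
      then show "open (G ` interior B)" by (simp add: B_def interior_open)
      fix z assume "z \<in> frontier B"
      then have "norm (z - \<zeta>) = R / 4" using R(1) by (simp add: B_def frontier_ball dist_norm norm_minus_commute)
      moreover from this have "z \<in> ball \<zeta> (R / 2)" "\<zeta> \<in> ball \<zeta> (R / 2)"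
        using R(1) by (simp_all add: dist_norm norm_minus_commute)
      ultimately have "norm c / 2 * (R / 4) \<le> norm (G z - G \<zeta>)"
        using expand[of z \<zeta>] by metis
      then show "2 * e \<le> norm (G z - G \<zeta>)" by (simp add: e_def mult.commute)
    qed (use \<open>0 < e\<close> R(1) in \<open>auto simp: B_def\<close>)
    moreover have "ball (g \<zeta>) e \<subseteq> ball (G \<zeta>) (2 * e)"
    proof
      fix w assume "w \<in> ball (g \<zeta>) e"
      moreover have "dist (G \<zeta>) (g \<zeta>) < e" using close[of \<zeta>] R(1) by (simp add: dist_norm)
      ultimately show "w \<in> ball (G \<zeta>) (2 * e)" using dist_triangle[of "G \<zeta>" w "g \<zeta>"] by simp
    qed
    ultimately have sub: "ball (g \<zeta>) e \<subseteq> G ` B" by blast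
    have "S w \<in> B \<and> G (S w) = w" if "w \<in> ball (g \<zeta>) e" for w
      using sub that S(2) by force
    moreover have "B \<subseteq> ball \<zeta> R" using R(1) by (auto simp: B_def)
    ultimately show "\<exists>S. S holomorphic_on ball (g \<zeta>) e \<and> S ` ball (g \<zeta>) e \<subseteq> ball \<zeta> R \<and> (\<forall>w\<in>ball (g \<zeta>) e. G (S w) = w)"
      using holomorphic_on_subset[OF S(1) sub] by (intro exI[of _ S]) blast
  qed
qed

text \<open>The radius \<open>\<tau>\<close> of the target disc is recorded because the branches in use contract discs by a definite
factor.\<close>

definition inverse_branch :: "(complex \<Rightarrow> complex) \<Rightarrow> complex \<Rightarrow> real \<Rightarrow> complex \<Rightarrow> real \<Rightarrow> (complex \<Rightarrow> complex) \<Rightarrow> bool"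
  where "inverse_branch F b \<delta> a \<tau> S \<longleftrightarrow>
    S holomorphic_on ball b \<delta> \<and> S ` ball b \<delta> \<subseteq> ball a \<tau> \<and> (\<forall>w\<in>ball b \<delta>. F (S w) = w)"

lemma inverse_branch_mono:
  assumes "inverse_branch F b \<delta> a \<tau> S" "\<delta>' \<le> \<delta>"
  shows "inverse_branch F b \<delta>' a \<tau> S"
proof -
  have "ball b \<delta>' \<subseteq> ball b \<delta>" using assms(2) by (rule subset_ball)
  then show ?thesis using assms(1) unfolding inverse_branch_def
    by (meson holomorphic_on_subset image_mono order_trans subset_iff)
qed

lemma inverse_branch_compose:
  assumes S: "inverse_branch F b \<delta> a \<tau> S" and T: "inverse_branch G c \<epsilon> b \<delta> T"
  shows "inverse_branch (G \<circ> F) c \<epsilon> a \<tau> (S \<circ> T)"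
  unfolding inverse_branch_def
proof (intro conjI ballI)
  show "S \<circ> T holomorphic_on ball c \<epsilon>"
    using S T unfolding inverse_branch_def by (meson holomorphic_on_compose_gen)
qed (use S T in \<open>auto simp: inverse_branch_def image_subset_iff\<close>)

text \<open>Rescaled at \<open>a\<close>, the iterates converge to an entire function \<open>g\<close> that cannot be totally ramified over all
five points of \<open>A\<close>. A simple solution of \<open>g \<zeta> = b\<close> persists for the rescaled iterates and gives inverse
branches on a fixed disc about \<open>b\<close>. Undoing the rescaling moves their images into arbitrarily small
discs about \<open>a\<close>.\<close>

lemma Julia_island:
  fixes f :: "complex \<Rightarrow> complex"
  assumes holf: "f holomorphic_on UNIV" and A: "A \<subseteq> Julia f" "card A = 5" and "a \<in> A"
  obtains b \<delta> where "b \<in> A" "0 < \<delta>" "\<And>\<tau>. 0 < \<tau> \<Longrightarrow> \<exists>n S. inverse_branch (f ^^ n) b \<delta> a \<tau> S"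
proof -
  obtain n :: "nat \<Rightarrow> nat" and z :: "nat \<Rightarrow> complex" and \<rho> :: "nat \<Rightarrow> real" and g where
    Z: "\<And>k. 0 < \<rho> k" "\<rho> \<longlonglongrightarrow> 0" "z \<longlonglongrightarrow> a"
    "g holomorphic_on UNIV" "spherically_bounded 2 UNIV g" "\<not> g constant_on UNIV"
    "\<And>C. compact C \<Longrightarrow> uniform_limit C (\<lambda>k \<zeta>. (f ^^ n k) (z k + of_real (\<rho> k) * \<zeta>)) g sequentially"
    by (rule Zalcman[OF holf subsetD[OF A(1) \<open>a \<in> A\<close>]]) (assumption | blast)+
  have "\<not> (\<forall>b \<zeta>. b \<in> A \<longrightarrow> g \<zeta> = b \<longrightarrow> deriv g \<zeta> = 0)"
    using five_totally_ramified_values[OF Z(4) zero_le_numeral Z(5) A(2)] Z(6) by blast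
  then obtain b \<zeta> where b: "b \<in> A" "g \<zeta> = b" "deriv g \<zeta> \<noteq> 0" by blast
  obtain e \<delta> R where eR: "0 < e" "0 < \<delta>" "0 < R"
    "\<And>G. \<lbrakk>G holomorphic_on UNIV; \<And>z. z \<in> ball \<zeta> R \<Longrightarrow> norm (G z - g z) < e\<rbrakk> \<Longrightarrow>
      \<exists>S. S holomorphic_on ball (g \<zeta>) \<delta> \<and> S ` ball (g \<zeta>) \<delta> \<subseteq> ball \<zeta> R \<and> (\<forall>w\<in>ball (g \<zeta>) \<delta>. G (S w) = w)"
    using inverse_branch_stable[OF Z(4) b(3)] by blast
  show thesis
  proof (rule that[OF b(1) eR(2)])
    fix \<tau> :: real assume "0 < \<tau>"
    have "\<forall>\<^sub>F k in sequentially. \<forall>w\<in>cball \<zeta> R. dist ((f ^^ n k) (z k + of_real (\<rho> k) * w)) (g w) < e"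
      using uniform_limitD[OF Z(7)[OF compact_cball] eR(1)] .
    moreover have "\<forall>\<^sub>F k in sequentially. dist (z k) a < \<tau> / 2"
      by (rule tendstoD[OF Z(3)]) (use \<open>0 < \<tau>\<close> in simp)
    moreover have "\<forall>\<^sub>F k in sequentially. \<rho> k < \<tau> / 2 / (norm \<zeta> + R)"
      using order_tendstoD(2)[OF Z(2)] \<open>0 < \<tau>\<close> eR(3) by (simp add: add_nonneg_pos)
    ultimately have "\<forall>\<^sub>F k in sequentially. \<exists>S. inverse_branch (f ^^ n k) b \<delta> a \<tau> S"
    proof eventually_elim
      case (elim k)
      define L where "L = (\<lambda>w. z k + of_real (\<rho> k) * w)"
      define G where "G = (\<lambda>w. (f ^^ n k) (L w))"
      have "(f ^^ n k) \<circ> L holomorphic_on UNIV"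
        by (rule holomorphic_on_compose_gen[OF _ holomorphic_funpow[OF holf]]) (auto simp: L_def intro!: holomorphic_intros)
      then have "G holomorphic_on UNIV" by (simp add: G_def o_def)
      moreover have "norm (G w - g w) < e" if "w \<in> ball \<zeta> R" for w
        using elim(1) that by (simp add: G_def L_def dist_norm)
      ultimately obtain S where S: "S holomorphic_on ball b \<delta>" "S ` ball b \<delta> \<subseteq> ball \<zeta> R" "\<And>w. w \<in> ball b \<delta> \<Longrightarrow> G (S w) = w"
        using eR(4)[of G] b(2) by blast
      have "L ` ball \<zeta> R \<subseteq> ball a \<tau>"
      proof
        fix y assume "y \<in> L ` ball \<zeta> R"
        then obtain w where w: "w \<in> ball \<zeta> R" "y = L w" by blast
        have "norm w \<le> norm \<zeta> + R" using w(1) norm_triangle_sub[of w \<zeta>] by (simp add: dist_norm norm_minus_commute)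
        then have "norm (of_real (\<rho> k) * w) \<le> \<rho> k * (norm \<zeta> + R)" using Z(1)[of k] by (simp add: norm_mult)
        also have "\<dots> < \<tau> / 2"
          using elim(3) pos_less_divide_eq[of "norm \<zeta> + R" "\<rho> k" "\<tau> / 2"] eR(3) by (simp only: add_nonneg_pos norm_ge_zero)
        finally have "norm (y - z k) < \<tau> / 2" by (simp add: w(2) L_def)
        then show "y \<in> ball a \<tau>"
          using elim(2) dist_triangle[of a y "z k"] by (simp add: dist_norm norm_minus_commute)
      qed
      moreover have "L \<circ> S holomorphic_on ball b \<delta>"
        unfolding L_def o_def by (intro holomorphic_intros S(1))
      ultimately have "inverse_branch (f ^^ n k) b \<delta> a \<tau> (L \<circ> S)"
        using S(2,3) unfolding inverse_branch_def G_def by (auto simp: image_subset_iff)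
      then show ?case by blast
    qed
    then show "\<exists>n S. inverse_branch (f ^^ n) b \<delta> a \<tau> S"
      using eventually_happens'[OF sequentially_bot] by blast
  qed
qed

text \<open>Brouwer's theorem gives a fixed point of the branch. There Cauchy's inequality bounds the derivative of the
branch by \<open>(\<delta> / 8) / (\<delta> / 2) = 1 / 4\<close>, and the derivative of \<open>F\<close> is its reciprocal.\<close>

lemma contracting_inverse_branch_repelling:
  fixes F :: "complex \<Rightarrow> complex"
  assumes holF: "F holomorphic_on UNIV" and "0 < \<delta>" and S: "inverse_branch F b \<delta> b (\<delta> / 8) S"
  obtains p where "F p = p" "1 < norm (deriv F p)"
proof -
  have holS: "S holomorphic_on ball b \<delta>" and imS: "\<And>w. w \<in> ball b \<delta> \<Longrightarrow> S w \<in> ball b (\<delta> / 8)"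
    and FS: "\<And>w. w \<in> ball b \<delta> \<Longrightarrow> F (S w) = w"
    using S unfolding inverse_branch_def image_subset_iff by blast+
  have sub: "cball b (\<delta> / 8) \<subseteq> ball b \<delta>" using \<open>0 < \<delta>\<close> by auto
  obtain p where p: "p \<in> cball b (\<delta> / 8)" "S p = p"
  proof (rule brouwer[of "cball b (\<delta> / 8)" S])
    show "continuous_on (cball b (\<delta> / 8)) S"
      by (rule continuous_on_subset[OF holomorphic_on_imp_continuous_on[OF holS] sub])
    have "S w \<in> cball b (\<delta> / 8)" if "w \<in> cball b (\<delta> / 8)" for w
      using imS[of w] sub that by (force simp: less_imp_le)
    then show "S \<in> cball b (\<delta> / 8) \<rightarrow> cball b (\<delta> / 8)" by blast
  qed (use \<open>0 < \<delta>\<close> in auto)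
  have pin: "p \<in> ball b \<delta>" using p(1) sub by blast
  have Fp: "F p = p" using FS[OF pin] p(2) by simp
  have near: "cball p (\<delta> / 2) \<subseteq> ball b \<delta>"
  proof
    fix x assume "x \<in> cball p (\<delta> / 2)"
    then show "x \<in> ball b \<delta>" using p(1) \<open>0 < \<delta>\<close> dist_triangle[of b x p] by simp
  qed
  have hol: "(\<lambda>w. S w - b) holomorphic_on cball p (\<delta> / 2)"
    by (intro holomorphic_intros holomorphic_on_subset[OF holS near])
  have derS: "(S has_field_derivative deriv S p) (at p)" by (rule holomorphic_derivI[OF holS open_ball pin])
  have "norm ((deriv ^^ 1) (\<lambda>w. S w - b) p) \<le> fact 1 * (\<delta> / 8) / (\<delta> / 2) ^ 1"
  proof (rule Cauchy_inequality[where \<xi> = p and r = "\<delta> / 2" and f = "\<lambda>w. S w - b" and n = 1])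
    show "(\<lambda>w. S w - b) holomorphic_on ball p (\<delta> / 2)" using hol by (rule holomorphic_on_subset) auto
    show "continuous_on (cball p (\<delta> / 2)) (\<lambda>w. S w - b)" using hol by (rule holomorphic_on_imp_continuous_on)
    fix x assume "norm (p - x) = \<delta> / 2"
    then have "x \<in> ball b \<delta>" using near by (auto simp: dist_norm)
    then show "norm (S x - b) \<le> \<delta> / 8" using imS[of x] by (simp add: dist_norm norm_minus_commute)
  qed (use \<open>0 < \<delta>\<close> in auto)
  moreover have "deriv (\<lambda>w. S w - b) p = deriv S p"
    using DERIV_diff[OF derS DERIV_const[of b]] by (intro DERIV_imp_deriv) simp
  ultimately have small: "norm (deriv S p) \<le> 1 / 4" using \<open>0 < \<delta>\<close> by simp
  have "(F has_field_derivative deriv F p) (at (S p))"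
    using holomorphic_derivI[OF holF open_UNIV UNIV_I, of p] p(2) by simp
  from DERIV_chain[OF this derS] have "((\<lambda>w. w) has_field_derivative deriv F p * deriv S p) (at p)"
    by (rule has_field_derivative_transform_within_open[OF _ open_ball pin]) (use FS in auto)
  then have "deriv F p * deriv S p = 1" using DERIV_ident DERIV_unique by blast
  then have "norm (deriv F p) * norm (deriv S p) = 1" by (metis norm_mult norm_one)
  moreover have "norm (deriv F p) * norm (deriv S p) \<le> norm (deriv F p) * (1 / 4)"
    using small by (rule mult_left_mono) simp
  ultimately have "1 < norm (deriv F p)" by linarith
  with Fp show thesis by (rule that)
qed

text \<open>If the Julia set is infinite, choose five of its points. Each point \<open>a\<close> has a successor \<open>\<nu> a\<close> among the five
such that an inverse branch of an iterate leads from a disc about \<open>\<nu> a\<close> into a much smaller disc about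
\<open>a\<close>. With a common radius for the five discs the branches compose, and since the set is finite some
composition leads from a disc into a smaller one with the same centre.\<close>

theorem repelling_periodic_point:
  fixes f :: "complex \<Rightarrow> complex"
  assumes holf: "f holomorphic_on UNIV" and nonaff: "\<not> affine_map f"
  obtains n p where "(f ^^ n) p = p" "1 < norm (deriv (f ^^ n) p)"
proof (cases "finite (Julia f)")
  case True
  then show thesis using finite_Julia_imp_repelling_fixpoint[OF holf nonaff] that by metis
next
  case False
  then obtain A where A: "A \<subseteq> Julia f" "card A = 5" "finite A"
    using infinite_arbitrarily_large by metis
  have "\<forall>a\<in>A. \<exists>p. fst p \<in> A \<and> 0 < snd p \<and> (\<forall>\<tau>>0. \<exists>n S. inverse_branch (f ^^ n) (fst p) (snd p) a \<tau> S)"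
  proof
    fix a assume "a \<in> A"
    then obtain b \<delta> where "b \<in> A" "0 < \<delta>" "\<And>\<tau>. 0 < \<tau> \<Longrightarrow> \<exists>n S. inverse_branch (f ^^ n) b \<delta> a \<tau> S"
      using Julia_island[OF holf A(1,2)] by metis
    then show "\<exists>p. fst p \<in> A \<and> 0 < snd p \<and> (\<forall>\<tau>>0. \<exists>n S. inverse_branch (f ^^ n) (fst p) (snd p) a \<tau> S)"
      by (intro exI[of _ "(b, \<delta>)"]) simp
  qed
  from bchoice[OF this] obtain q where q: "\<forall>a\<in>A. fst (q a) \<in> A \<and> 0 < snd (q a) \<and>
      (\<forall>\<tau>>0. \<exists>n S. inverse_branch (f ^^ n) (fst (q a)) (snd (q a)) a \<tau> S)" ..
  define \<nu> where "\<nu> = (\<lambda>a. fst (q a))"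
  define \<delta> where "\<delta> = Min ((\<lambda>a. snd (q a)) ` A)"
  have "A \<noteq> {}" using A(2) by auto
  then have "0 < \<delta>" using q A(3) by (auto simp: \<delta>_def Min_gr_iff)
  have \<nu>A: "\<nu> a \<in> A" if "a \<in> A" for a using q that by (simp add: \<nu>_def)
  have step: "\<exists>n S. inverse_branch (f ^^ n) (\<nu> a) \<delta> a (\<delta> / 8) S" if a: "a \<in> A" for a
  proof -
    have "0 < \<delta> / 8" using \<open>0 < \<delta>\<close> by simp
    then obtain n S where S: "inverse_branch (f ^^ n) (\<nu> a) (snd (q a)) a (\<delta> / 8) S"
      using bspec[OF q a] unfolding \<nu>_def by blast
    have "\<delta> \<le> snd (q a)" using A(3) a by (simp add: \<delta>_def)
    from inverse_branch_mono[OF S this] show ?thesis by blast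
  qed
  have path: "\<exists>n S. inverse_branch (f ^^ n) ((\<nu> ^^ Suc m) a) \<delta> a (\<delta> / 8) S" if "a \<in> A" for m a
    using that
  proof (induction m arbitrary: a)
    case 0
    then show ?case using step by simp
  next
    case (Suc m)
    obtain n S where S: "inverse_branch (f ^^ n) (\<nu> a) \<delta> a (\<delta> / 8) S" using step[OF Suc.prems] by blast
    obtain n' T where "inverse_branch (f ^^ n') ((\<nu> ^^ Suc m) (\<nu> a)) \<delta> (\<nu> a) (\<delta> / 8) T"
      using Suc.IH[OF \<nu>A[OF Suc.prems]] by blast
    then have "inverse_branch (f ^^ n') ((\<nu> ^^ Suc m) (\<nu> a)) \<delta> (\<nu> a) \<delta> T"
      using \<open>0 < \<delta>\<close> subset_ball[of "\<delta> / 8" \<delta> "\<nu> a"] unfolding inverse_branch_def by auto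
    from inverse_branch_compose[OF S this]
    have "inverse_branch (f ^^ (n' + n)) ((\<nu> ^^ Suc (Suc m)) a) \<delta> a (\<delta> / 8) (S \<circ> T)"
      by (simp add: funpow_add funpow_swap1)
    then show ?case by blast
  qed
  obtain b m where b: "b \<in> A" "(\<nu> ^^ Suc m) b = b"
  proof -
    obtain a where "a \<in> A" using \<open>A \<noteq> {}\<close> by blast
    have orbit: "(\<nu> ^^ k) a \<in> A" for k by (induction k) (use \<open>a \<in> A\<close> \<nu>A in auto)
    have "\<not> inj (\<lambda>k. (\<nu> ^^ k) a)"
    proof
      assume "inj (\<lambda>k. (\<nu> ^^ k) a)"
      then have "infinite (range (\<lambda>k. (\<nu> ^^ k) a))" by (simp add: range_inj_infinite)
      moreover have "range (\<lambda>k. (\<nu> ^^ k) a) \<subseteq> A" using orbit by blast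
      ultimately show False using A(3) finite_subset by blast
    qed
    then obtain i j where "(\<nu> ^^ i) a = (\<nu> ^^ j) a" "i < j"
      unfolding inj_def by (metis linorder_neqE_nat)
    then have "(\<nu> ^^ Suc (j - Suc i)) ((\<nu> ^^ i) a) = (\<nu> ^^ i) a"
      by (metis Suc_diff_Suc add.commute comp_apply funpow_add le_add_diff_inverse less_imp_le)
    with orbit that show thesis by blast
  qed
  obtain n S where "inverse_branch (f ^^ n) b \<delta> b (\<delta> / 8) S" using path[OF b(1), of m] b(2) by auto
  then show thesis
    using contracting_inverse_branch_repelling[OF holomorphic_funpow[OF holf] \<open>0 < \<delta>\<close>] that by blast
qed

section \<open>The operator at a repelling fixed point\<close>

text \<open>Continuity of the inclusion at 0, expressed by the homogeneity of the quasi-norm as an inequality.\<close>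

lemma compact_evaluation_bounded:
  assumes qB: "quasi_Banach_space V N" and ci: "continuously_included V N" and C: "compact C"
  obtains B where "0 \<le> B" "\<And>h z. h \<in> V \<Longrightarrow> z \<in> C \<Longrightarrow> norm (h z) \<le> B * N h"
proof -
  have qn: "quasi_norm_on V N" and sub: "cfun_subspace V" and top: "topspace (quasi_norm_topology V N) = V"
    using qB by (auto simp: quasi_Banach_space_def topological_vector_space_def)
  have V: "V \<subseteq> entire_functions" and cm: "continuous_map (quasi_norm_topology V N) entire_topology (\<lambda>v. v)"
    using ci by (auto simp: continuously_included_def)
  have "0 \<in> V" using cfun.subspace_0[OF sub] .
  define U where "U = {g \<in> entire_functions. \<forall>z\<in>C. norm (g z) < 1}"
  have "openin entire_topology U"
    unfolding openin_entire_topology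
  proof (intro conjI ballI)
    fix h assume h: "h \<in> U"
    have "\<exists>e>0. \<forall>z\<in>C. norm (h z) \<le> 1 - e"
    proof (cases "C = {}")
      case True then show ?thesis by (intro exI[of _ 1]) auto
    next
      case False
      have "h holomorphic_on UNIV" using h by (simp add: U_def entire_functions_def)
      then have "continuous_on C (\<lambda>z. norm (h z))"
        by (intro continuous_on_norm holomorphic_on_imp_continuous_on) (rule holomorphic_on_subset, auto)
      then obtain x where x: "x \<in> C" "\<And>y. y \<in> C \<Longrightarrow> norm (h y) \<le> norm (h x)"
        using continuous_attains_sup[OF C False] by blast
      then show ?thesis using h by (intro exI[of _ "1 - norm (h x)"]) (auto simp: U_def)
    qed
    then obtain e where e: "0 < e" "\<And>z. z \<in> C \<Longrightarrow> norm (h z) \<le> 1 - e" by blast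
    have "g \<in> U" if g: "g \<in> entire_functions" "\<forall>z\<in>C. norm (g z - h z) < e" for g
    proof -
      have "norm (g z) < 1" if "z \<in> C" for z
      proof -
        have "norm (g z) \<le> norm (h z) + norm (g z - h z)" by (rule norm_triangle_sub)
        moreover have "norm (g z - h z) < e" using g(2) that by blast
        ultimately show ?thesis using e(2)[OF that] by linarith
      qed
      with g(1) show ?thesis by (simp add: U_def)
    qed
    with C e(1) show "\<exists>K e. compact K \<and> e > 0 \<and>
       (\<forall>g\<in>entire_functions. (\<forall>z\<in>K. norm (g z - h z) < e) \<longrightarrow> g \<in> U)" by blast
  qed (auto simp: U_def)
  from openin_continuous_map_preimage[OF cm this]
  have "openin (quasi_norm_topology V N) {v \<in> V. v \<in> U}" by (simp add: top)
  moreover have "0 \<in> {v \<in> V. v \<in> U}" using \<open>0 \<in> V\<close> V by (auto simp: U_def)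
  ultimately obtain r where r: "0 < r" "\<And>w. w \<in> V \<Longrightarrow> N (w - 0) < r \<Longrightarrow> w \<in> U"
    unfolding openin_quasi_norm_topology by blast
  show thesis
  proof (rule that[of "2 / r"])
    fix h z assume h: "h \<in> V" and z: "z \<in> C"
    have "0 \<le> N h" using qn h by (simp add: quasi_norm_on_def)
    show "norm (h z) \<le> 2 / r * N h"
    proof (cases "N h = 0")
      case True
      then have "h = 0" using qn h by (simp add: quasi_norm_on_def)
      then show ?thesis using True by simp
    next
      case False
      with \<open>0 \<le> N h\<close> have "0 < N h" by simp
      define c where "c = r / (2 * N h)"
      have "0 < c" using r(1) \<open>0 < N h\<close> by (simp add: c_def)
      have cV: "cscale (of_real c) h \<in> V" by (rule cfun.subspace_scale[OF sub h])
      have "N (cscale (of_real c) h) = norm (of_real c :: complex) * N h"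
        using qn h by (simp add: quasi_norm_on_def)
      also have "\<dots> = c * N h" using \<open>0 < c\<close> by simp
      also have "\<dots> = r / 2" using \<open>0 < N h\<close> by (simp add: c_def)
      finally have "N (cscale (of_real c) h - 0) < r" using r(1) by simp
      from r(2)[OF cV this] z have "norm (cscale (of_real c) h z) < 1" by (simp add: U_def)
      then have "c * norm (h z) < 1" using \<open>0 < c\<close> by (simp add: cscale_def norm_mult)
      then show ?thesis using r(1) \<open>0 < N h\<close> by (simp add: c_def field_simps)
    qed
  qed (use r(1) in simp)
qed

definition vanishes_to_order :: "complex \<Rightarrow> nat \<Rightarrow> (complex \<Rightarrow> complex) \<Rightarrow> bool"
  where "vanishes_to_order p k h \<longleftrightarrow> (\<exists>g. g holomorphic_on UNIV \<and> (\<forall>z. h z = (z - p) ^ k * g z))"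

lemma entire_divide_zero:
  assumes "g holomorphic_on UNIV"
  obtains q where "q holomorphic_on UNIV" "\<And>z. g z = g p + (z - p) * q z" "q p = deriv g p"
proof (rule that[of "\<lambda>z. if z = p then deriv g p else (g z - g p) / (z - p)"])
  show "(\<lambda>z. if z = p then deriv g p else (g z - g p) / (z - p)) holomorphic_on UNIV"
    by (rule pole_lemma_open[OF assms open_UNIV])
qed auto

text \<open>Each further order of vanishing imposes one linear condition, the vanishing of the next Taylor coefficient
at \<open>p\<close>. If some \<open>h0\<close> fails it, every element of the larger space differs from a multiple of \<open>h0\<close> by an
element of the smaller one; a finite spanning set of the smaller space together with \<open>h0\<close> would span
the larger one.\<close>

lemma infinite_dimensional_vanishing:
  assumes inf: "infinite_dimensional V" and sub: "cfun_subspace V" and V: "V \<subseteq> entire_functions"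
  shows "infinite_dimensional {h \<in> V. vanishes_to_order p k h}"
proof (induction k)
  case 0
  have "{h \<in> V. vanishes_to_order p 0 h} = V"
    using V by (auto simp: vanishes_to_order_def entire_functions_def)
  then show ?case using inf by simp
next
  case (Suc k)
  let ?W = "\<lambda>k. {h \<in> V. vanishes_to_order p k h}"
  have Suc_sub: "?W (Suc k) \<subseteq> ?W k"
  proof
    fix h assume "h \<in> ?W (Suc k)"
    then obtain g where g: "h \<in> V" "g holomorphic_on UNIV" "\<And>z. h z = (z - p) ^ Suc k * g z"
      unfolding vanishes_to_order_def by blast
    have "(\<lambda>z. (z - p) * g z) holomorphic_on UNIV" by (intro holomorphic_intros g(2))
    moreover have "h z = (z - p) ^ k * ((z - p) * g z)" for z using g(3)[of z] by simp
    ultimately have "vanishes_to_order p k h" unfolding vanishes_to_order_def by blast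
    with g(1) show "h \<in> ?W k" by simp
  qed
  show ?case
    unfolding infinite_dimensional_def
  proof
    assume "\<exists>B. finite B \<and> B \<subseteq> ?W (Suc k) \<and> ?W (Suc k) \<subseteq> cfun_span B"
    then obtain B where B: "finite B" "B \<subseteq> ?W (Suc k)" "?W (Suc k) \<subseteq> cfun_span B" by blast
    show False
    proof (cases "?W k \<subseteq> ?W (Suc k)")
      case True
      with B Suc_sub have "\<exists>B. finite B \<and> B \<subseteq> ?W k \<and> ?W k \<subseteq> cfun_span B" by (meson order_trans)
      with Suc show False by (simp add: infinite_dimensional_def)
    next
      case False
      then obtain h0 where h0: "h0 \<in> V" "vanishes_to_order p k h0" "\<not> vanishes_to_order p (Suc k) h0" by blast
      then obtain g0 where g0: "g0 holomorphic_on UNIV" "\<And>z. h0 z = (z - p) ^ k * g0 z"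
        unfolding vanishes_to_order_def by blast
      have divisible: "vanishes_to_order p (Suc k) h"
        if g: "g holomorphic_on UNIV" "\<And>z. h z = (z - p) ^ k * g z" "g p = 0" for h g
      proof -
        obtain q where q: "q holomorphic_on UNIV" "\<And>z. g z = g p + (z - p) * q z"
          by (rule entire_divide_zero[OF g(1), of p]) (rule that, assumption+)
        then have "h z = (z - p) ^ Suc k * q z" for z using g(2)[of z] q(2)[of z] g(3) by (simp add: mult_ac)
        with q(1) show ?thesis unfolding vanishes_to_order_def by blast
      qed
      have "g0 p \<noteq> 0" using divisible[OF g0] h0(3) by blast
      have "?W k \<subseteq> cfun_span (insert h0 B)"
      proof
        fix h assume "h \<in> ?W k"
        then obtain g where h: "h \<in> V" "g holomorphic_on UNIV" "\<And>z. h z = (z - p) ^ k * g z"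
          unfolding vanishes_to_order_def by blast
        define c where "c = g p / g0 p"
        have "h - cscale c h0 \<in> V" by (intro cfun.subspace_diff[OF sub] cfun.subspace_scale[OF sub] h h0)
        moreover have "vanishes_to_order p (Suc k) (h - cscale c h0)"
        proof (rule divisible)
          show "(\<lambda>z. g z - c * g0 z) holomorphic_on UNIV" by (intro holomorphic_intros h g0)
          show "(h - cscale c h0) z = (z - p) ^ k * (g z - c * g0 z)" for z
            by (simp add: h(3) g0(2) cscale_def algebra_simps)
          show "g p - c * g0 p = 0" using \<open>g0 p \<noteq> 0\<close> by (simp add: c_def)
        qed
        ultimately have "h - cscale c h0 \<in> cfun_span B" using B(3) by blast
        then have "h - cscale c h0 \<in> cfun_span (insert h0 B)"
          using cfun.span_mono[of B "insert h0 B"] by blast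
        moreover have "cscale c h0 \<in> cfun_span (insert h0 B)"
          by (intro cfun.span_scale cfun.span_base) simp
        ultimately have "(h - cscale c h0) + cscale c h0 \<in> cfun_span (insert h0 B)" by (rule cfun.span_add)
        then show "h \<in> cfun_span (insert h0 B)" by simp
      qed
      moreover have "insert h0 B \<subseteq> ?W k" using h0 B(2) Suc_sub by auto
      ultimately have "\<exists>B. finite B \<and> B \<subseteq> ?W k \<and> ?W k \<subseteq> cfun_span B"
        using B(1) by (intro exI[of _ "insert h0 B"] conjI) auto
      with Suc show False by (simp add: infinite_dimensional_def)
    qed
  qed
qed

lemma entire_eq_at_point:
  fixes g h :: "complex \<Rightarrow> complex"
  assumes "continuous (at p) g" "continuous (at p) h" and "0 < r"
    and eq: "\<And>z. z \<noteq> p \<Longrightarrow> dist z p < r \<Longrightarrow> g z = h z"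
  shows "g p = h p"
proof -
  have "\<forall>\<^sub>F z in at p. g z = h z"
    unfolding eventually_at using eq \<open>0 < r\<close> by blast
  then have "(h \<longlongrightarrow> g p) (at p)"
    using assms(1) by (simp add: continuous_within Lim_transform_eventually)
  moreover have "(h \<longlongrightarrow> h p) (at p)" using assms(2) by (simp add: continuous_within)
  ultimately show ?thesis using tendsto_unique[OF at_neq_bot] by blast
qed

lemma entire_isCont: "g holomorphic_on UNIV \<Longrightarrow> continuous (at z) g"
  using holomorphic_on_imp_continuous_on continuous_on_eq_continuous_at open_UNIV by blast

lemma entire_order_factorization:
  assumes holh: "h holomorphic_on UNIV" and nz: "h z1 \<noteq> 0"
  obtains j g where "g holomorphic_on UNIV" "g p \<noteq> 0" "\<And>z. h z = (z - p) ^ j * g z"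
proof -
  have "(if h p = 0 then 0 < zorder h p else zorder h p = 0) \<and>
      (\<exists>r. 0 < r \<and> cball p r \<subseteq> UNIV \<and> zor_poly h p holomorphic_on cball p r \<and>
        (\<forall>w\<in>cball p r. h w = zor_poly h p w * (w - p) ^ nat (zorder h p) \<and> zor_poly h p w \<noteq> 0))"
    by (rule zorder_exist_zero[OF holh open_UNIV connected_UNIV UNIV_I]) (use nz in blast)
  then obtain r where r: "0 < r" "zor_poly h p holomorphic_on cball p r"
    "\<And>w. w \<in> cball p r \<Longrightarrow> h w = zor_poly h p w * (w - p) ^ nat (zorder h p) \<and> zor_poly h p w \<noteq> 0"
    by blast
  define e where "e = zor_poly h p"
  define j where "j = nat (zorder h p)"
  have hole: "e holomorphic_on ball p r" using holomorphic_on_subset[OF r(2) ball_subset_cball] by (simp add: e_def)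
  have he: "h w = e w * (w - p) ^ j" "e w \<noteq> 0" if "w \<in> ball p r" for w
    using r(3)[of w] that by (simp_all add: e_def j_def)
  have holu: "(\<lambda>z. (z - p) ^ j) holomorphic_on UNIV" by (intro holomorphic_intros)
  have unz: "(p + 1 - p) ^ j \<noteq> 0" by simp
  have loc: "\<exists>R \<epsilon>. 0 < \<epsilon> \<and> R holomorphic_on ball z0 \<epsilon> \<and> (\<forall>z\<in>ball z0 \<epsilon>. h z = R z * (z - p) ^ j)" for z0
  proof (cases "z0 = p")
    case True
    then show ?thesis using r(1) hole he(1) by blast
  next
    case False
    have np: "z \<noteq> p" if "z \<in> ball z0 (dist z0 p)" for z using that by auto
    have "(\<lambda>z. h z / (z - p) ^ j) holomorphic_on ball z0 (dist z0 p)"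
      using np by (intro holomorphic_intros holomorphic_on_subset[OF holh]) auto
    moreover have "h z = h z / (z - p) ^ j * (z - p) ^ j" if "z \<in> ball z0 (dist z0 p)" for z using np[OF that] by simp
    ultimately show ?thesis using False
      by (intro exI[of _ "\<lambda>z. h z / (z - p) ^ j"] exI[of _ "dist z0 p"] conjI ballI) auto
  qed
  obtain Q where Q: "Q holomorphic_on UNIV" "\<And>z. h z = Q z * (z - p) ^ j"
    by (rule holomorphic_quotient_from_local[OF holu unz loc]) (rule that, assumption+)
  have "Q p = e p"
  proof (rule entire_eq_at_point[where g = Q and h = e and p = p, OF entire_isCont[OF Q(1)] _ r(1)])
    have "p \<in> ball p r" using r(1) by simp
    then show "continuous (at p) e"
      using holomorphic_on_imp_continuous_on[OF hole] continuous_on_eq_continuous_at[OF open_ball] by blast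
    fix z assume "z \<noteq> p" "dist z p < r"
    then show "Q z = e z" using he(1)[of z] Q(2)[of z] by (simp add: dist_commute)
  qed
  then have "Q p \<noteq> 0" using he(2)[of p] r(1) by simp
  with Q show thesis by (intro that[of Q j]) (simp_all add: mult.commute)
qed

lemma vanishes_to_order_le:
  assumes "vanishes_to_order p k h" and g: "g holomorphic_on UNIV" "g p \<noteq> 0" "\<And>z. h z = (z - p) ^ j * g z"
  shows "k \<le> j"
proof (rule ccontr)
  assume "\<not> k \<le> j"
  define d where "d = k - Suc j"
  have k: "k = Suc d + j" using \<open>\<not> k \<le> j\<close> by (simp add: d_def)
  obtain q where q: "q holomorphic_on UNIV" "\<And>z. h z = (z - p) ^ k * q z"
    using assms(1) unfolding vanishes_to_order_def by blast
  have "(\<lambda>z. (z - p) ^ Suc d * q z) holomorphic_on UNIV" by (intro holomorphic_intros q(1))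
  then have "g p = (p - p) ^ Suc d * q p"
  proof (intro entire_eq_at_point[where g = g and h = "\<lambda>z. (z - p) ^ Suc d * q z" and p = p, OF _ _ zero_less_one] entire_isCont g(1))
    fix z assume "z \<noteq> p"
    then show "g z = (z - p) ^ Suc d * q z"
      using g(3)[of z] q(2)[of z] by (simp add: k power_add mult_ac)
  qed
  with g(2) show False by simp
qed

text \<open>Let \<open>\<mu>\<close> be the multiplier of \<open>F\<close> at \<open>p\<close>, write \<open>w z = (z - p) ^ m * w1 z\<close> with \<open>w1 p \<noteq> 0\<close>, and let \<open>h\<close> vanish
to order \<open>e\<close> at \<open>p\<close>. Then the image of \<open>h\<close> under the operator vanishes to order \<open>m + e\<close>, and its leading
coefficient is that of \<open>h\<close> times \<open>w1 p * \<mu> ^ e\<close>. In an infinite-dimensional space there is an \<open>h \<noteq> 0\<close> with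
\<open>e \<ge> k\<close>, where \<open>k\<close> makes \<open>norm (w1 p) * norm \<mu> ^ k\<close> exceed twice the norm bound \<open>D\<close> of the operator. Orders
of vanishing never decrease, so leading coefficients grow at least like \<open>(2 * D) ^ n\<close> along the
iteration, while quasi-norms grow at most like \<open>D ^ n\<close>. This is impossible since the leading coefficient is
bounded by the maximum on the circle of radius 1, whatever the order of vanishing.\<close>

lemma repelling_fixpoint_unbounded:
  assumes qB: "quasi_Banach_space V N" and ci: "continuously_included V N" and inf: "infinite_dimensional V"
    and holF: "F holomorphic_on UNIV" and Fp: "F p = p" and rep: "1 < norm (deriv F p)"
    and holw: "w holomorphic_on UNIV" and wnz: "w z1 \<noteq> 0"
    and TV: "\<And>h. h \<in> V \<Longrightarrow> weighted_comp w F h \<in> V"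
    and TN: "\<And>h. h \<in> V \<Longrightarrow> N (weighted_comp w F h) \<le> C * N h"
  shows False
proof -
  have sub: "cfun_subspace V" and qn: "quasi_norm_on V N"
    using qB by (auto simp: quasi_Banach_space_def topological_vector_space_def)
  have V: "V \<subseteq> entire_functions" using ci by (simp add: continuously_included_def)
  have N0: "0 \<le> N h" if "h \<in> V" for h using qn that by (simp add: quasi_norm_on_def)
  define T where "T = weighted_comp w F"
  \<comment> \<open>A positive bound, so that powers of it can be cancelled.\<close>
  define D where "D = max C 1"
  have "1 \<le> D" by (simp add: D_def)
  have TD: "N (T h) \<le> D * N h" if "h \<in> V" for h
  proof -
    have "C * N h \<le> D * N h" by (rule mult_right_mono[OF _ N0[OF that]]) (simp add: D_def)
    with TN[OF that] show ?thesis unfolding T_def by linarith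
  qed
  define \<mu> where "\<mu> = deriv F p"
  obtain F1 where F1: "F1 holomorphic_on UNIV" "\<And>z. F z = F p + (z - p) * F1 z" "F1 p = \<mu>"
  proof (rule entire_divide_zero[OF holF, of p])
    fix q assume q: "q holomorphic_on UNIV" "\<And>z. F z = F p + (z - p) * q z" "q p = deriv F p"
    from q(3) have "q p = \<mu>" by (simp only: \<mu>_def)
    with q(1,2) show thesis by (rule that)
  qed
  obtain m w1 where w1: "w1 holomorphic_on UNIV" "w1 p \<noteq> 0" "\<And>z. w z = (z - p) ^ m * w1 z"
  proof (rule entire_order_factorization[OF holw wnz, of p])
    fix j g assume "g holomorphic_on UNIV" "g p \<noteq> 0" "\<And>z. w z = (z - p) ^ j * g z"
    then show thesis by (rule that)
  qed
  obtain k where "2 * D / norm (w1 p) < norm \<mu> ^ k"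
    using real_arch_pow[OF rep, of "2 * D / norm (w1 p)"] unfolding \<mu>_def by blast
  then have k: "2 * D < norm (w1 p) * norm \<mu> ^ k" using w1(2) by (simp add: divide_less_eq mult.commute)
  obtain h where h: "h \<in> V" "vanishes_to_order p k h" "h \<noteq> 0"
  proof -
    have "\<not> {h \<in> V. vanishes_to_order p k h} \<subseteq> {0}"
    proof
      assume "{h \<in> V. vanishes_to_order p k h} \<subseteq> {0}"
      then have "{h \<in> V. vanishes_to_order p k h} \<subseteq> cfun_span {}" using cfun.span_zero by blast
      with infinite_dimensional_vanishing[OF inf sub V, of p k] show False
        unfolding infinite_dimensional_def by blast
    qed
    with that show thesis by blast
  qed
  have holh: "h holomorphic_on UNIV" using h(1) V by (auto simp: entire_functions_def)
  obtain z2 where z2: "h z2 \<noteq> 0" using h(3) by (auto simp: fun_eq_iff)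
  obtain j g where g: "g holomorphic_on UNIV" "g p \<noteq> 0" "\<And>z. h z = (z - p) ^ j * g z"
  proof (rule entire_order_factorization[OF holh z2, of p])
    fix j g assume "g holomorphic_on UNIV" "g p \<noteq> 0" "\<And>z. h z = (z - p) ^ j * g z"
    then show thesis by (rule that)
  qed
  have "k \<le> j" by (rule vanishes_to_order_le[OF h(2) g])
  have iter: "(T ^^ n) h \<in> V \<and> N ((T ^^ n) h) \<le> D ^ n * N h \<and>
      (\<exists>e H. k \<le> e \<and> H holomorphic_on UNIV \<and> (\<forall>z. (T ^^ n) h z = (z - p) ^ e * H z) \<and> norm (g p) * (2 * D) ^ n \<le> norm (H p))" for n
  proof (induction n)
    case 0
    have "h \<in> V \<and> N h \<le> 1 * N h" using h(1) by simp
    moreover have "\<exists>e H. k \<le> e \<and> H holomorphic_on UNIV \<and> (\<forall>z. h z = (z - p) ^ e * H z) \<and> norm (g p) * 1 \<le> norm (H p)"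
      by (intro exI[of _ j] exI[of _ g] conjI allI g \<open>k \<le> j\<close>) simp
    ultimately show ?case unfolding funpow_0 power_0 by blast
  next
    case (Suc n)
    then obtain e H where IH: "(T ^^ n) h \<in> V" "N ((T ^^ n) h) \<le> D ^ n * N h" "k \<le> e" "H holomorphic_on UNIV"
      "\<And>z. (T ^^ n) h z = (z - p) ^ e * H z" "norm (g p) * (2 * D) ^ n \<le> norm (H p)" by blast
    define H' where "H' = (\<lambda>z. w1 z * F1 z ^ e * H (F z))"
    have "N (T ((T ^^ n) h)) \<le> D * N ((T ^^ n) h)" by (rule TD[OF IH(1)])
    also have "\<dots> \<le> D * (D ^ n * N h)" using IH(2) \<open>1 \<le> D\<close> by (intro mult_left_mono) auto
    finally have "N ((T ^^ Suc n) h) \<le> D ^ Suc n * N h" by (simp add: mult.assoc)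
    moreover have "(T ^^ Suc n) h \<in> V" using TV[OF IH(1)] by (simp add: T_def)
    moreover have "H' holomorphic_on UNIV"
    proof -
      have "H \<circ> F holomorphic_on UNIV" by (rule holomorphic_on_compose_gen[OF holF IH(4)]) auto
      then show ?thesis unfolding H'_def by (intro holomorphic_intros w1(1) F1(1)) (simp add: o_def)
    qed
    moreover have "(T ^^ Suc n) h z = (z - p) ^ (m + e) * H' z" for z
    proof -
      have "(T ^^ Suc n) h z = w z * ((F z - p) ^ e * H (F z))"
        by (simp add: T_def weighted_comp_def IH(5)[unfolded T_def])
      also have "F z - p = (z - p) * F1 z" using F1(2)[of z] Fp by simp
      finally show ?thesis by (simp add: H'_def w1(3) power_add power_mult_distrib mult_ac)
    qed
    moreover have "norm (g p) * (2 * D) ^ Suc n \<le> norm (H' p)"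
    proof -
      have "norm \<mu> ^ k \<le> norm \<mu> ^ e" using rep IH(3) by (intro power_increasing) (auto simp: \<mu>_def)
      then have "norm (w1 p) * norm \<mu> ^ k \<le> norm (w1 p) * norm \<mu> ^ e" by (rule mult_left_mono) simp
      then have "2 * D \<le> norm (w1 p) * norm \<mu> ^ e" using k by linarith
      from mult_mono[OF this IH(6)]
      have "(2 * D) * (norm (g p) * (2 * D) ^ n) \<le> (norm (w1 p) * norm \<mu> ^ e) * norm (H p)"
        using \<open>1 \<le> D\<close> by simp
      then show ?thesis by (simp add: H'_def F1(3) Fp norm_mult norm_power mult_ac)
    qed
    moreover have "k \<le> m + e" using IH(3) by simp
    ultimately show ?case by blast
  qed
  obtain B where B: "0 \<le> B" "\<And>h z. h \<in> V \<Longrightarrow> z \<in> sphere p 1 \<Longrightarrow> norm (h z) \<le> B * N h"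
    using compact_evaluation_bounded[OF qB ci compact_sphere] by blast
  have bound: "norm (g p) * 2 ^ n \<le> B * N h" for n
  proof -
    obtain e H where H: "(T ^^ n) h \<in> V" "N ((T ^^ n) h) \<le> D ^ n * N h" "H holomorphic_on UNIV"
      "\<And>z. (T ^^ n) h z = (z - p) ^ e * H z" "norm (g p) * (2 * D) ^ n \<le> norm (H p)" using iter[of n] by blast
    have "norm (H p) \<le> B * (D ^ n * N h)"
    proof (rule maximum_modulus_frontier[where S = "cball p 1" and f = H and \<xi> = p])
      show "H holomorphic_on interior (cball p 1)" using H(3) by (rule holomorphic_on_subset) simp
      show "continuous_on (closure (cball p 1)) H"
        by (rule holomorphic_on_imp_continuous_on[OF holomorphic_on_subset[OF H(3) subset_UNIV]])
      fix z assume "z \<in> frontier (cball p 1)"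
      then have z: "z \<in> sphere p 1" by (simp add: frontier_cball)
      then have "norm (z - p) = 1" by (simp add: dist_norm norm_minus_commute)
      then have "norm (H z) = norm ((T ^^ n) h z)" by (simp add: H(4) norm_mult norm_power)
      also have "\<dots> \<le> B * N ((T ^^ n) h)" by (rule B(2)[OF H(1) z])
      also have "\<dots> \<le> B * (D ^ n * N h)" by (rule mult_left_mono[OF H(2) B(1)])
      finally show "norm (H z) \<le> B * (D ^ n * N h)" .
    qed auto
    with H(5) have "(norm (g p) * 2 ^ n) * D ^ n \<le> (B * N h) * D ^ n"
      by (simp add: power_mult_distrib mult_ac)
    then show ?thesis using \<open>1 \<le> D\<close> by simp
  qed
  obtain n where "B * N h / norm (g p) < 2 ^ n" using real_arch_pow[of 2] by auto
  then have "B * N h < norm (g p) * 2 ^ n" using g(2) by (simp add: divide_less_eq mult.commute)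
  with bound[of n] show False by simp
qed

text \<open>Iterates of a weighted composition operator along \<open>f\<close> are weighted composition operators along iterates of
\<open>f\<close>. Their weights do not vanish identically because \<open>f\<close> is an open map.\<close>

lemma weighted_comp_power:
  assumes holf: "f holomorphic_on UNIV" and nonconst: "\<not> f constant_on UNIV"
    and holu: "u holomorphic_on UNIV" and unz: "u z0 \<noteq> 0"
    and bdd: "weighted_comp_bounded V N u f" and N0: "\<And>h. h \<in> V \<Longrightarrow> 0 \<le> N h"
  shows "\<exists>w C. w holomorphic_on UNIV \<and> (\<exists>z. w z \<noteq> 0) \<and>
    (\<forall>h\<in>V. weighted_comp w (f ^^ n) h \<in> V \<and> N (weighted_comp w (f ^^ n) h) \<le> C * N h)"
proof (induction n)
  case 0
  show ?case by (intro exI[of _ "\<lambda>z. 1"] exI[of _ 1]) (simp add: weighted_comp_def)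
next
  case (Suc n)
  then obtain w C where w: "w holomorphic_on UNIV" "\<exists>z. w z \<noteq> 0"
    "\<And>h. h \<in> V \<Longrightarrow> weighted_comp w (f ^^ n) h \<in> V"
    "\<And>h. h \<in> V \<Longrightarrow> N (weighted_comp w (f ^^ n) h) \<le> C * N h" by blast
  have dom: "weighted_comp_domain V u f = V"
    using bdd by (simp add: weighted_comp_bounded_def)
  have uV: "weighted_comp u f h \<in> V" if "h \<in> V" for h
    using that dom by (auto simp: weighted_comp_domain_def)
  obtain C' where C': "\<And>h. h \<in> V \<Longrightarrow> N (weighted_comp u f h) \<le> C' * N h"
    using bdd by (auto simp: weighted_comp_bounded_def)
  define v where "v = (\<lambda>z. u z * w (f z))"
  have comp: "weighted_comp v (f ^^ Suc n) h = weighted_comp u f (weighted_comp w (f ^^ n) h)" for h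
    by (simp add: weighted_comp_def v_def funpow_swap1 mult.assoc)
  have "w \<circ> f holomorphic_on UNIV" by (rule holomorphic_on_compose_gen[OF holf w(1)]) auto
  then have holv: "v holomorphic_on UNIV" unfolding v_def by (intro holomorphic_intros holu) (simp add: o_def)
  have "\<exists>z. v z \<noteq> 0"
  proof (rule ccontr)
    assume v0: "\<not> ?thesis"
    define U where "U = u -` (- {0})"
    have "open U" unfolding U_def
      using holomorphic_on_imp_continuous_on[OF holu] by (intro open_vimage) (auto simp: open_Compl)
    then have "open (f ` U)"
      by (rule open_mapping_thm[OF holf open_UNIV connected_UNIV _ subset_UNIV nonconst])
    moreover have "f ` U \<noteq> {}" using unz by (auto simp: U_def)
    moreover have "w y = 0" if "y \<in> f ` U" for y using that v0 by (auto simp: v_def U_def)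
    ultimately have "w y = 0" for y
      using analytic_continuation_open[OF _ open_UNIV _ connected_UNIV subset_UNIV w(1) holomorphic_on_const[of 0], of "f ` U"]
      by blast
    with w(2) show False by blast
  qed
  moreover have "weighted_comp v (f ^^ Suc n) h \<in> V \<and> N (weighted_comp v (f ^^ Suc n) h) \<le> (\<bar>C'\<bar> * C) * N h"
    if h: "h \<in> V" for h
  proof -
    have "N (weighted_comp v (f ^^ Suc n) h) \<le> C' * N (weighted_comp w (f ^^ n) h)"
      unfolding comp by (rule C'[OF w(3)[OF h]])
    also have "\<dots> \<le> \<bar>C'\<bar> * N (weighted_comp w (f ^^ n) h)"
      by (rule mult_right_mono[OF abs_ge_self N0[OF w(3)[OF h]]])
    also have "\<dots> \<le> \<bar>C'\<bar> * (C * N h)" by (rule mult_left_mono[OF w(4)[OF h]]) simp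
    finally show ?thesis using uV[OF w(3)[OF h], folded comp] by (simp only: mult.assoc simp_thms)
  qed
  ultimately show ?case using holv by (intro exI[of _ v] exI[of _ "\<bar>C'\<bar> * C"]) blast
qed

theorem corollary1p8:
  fixes V :: "(complex \<Rightarrow> complex) set"
    and N :: "(complex \<Rightarrow> complex) \<Rightarrow> real"
    and f u :: "complex \<Rightarrow> complex"
  assumes "quasi_Banach_space V N"
    and "infinite_dimensional V"
    and "continuously_included V N"
    and "f \<in> entire_functions"
    and "u \<in> entire_functions - {0}"
    and "weighted_comp_bounded V N u f"
  shows "\<exists>a b. norm a \<le> 1 \<and> (\<forall>z. f z = a * z + b)"
proof (rule ccontr)
  assume contr: "\<not> (\<exists>a b. norm a \<le> 1 \<and> (\<forall>z. f z = a * z + b))"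
  have holf: "f holomorphic_on UNIV" and holu: "u holomorphic_on UNIV"
    using assms(4,5) by (auto simp: entire_functions_def)
  obtain z0 where unz: "u z0 \<noteq> 0" using assms(5) by (auto simp: fun_eq_iff)
  have nonconst: "\<not> f constant_on UNIV"
  proof
    assume "f constant_on UNIV"
    then obtain c where "\<And>z. f z = c" by (auto simp: constant_on_def)
    then have "norm (0 :: complex) \<le> 1 \<and> (\<forall>z. f z = 0 * z + c)" by simp
    with contr show False by blast
  qed
  obtain n p where p: "(f ^^ n) p = p" "1 < norm (deriv (f ^^ n) p)"
  proof (cases "affine_map f")
    case True
    then obtain a b where ab: "\<And>z. f z = a * z + b" by (auto simp: affine_map_def)
    then have a: "1 < norm a" using contr by (metis not_le)
    then have "a \<noteq> 1" by auto
    have "f (b / (1 - a)) = b / (1 - a)" unfolding ab using \<open>a \<noteq> 1\<close> by (simp add: field_simps)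
    moreover have "(f has_field_derivative a) (at z)" for z
    proof -
      have "((\<lambda>z. a * z + b) has_field_derivative a) (at z)" by (auto intro!: derivative_eq_intros)
      moreover have "(\<lambda>z. a * z + b) = f" using ab by (auto simp: fun_eq_iff)
      ultimately show ?thesis by simp
    qed
    then have "deriv f z = a" for z by (intro DERIV_imp_deriv)
    ultimately show thesis using a by (intro that[of 1 "b / (1 - a)"]) simp_all
  next
    case False
    then show thesis using repelling_periodic_point[OF holf] that by blast
  qed
  have N0: "0 \<le> N h" if "h \<in> V" for h
    using assms(1) that by (simp add: quasi_Banach_space_def quasi_norm_on_def)
  obtain w C z1 where w: "w holomorphic_on UNIV" "w z1 \<noteq> 0"
    "\<And>h. h \<in> V \<Longrightarrow> weighted_comp w (f ^^ n) h \<in> V"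
    "\<And>h. h \<in> V \<Longrightarrow> N (weighted_comp w (f ^^ n) h) \<le> C * N h"
    using weighted_comp_power[OF holf nonconst holu unz assms(6) N0, of n] by blast
  show False
    by (rule repelling_fixpoint_unbounded[OF assms(1,3,2) holomorphic_funpow[OF holf] p w])
qed

end
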